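(* Let $p\ge 0$ be a fixed integer constant. The problem \textsc{Parameterized Equal Clustering} (with the $\ell_p$-norm), parameterized by the budget $B$, admits a $2$-approximate kernel in which the output instance $(\mathbf{X}',k',B')$ consists of a collection $\mathbf{X}'$ of $\mathcal{O}(B^2)$ points of $\mathbb{Z}^{d'}$ with $d'=\mathcal{O}(B^{p+2})$, each coordinate of each point having absolute value $\mathcal{O}(B^3)$.
   Context: For a nonnegative integer $p$ and $\mathbf{x}\in\mathbb{R}^d$, $\|\mathbf{x}\|_p=(\sum_{i=1}^d|x[i]|^p)^{1/p}$ for $p\ge1$, and $\|\mathbf{x}\|_0$ is the number of nonzero coordinates of $\mathbf{x}$ (Hamming norm). Collections of points are multisets (identical points are treated as distinct elements). For a finite collection $T\subseteq\mathbb{Z}^d$, ${\sf cost}_p(T)=\min_{\mathbf{c}\in\mathbb{R}^d}\sum_{\mathbf{x}\in T}\|\mathbf{c}-\mathbf{x}\|_p$. Given a collection $\mathbf{X}$ of $n$ points of $\mathbb{Z}^d$ and a positive integer $k$ dividing $n$, an equal $k$-clustering is a partition $\{X_1,\dots,X_k\}$ of $\mathbf{X}$ with $|X_i|=n/k$ for all $i$; its cost is ${\sf cost}_p(X_1,\dots,X_k)=\sum_i{\sf cost}_p(X_i)$. In \textsc{Parameterized Equal Clustering}, an instance is $(\mathbf{X},k,B)$ with $B$ a nonnegative integer (the parameter); a solution is an equal $k$-clustering, and its value is ${\sf cost}^B_p(X_1,\dots,X_k)={\sf cost}_p(X_1,\dots,X_k)$ if this is at most $B$, and $B+1$ otherwise;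 ${\sf Opt}(\mathbf{X},k,B)$ is the minimum value over all equal $k$-clusterings. An $\alpha$-approximate kernel (of size $g$) for such a parameterized minimization problem is a pair of polynomial-time algorithms: a reduction algorithm that, given an instance $(I,B)$, outputs an instance $(I',B')$ of the same problem with $|I'|+B'\le g(B)$; and a solution-lifting algorithm that, given $(I,B)$, $(I',B')$ and any solution $s'$ of $(I',B')$, outputs a solution $s$ of $(I,B)$ such that $\frac{\mathrm{val}(I,B,s)}{{\sf Opt}(I,B)}\le\alpha\cdot\frac{\mathrm{val}(I',B',s')}{{\sf Opt}(I',B')}$, where a ratio is taken to be $1$ when its denominator ${\sf Opt}$ is $0$. *)

theory Defs
  imports
    "HOL-Library.Multiset"
    "HOL-Library.Landau_Symbols"
    "HOL-Computational_Algebra.Polynomial"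
begin

section \<open>Polynomial-time computation\<close>

text \<open>
  The machine model is a variable-free WHILE language over binary trees (in the style of Jones).
  Every elementary step is charged the size of the tree it reads, so that the time bounds the size
  of all intermediate results and of the output (lemma \<open>exec_size_le\<close>). Simulations between this
  model and Turing machines in either direction cost a polynomial overhead only.
\<close>

datatype tree = Leaf | Node tree tree

datatype prog =
    Ident
  | Const_Leaf
  | Left
  | Right
  | MkNode prog prog
  | Seq prog prog
  | Cond prog prog prog
  | While prog prog

fun left :: "tree \<Rightarrow> tree" where
  "left Leaf = Leaf"
| "left (Node a b) = a"

fun right :: "tree \<Rightarrow> tree" where
  "right Leaf = Leaf"
| "right (Node a b) = b"

text \<open>
  \<open>exec P x y t\<close>: on input \<open>x\<close> the program \<open>P\<close> halts with output \<open>y\<close> after time \<open>t\<close>.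
  A test succeeds iff its result is not \<open>Leaf\<close>; \<open>size\<close> counts the inner nodes of a tree.
\<close>

inductive exec :: "prog \<Rightarrow> tree \<Rightarrow> tree \<Rightarrow> nat \<Rightarrow> bool" where
  exec_Ident: "exec Ident x x (Suc (size x))"
| exec_Const_Leaf: "exec Const_Leaf x Leaf (Suc (size x))"
| exec_Left: "exec Left x (left x) (Suc (size x))"
| exec_Right: "exec Right x (right x) (Suc (size x))"
| exec_MkNode: "exec P x y s \<Longrightarrow> exec Q x z t \<Longrightarrow> exec (MkNode P Q) x (Node y z) (Suc (s + t))"
| exec_Seq: "exec P x y s \<Longrightarrow> exec Q y z t \<Longrightarrow> exec (Seq P Q) x z (Suc (s + t))"
| exec_Cond_True: "exec C x c s \<Longrightarrow> c \<noteq> Leaf \<Longrightarrow> exec P x y t \<Longrightarrow> exec (Cond C P Q) x y (Suc (s + t))"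
| exec_Cond_False: "exec C x Leaf s \<Longrightarrow> exec Q x y t \<Longrightarrow> exec (Cond C P Q) x y (Suc (s + t))"
| exec_While_False: "exec C x Leaf s \<Longrightarrow> exec (While C P) x x (Suc s)"
| exec_While_True: "exec C x c s \<Longrightarrow> c \<noteq> Leaf \<Longrightarrow> exec P x y t \<Longrightarrow> exec (While C P) y z u
    \<Longrightarrow> exec (While C P) x z (Suc (s + t + u))"

lemma exec_deterministic:
  assumes "exec P x y t" "exec P x y' t'"
  shows "y' = y \<and> t' = t"
  using assms
proof (induction arbitrary: y' t' rule: exec.induct)
  case (exec_MkNode P x y s Q z t)
  from exec_MkNode.prems show ?case by cases (use exec_MkNode.IH in blast)
next
  case (exec_Seq P x y s Q z t)
  from exec_Seq.prems show ?case by cases (use exec_Seq.IH in blast)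
next
  case (exec_Cond_True C x c s P y t Q)
  from exec_Cond_True.prems show ?case by cases (use exec_Cond_True.IH exec_Cond_True.hyps in blast)+
next
  case (exec_Cond_False C x s Q y t P)
  from exec_Cond_False.prems show ?case by cases (use exec_Cond_False.IH in blast)+
next
  case (exec_While_False C x s P)
  from exec_While_False.prems show ?case by cases (use exec_While_False.IH in blast)+
next
  case (exec_While_True C x c s P y t z u)
  from exec_While_True.prems show ?case by cases (use exec_While_True.IH exec_While_True.hyps in blast)+
qed (auto elim: exec.cases)

lemma exec_size_le: "exec P x y t \<Longrightarrow> size x \<le> t \<and> size y \<le> t"
proof (induction rule: exec.induct)
  case (exec_Left x) then show ?case by (cases x) auto
next
  case (exec_Right x) then show ?case by (cases x) auto
qed auto

definition polytime_on :: "'a set \<Rightarrow> ('a \<Rightarrow> tree) \<Rightarrow> ('b \<Rightarrow> tree) \<Rightarrow> ('a \<Rightarrow> 'b) \<Rightarrow> bool" where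
  "polytime_on A enc_in enc_out f \<longleftrightarrow>
     (\<exists>(P :: prog) (q :: nat poly). \<forall>x\<in>A. \<exists>t.
        exec P (enc_in x) (enc_out (f x)) t \<and> t \<le> poly q (size (enc_in x)))"

text \<open>Numbers are encoded in binary, least significant bit first.\<close>

definition enc_bool :: "bool \<Rightarrow> tree" where
  "enc_bool b = (if b then Node Leaf Leaf else Leaf)"

fun enc_nat :: "nat \<Rightarrow> tree" where
  "enc_nat n = (if n = 0 then Leaf else Node (enc_bool (odd n)) (enc_nat (n div 2)))"

declare enc_nat.simps [simp del]

definition enc_int :: "int \<Rightarrow> tree" where
  "enc_int i = Node (enc_bool (i < 0)) (enc_nat (nat \<bar>i\<bar>))"

fun enc_list :: "('a \<Rightarrow> tree) \<Rightarrow> 'a list \<Rightarrow> tree" where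
  "enc_list e [] = Leaf"
| "enc_list e (x # xs) = Node (e x) (enc_list e xs)"


section \<open>Parameterized minimization problems and approximate kernels\<close>

text \<open>
  An instance is a pair \<open>(I, B)\<close> of a main part \<open>I\<close> and a parameter \<open>B\<close>. The sets \<open>sols \<Pi> (I, B)\<close>
  are meant to be finite and nonempty, so that the minimum defining \<open>opt\<close> makes sense.
\<close>

record ('i, 's) min_problem =
  insts :: "('i \<times> nat) set"
  sols :: "'i \<times> nat \<Rightarrow> 's set"
  sol_val :: "'i \<times> nat \<Rightarrow> 's \<Rightarrow> real"
  enc_main :: "'i \<Rightarrow> tree"
  enc_sol :: "'s \<Rightarrow> tree"

definition opt :: "('i, 's) min_problem \<Rightarrow> 'i \<times> nat \<Rightarrow> real" where
  "opt \<Pi> J = Min (sol_val \<Pi> J ` sols \<Pi> J)"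

definition approx_ratio :: "('i, 's) min_problem \<Rightarrow> 'i \<times> nat \<Rightarrow> 's \<Rightarrow> real" where
  "approx_ratio \<Pi> J s = (if opt \<Pi> J = 0 then 1 else sol_val \<Pi> J s / opt \<Pi> J)"

definition enc_inst :: "('i, 's) min_problem \<Rightarrow> 'i \<times> nat \<Rightarrow> tree" where
  "enc_inst \<Pi> J = Node (enc_main \<Pi> (fst J)) (enc_nat (snd J))"

text \<open>\<open>R\<close> is the reduction algorithm and \<open>L\<close> the solution-lifting algorithm.\<close>

definition approx_kernel ::
  "('i, 's) min_problem \<Rightarrow> real \<Rightarrow> (nat \<Rightarrow> nat) \<Rightarrow> ('i \<times> nat \<Rightarrow> 'i \<times> nat) \<Rightarrow>
    (('i \<times> nat) \<times> ('i \<times> nat) \<times> 's \<Rightarrow> 's) \<Rightarrow> bool" where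
  "approx_kernel \<Pi> \<alpha> g R L \<longleftrightarrow>
     polytime_on (insts \<Pi>) (enc_inst \<Pi>) (enc_inst \<Pi>) R \<and>
     polytime_on {(J, J', s'). J \<in> insts \<Pi> \<and> J' = R J \<and> s' \<in> sols \<Pi> J'}
       (\<lambda>(J, J', s'). Node (enc_inst \<Pi> J) (Node (enc_inst \<Pi> J') (enc_sol \<Pi> s')))
       (enc_sol \<Pi>) L \<and>
     (\<forall>J\<in>insts \<Pi>.
        R J \<in> insts \<Pi> \<and>
        size (enc_main \<Pi> (fst (R J))) + snd (R J) \<le> g (snd J) \<and>
        (\<forall>s'\<in>sols \<Pi> (R J).
           L (J, R J, s') \<in> sols \<Pi> J \<and>
           approx_ratio \<Pi> J (L (J, R J, s')) \<le> \<alpha> * approx_ratio \<Pi> (R J) s'))"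


section \<open>Equal clustering\<close>

type_synonym point = "int list"

definition lp_norm :: "nat \<Rightarrow> real list \<Rightarrow> real" where
  "lp_norm p v =
     (if p = 0 then real (length (filter (\<lambda>a. a \<noteq> 0) v))
      else root p (\<Sum>a\<leftarrow>v. \<bar>a\<bar> ^ p))"

definition vec_diff :: "real list \<Rightarrow> point \<Rightarrow> real list" where
  "vec_diff c x = map2 (\<lambda>a b. a - real_of_int b) c x"

text \<open>The infimum over the possible centers in \<open>d\<close>-dimensional real space is attained.\<close>

definition cost :: "nat \<Rightarrow> nat \<Rightarrow> point multiset \<Rightarrow> real" where
  "cost p d T = (INF c\<in>{c :: real list. length c = d}. \<Sum>x\<in>#T. lp_norm p (vec_diff c x))"

text \<open>
  Multisets of points are presented to algorithms as lists. A clustering is given by the list of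
  its clusters.
\<close>

definition dimension :: "point list \<Rightarrow> nat" where
  "dimension X = length (hd X)"

definition equal_clusterings :: "nat \<Rightarrow> point list \<Rightarrow> point list list set" where
  "equal_clusterings k X =
     {C. length C = k \<and> (\<Sum>T\<leftarrow>C. mset T) = mset X \<and> (\<forall>T\<in>set C. length T = length X div k)}"

definition clustering_cost :: "nat \<Rightarrow> nat \<Rightarrow> point list list \<Rightarrow> real" where
  "clustering_cost p d C = (\<Sum>T\<leftarrow>C. cost p d (mset T))"

definition equal_clustering_insts :: "((point list \<times> nat) \<times> nat) set" where
  "equal_clustering_insts =
     {((X, k), B). X \<noteq> [] \<and> dimension X \<ge> 1 \<and> (\<forall>x\<in>set X. length x = dimension X) \<and>
        k \<ge> 1 \<and> k dvd length X}"

definition equal_clustering :: "nat \<Rightarrow> (point list \<times> nat, point list list) min_problem" where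
  "equal_clustering p =
     \<lparr> insts = equal_clustering_insts,
       sols = (\<lambda>((X, k), B). equal_clusterings k X),
       sol_val = (\<lambda>((X, k), B) C.
         let c = clustering_cost p (dimension X) C in if c \<le> real B then c else real B + 1),
       enc_main = (\<lambda>(X, k). Node (enc_list (enc_list enc_int) X) (enc_nat k)),
       enc_sol = enc_list (enc_list (enc_list enc_int)) \<rparr>"

lemma sum_list_mset_eq: "(\<Sum>T\<leftarrow>C. mset T) = mset (concat C)"
  by (induction C) auto

lemma finite_equal_clusterings: "finite (equal_clusterings k X)"
proof (rule finite_subset)
  let ?A = "{T. set T \<subseteq> set X \<and> length T = length X div k}"
  show "equal_clusterings k X \<subseteq> {C. set C \<subseteq> ?A \<and> length C = k}"
    unfolding equal_clusterings_def sum_list_mset_eq by (auto dest!: mset_eq_setD)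
  show "finite {C. set C \<subseteq> ?A \<and> length C = k}"
    by (intro finite_lists_length_eq) auto
qed

lemma equal_clusterings_nonempty:
  assumes "k dvd length X"
  shows "equal_clusterings k X \<noteq> {}"
proof -
  have "\<exists>C. length C = k \<and> concat C = X \<and> (\<forall>T\<in>set C. length T = m)"
    if "length X = k * m" for m and X :: "point list"
    using that
  proof (induction k arbitrary: X)
    case (Suc k)
    then have "length (drop m X) = k * m" by simp
    from Suc.IH[OF this] obtain C where
      C: "length C = k" "concat C = drop m X" "\<forall>T\<in>set C. length T = m" by blast
    with Suc.prems show ?case by (intro exI[of _ "take m X # C"]) auto
  qed auto
  moreover have "length X = k * (length X div k)" using assms by simp
  ultimately obtain C where "length C = k" "concat C = X" "\<forall>T\<in>set C. length T = length X div k"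
    by blast
  then have "C \<in> equal_clusterings k X" by (simp add: equal_clusterings_def sum_list_mset_eq)
  then show ?thesis by blast
qed

end

theory Submission
  imports Defs
begin

text \<open>
  Let \<open>s = n / k\<close> be the cluster size. As long as some point has \<open>s\<close> copies, \<open>s\<close> of them are split off
  as a cluster of cost \<open>0\<close>, so every multiplicity is replaced by its residue modulo \<open>s\<close>. If \<open>s > B\<close>,
  this is lossless for clusterings of cost at most \<open>B\<close>: each split-off group can be charged to a cluster
  of its own in which its point is a strict majority, and exchanging points with that cluster is free.
  If \<open>s \<le> B\<close>, Hall's theorem yields a common transversal of the groups and the clusters that carries at
  most a \<open>1/s\<close> fraction of the cost, and exchanging points along it costs a factor of at most \<open>2 - 2/s\<close>.

  A clustering of cost at most \<open>B\<close> leaves at most \<open>2B\<close> distinct residual points. If \<open>s > 2B + 2\<close>, every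
  cluster of cost at most \<open>B\<close> has a point of multiplicity at least \<open>s - B\<close>, which determines the center,
  so every point with more than \<open>B\<close> copies can lose \<open>s - (2B + 2)\<close> of them, all in the one cluster where
  it is frequent, without any change of cost. Points in a cluster of cost at most \<open>B\<close> differ in few coordinates and by little;
  hence in every component of the graph of close points only few coordinates vary, these can be
  translated near \<open>0\<close>, and constant extra coordinates keep the components apart.
\<close>

section \<open>A calculus of polynomial-time functions\<close>

abbreviation ptime :: "('a \<Rightarrow> tree) \<Rightarrow> ('b \<Rightarrow> tree) \<Rightarrow> ('a \<Rightarrow> 'b) \<Rightarrow> bool" where
  "ptime e e' f \<equiv> polytime_on UNIV e e' f"

definition enc_prod :: "('a \<Rightarrow> tree) \<Rightarrow> ('b \<Rightarrow> tree) \<Rightarrow> 'a \<times> 'b \<Rightarrow> tree" where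
  "enc_prod e1 e2 z = Node (e1 (fst z)) (e2 (snd z))"

lemma enc_prod_Pair [simp]: "enc_prod e1 e2 (a, b) = Node (e1 a) (e2 b)"
  by (simp add: enc_prod_def)

lemma poly_nat_mono:
  fixes q :: "nat poly"
  assumes "m \<le> n"
  shows "poly q m \<le> poly q n"
  using assms by (induction q) (auto intro!: add_mono mult_mono)

lemma polytime_onE:
  assumes "polytime_on A e e' f"
  obtains P q where "\<forall>x\<in>A. \<exists>t. exec P (e x) (e' (f x)) t \<and> t \<le> poly q (size (e x))"
  using assms unfolding polytime_on_def by blast

lemma polytime_onI:
  assumes "\<And>x. x \<in> A \<Longrightarrow> \<exists>t. exec P (e x) (e' (f x)) t \<and> t \<le> poly q (size (e x))"
  shows "polytime_on A e e' f"
  using assms unfolding polytime_on_def by blast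

lemma polytime_on_subset: "polytime_on A e e' f \<Longrightarrow> B \<subseteq> A \<Longrightarrow> polytime_on B e e' f"
  unfolding polytime_on_def by (meson subsetD)

lemma polytime_on_cong:
  assumes "polytime_on A e e' f" "\<And>x. x \<in> A \<Longrightarrow> e1 x = e x \<and> e1' (f1 x) = e' (f x)"
  shows "polytime_on A e1 e1' f1"
  using assms unfolding polytime_on_def by (metis (no_types, lifting))

lemma polytime_on_size:
  assumes "polytime_on A e e' f"
  obtains q :: "nat poly" where "\<forall>x\<in>A. size (e' (f x)) \<le> poly q (size (e x))"
proof -
  from assms obtain P q where
    *: "\<forall>x\<in>A. \<exists>t. exec P (e x) (e' (f x)) t \<and> t \<le> poly q (size (e x))"
    by (rule polytime_onE)
  show thesis
  proof (rule that, rule ballI)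
    fix x assume "x \<in> A"
    with * show "size (e' (f x)) \<le> poly q (size (e x))"
      using exec_size_le le_trans by blast
  qed
qed

lemma pt_id: "polytime_on A e e (\<lambda>z. z)"
  by (rule polytime_onI[where P = Ident and q = "[:1, 1:]"]) (auto intro: exec_Ident)

lemma pt_comp_on:
  assumes "polytime_on A e1 e2 f" "polytime_on B e2 e3 g" "\<And>x. x \<in> A \<Longrightarrow> f x \<in> B"
  shows "polytime_on A e1 e3 (\<lambda>x. g (f x))"
proof -
  from assms(1) obtain P q where
    1: "\<forall>x\<in>A. \<exists>t. exec P (e1 x) (e2 (f x)) t \<and> t \<le> poly q (size (e1 x))"
    by (rule polytime_onE)
  from assms(2) obtain Q r where
    2: "\<forall>x\<in>B. \<exists>t. exec Q (e2 x) (e3 (g x)) t \<and> t \<le> poly r (size (e2 x))"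
    by (rule polytime_onE)
  show ?thesis
  proof (rule polytime_onI[where P = "Seq P Q" and q = "1 + q + pcompose r q"])
    fix x assume x: "x \<in> A"
    obtain s where s: "exec P (e1 x) (e2 (f x)) s" "s \<le> poly q (size (e1 x))" using 1 x by blast
    obtain t where t: "exec Q (e2 (f x)) (e3 (g (f x))) t" "t \<le> poly r (size (e2 (f x)))"
      using 2 x assms(3) by blast
    have "size (e2 (f x)) \<le> poly q (size (e1 x))" using s exec_size_le le_trans by blast
    then have "t \<le> poly r (poly q (size (e1 x)))" using t(2) poly_nat_mono le_trans by blast
    then show "\<exists>t. exec (Seq P Q) (e1 x) (e3 (g (f x))) t \<and> t \<le> poly (1 + q + pcompose r q) (size (e1 x))"
      using s t by (intro exI[of _ "Suc (s + t)"]) (auto intro: exec_Seq simp: poly_pcompose)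
  qed
qed

lemma pt_comp:
  assumes "polytime_on A e1 e2 f" "ptime e2 e3 g"
  shows "polytime_on A e1 e3 (\<lambda>x. g (f x))"
  using pt_comp_on[OF assms] by simp

lemma pt_Pair:
  assumes "polytime_on A e e1 f" "polytime_on A e e2 g"
  shows "polytime_on A e (enc_prod e1 e2) (\<lambda>x. (f x, g x))"
proof -
  from assms(1) obtain P q where
    1: "\<forall>x\<in>A. \<exists>t. exec P (e x) (e1 (f x)) t \<and> t \<le> poly q (size (e x))"
    by (rule polytime_onE)
  from assms(2) obtain Q r where
    2: "\<forall>x\<in>A. \<exists>t. exec Q (e x) (e2 (g x)) t \<and> t \<le> poly r (size (e x))"
    by (rule polytime_onE)
  show ?thesis
  proof (rule polytime_onI[where P = "MkNode P Q" and q = "1 + q + r"])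
    fix x assume x: "x \<in> A"
    obtain s where s: "exec P (e x) (e1 (f x)) s" "s \<le> poly q (size (e x))" using 1 x by blast
    obtain t where t: "exec Q (e x) (e2 (g x)) t" "t \<le> poly r (size (e x))" using 2 x by blast
    show "\<exists>t. exec (MkNode P Q) (e x) (enc_prod e1 e2 (f x, g x)) t \<and> t \<le> poly (1 + q + r) (size (e x))"
      using s t by (intro exI[of _ "Suc (s + t)"]) (auto intro: exec_MkNode)
  qed
qed

lemma pt_If_on:
  assumes "polytime_on A e enc_bool b"
    "polytime_on {x \<in> A. b x} e e' f" "polytime_on {x \<in> A. \<not> b x} e e' g"
  shows "polytime_on A e e' (\<lambda>x. if b x then f x else g x)"
proof -
  from assms(1) obtain C q where
    1: "\<forall>x\<in>A. \<exists>t. exec C (e x) (enc_bool (b x)) t \<and> t \<le> poly q (size (e x))"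
    by (rule polytime_onE)
  from assms(2) obtain P r where
    2: "\<forall>x\<in>{x\<in>A. b x}. \<exists>t. exec P (e x) (e' (f x)) t \<and> t \<le> poly r (size (e x))"
    by (rule polytime_onE)
  from assms(3) obtain Q u where
    3: "\<forall>x\<in>{x\<in>A. \<not> b x}. \<exists>t. exec Q (e x) (e' (g x)) t \<and> t \<le> poly u (size (e x))"
    by (rule polytime_onE)
  show ?thesis
  proof (rule polytime_onI[where P = "Cond C P Q" and q = "1 + q + r + u"])
    fix x assume x: "x \<in> A"
    obtain s where s: "exec C (e x) (enc_bool (b x)) s" "s \<le> poly q (size (e x))" using 1 x by blast
    show "\<exists>t. exec (Cond C P Q) (e x) (e' (if b x then f x else g x)) t \<and>
              t \<le> poly (1 + q + r + u) (size (e x))"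
    proof (cases "b x")
      case True
      then obtain t where "exec P (e x) (e' (f x)) t" "t \<le> poly r (size (e x))" using 2 x by blast
      with True s show ?thesis
        by (intro exI[of _ "Suc (s + t)"]) (auto intro!: exec_Cond_True simp: enc_bool_def)
    next
      case False
      then obtain t where "exec Q (e x) (e' (g x)) t" "t \<le> poly u (size (e x))" using 3 x by blast
      with False s show ?thesis
        by (intro exI[of _ "Suc (s + t)"]) (auto intro!: exec_Cond_False simp: enc_bool_def)
    qed
  qed
qed

lemma pt_If:
  assumes "polytime_on A e enc_bool b" "polytime_on A e e' f" "polytime_on A e e' g"
  shows "polytime_on A e e' (\<lambda>x. if b x then f x else g x)"
  by (rule pt_If_on[OF assms(1)]) (auto intro: polytime_on_subset assms(2,3))

lemma pt_const: "polytime_on A e e' (\<lambda>_. c)"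
proof -
  have "polytime_on A e (\<lambda>z. z) (\<lambda>_. t)" for t
  proof (induction t)
    case Leaf
    show ?case
      by (rule polytime_onI[where P = Const_Leaf and q = "[:1, 1:]"]) (auto intro: exec_Const_Leaf)
  next
    case (Node t1 t2)
    from pt_Pair[OF Node] show ?case by (rule polytime_on_cong) auto
  qed
  from this[of "e' c"] show ?thesis by (rule polytime_on_cong) auto
qed

lemma pt_left: "ptime (\<lambda>z. z) (\<lambda>z. z) left"
  by (rule polytime_onI[where P = Left and q = "[:1, 1:]"]) (auto intro: exec_Left)

lemma pt_right: "ptime (\<lambda>z. z) (\<lambda>z. z) right"
  by (rule polytime_onI[where P = Right and q = "[:1, 1:]"]) (auto intro: exec_Right)

lemma pt_via_left:
  assumes "polytime_on A e e1 f" "\<And>x. x \<in> A \<Longrightarrow> e2 (g x) = left (e1 (f x))"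
  shows "polytime_on A e e2 g"
proof -
  have "polytime_on A e (\<lambda>z. z) (\<lambda>x. e1 (f x))"
    using assms(1) by (rule polytime_on_cong) auto
  from pt_comp[OF this pt_left] show ?thesis by (rule polytime_on_cong) (use assms(2) in auto)
qed

lemma pt_via_right:
  assumes "polytime_on A e e1 f" "\<And>x. x \<in> A \<Longrightarrow> e2 (g x) = right (e1 (f x))"
  shows "polytime_on A e e2 g"
proof -
  have "polytime_on A e (\<lambda>z. z) (\<lambda>x. e1 (f x))"
    using assms(1) by (rule polytime_on_cong) auto
  from pt_comp[OF this pt_right] show ?thesis by (rule polytime_on_cong) (use assms(2) in auto)
qed

lemma pt_recode:
  assumes "polytime_on A e e1 f" "\<And>x. x \<in> A \<Longrightarrow> e2 (g x) = e1 (f x)"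
  shows "polytime_on A e e2 g"
  using assms(1) by (rule polytime_on_cong) (use assms(2) in auto)

lemma pt_fst: "polytime_on A e (enc_prod e1 e2) f \<Longrightarrow> polytime_on A e e1 (\<lambda>z. fst (f z))"
  by (erule pt_via_left) (simp add: enc_prod_def)

lemma pt_snd: "polytime_on A e (enc_prod e1 e2) f \<Longrightarrow> polytime_on A e e2 (\<lambda>z. snd (f z))"
  by (erule pt_via_right) (simp add: enc_prod_def)

lemma pt_not:
  assumes "polytime_on A e enc_bool f"
  shows "polytime_on A e enc_bool (\<lambda>z. \<not> f z)"
  by (rule pt_recode[OF pt_If[OF assms, of enc_bool "\<lambda>_. False" "\<lambda>_. True"]]) (auto intro: pt_const)

lemma pt_conj:
  assumes "polytime_on A e enc_bool f" "polytime_on A e enc_bool g"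
  shows "polytime_on A e enc_bool (\<lambda>z. f z \<and> g z)"
  by (rule pt_recode[OF pt_If[OF assms, of "\<lambda>_. False"]]) (auto intro: pt_const)

lemma pt_disj:
  assumes "polytime_on A e enc_bool f" "polytime_on A e enc_bool g"
  shows "polytime_on A e enc_bool (\<lambda>z. f z \<or> g z)"
  by (rule pt_recode[OF pt_If[OF assms(1) _ assms(2), of "\<lambda>_. True"]]) (auto intro: pt_const)

lemma pt_beq:
  assumes "polytime_on A e enc_bool f" "polytime_on A e enc_bool g"
  shows "polytime_on A e enc_bool (\<lambda>z. f z = g z)"
  by (rule pt_recode[OF pt_If[OF assms pt_not[OF assms(2)]]]) auto

lemma pt_nonleaf:
  assumes "polytime_on A e e1 f" "\<And>x. x \<in> A \<Longrightarrow> b x \<longleftrightarrow> e1 (f x) \<noteq> Leaf"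
  shows "polytime_on A e enc_bool b"
proof -
  from assms(1) obtain C q where
    1: "\<forall>x\<in>A. \<exists>t. exec C (e x) (e1 (f x)) t \<and> t \<le> poly q (size (e x))"
    by (rule polytime_onE)
  from pt_const[of A e enc_bool True] obtain P r where
    2: "\<forall>x\<in>A. \<exists>t. exec P (e x) (enc_bool True) t \<and> t \<le> poly r (size (e x))"
    by (rule polytime_onE)
  from pt_const[of A e enc_bool False] obtain Q u where
    3: "\<forall>x\<in>A. \<exists>t. exec Q (e x) (enc_bool False) t \<and> t \<le> poly u (size (e x))"
    by (rule polytime_onE)
  show ?thesis
  proof (rule polytime_onI[where P = "Cond C P Q" and q = "1 + q + r + u"])
    fix x assume x: "x \<in> A"
    obtain s where s: "exec C (e x) (e1 (f x)) s" "s \<le> poly q (size (e x))" using 1 x by blast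
    obtain t where t: "exec P (e x) (enc_bool True) t" "t \<le> poly r (size (e x))" using 2 x by blast
    obtain t' where t': "exec Q (e x) (enc_bool False) t'" "t' \<le> poly u (size (e x))" using 3 x by blast
    show "\<exists>t. exec (Cond C P Q) (e x) (enc_bool (b x)) t \<and> t \<le> poly (1 + q + r + u) (size (e x))"
    proof (cases "b x")
      case True
      with s t assms(2)[OF x] show ?thesis
        by (intro exI[of _ "Suc (s + t)"]) (auto intro!: exec_Cond_True)
    next
      case False
      with s t' assms(2)[OF x] show ?thesis
        by (intro exI[of _ "Suc (s + t')"]) (auto intro!: exec_Cond_False)
    qed
  qed
qed

text \<open>
  A loop is polynomial if it stops after polynomially many rounds and if a polynomially bounded
  potential that dominates the size of the state never increases.
\<close>

lemma pt_While:
  fixes \<mu> \<Phi> :: "'a \<Rightarrow> nat" and q r :: "nat poly"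
  assumes b: "ptime e enc_bool b" and f: "polytime_on {x. b x} e e f"
    and g: "\<And>x. g x = (if b x then g (f x) else x)"
    and \<mu>: "\<And>x. b x \<Longrightarrow> \<mu> (f x) < \<mu> x" "\<And>x. \<mu> x \<le> poly q (size (e x))"
    and \<Phi>: "\<And>x. size (e x) \<le> \<Phi> x" "\<And>x. b x \<Longrightarrow> \<Phi> (f x) \<le> \<Phi> x" "\<And>x. \<Phi> x \<le> poly r (size (e x))"
  shows "ptime e e g"
proof -
  from b obtain C qc where
    1: "\<forall>x\<in>UNIV. \<exists>t. exec C (e x) (enc_bool (b x)) t \<and> t \<le> poly qc (size (e x))"
    by (rule polytime_onE)
  from f obtain P qp where
    2: "\<forall>x\<in>{x. b x}. \<exists>t. exec P (e x) (e (f x)) t \<and> t \<le> poly qp (size (e x))"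
    by (rule polytime_onE)
  let ?K = "\<lambda>n. poly qc n + poly qp n + 1"
  have K_mono: "?K m \<le> ?K n" if "m \<le> n" for m n
    using poly_nat_mono[OF that, of qc] poly_nat_mono[OF that, of qp] by simp
  have main: "\<exists>t. exec (While C P) (e x) (e (g x)) t \<and> t \<le> (\<mu> x + 1) * ?K (\<Phi> x)" for x
  proof (induction "\<mu> x" arbitrary: x rule: less_induct)
    case less
    obtain s where s: "exec C (e x) (enc_bool (b x)) s" "s \<le> poly qc (size (e x))" using 1 by blast
    have s': "s \<le> poly qc (\<Phi> x)" using s(2) poly_nat_mono[OF \<Phi>(1)] le_trans by blast
    show ?case
    proof (cases "b x")
      case False
      have "exec (While C P) (e x) (e (g x)) (Suc s)"
        using s False g[of x] by (auto intro!: exec_While_False simp: enc_bool_def)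
      moreover have "Suc s \<le> 1 * ?K (\<Phi> x)" using s' by simp
      then have "Suc s \<le> (\<mu> x + 1) * ?K (\<Phi> x)" by (rule order_trans) (intro mult_right_mono, auto)
      ultimately show ?thesis by blast
    next
      case True
      obtain t where t: "exec P (e x) (e (f x)) t" "t \<le> poly qp (size (e x))" using 2 True by blast
      have t': "t \<le> poly qp (\<Phi> x)" using t(2) poly_nat_mono[OF \<Phi>(1)] le_trans by blast
      obtain u where u: "exec (While C P) (e (f x)) (e (g (f x))) u" "u \<le> (\<mu> (f x) + 1) * ?K (\<Phi> (f x))"
        using less \<mu>(1)[OF True] by blast
      have "u \<le> \<mu> x * ?K (\<Phi> x)"
        using u(2) by (rule order_trans)
          (intro mult_mono K_mono \<Phi>(2) True, use \<mu>(1)[OF True] in auto)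
      then have "Suc (s + t + u) \<le> (\<mu> x + 1) * ?K (\<Phi> x)" using s' t' by (simp add: algebra_simps)
      moreover have "exec (While C P) (e x) (e (g x)) (Suc (s + t + u))"
        using s t u True g[of x] by (auto intro!: exec_While_True simp: enc_bool_def)
      ultimately show ?thesis by blast
    qed
  qed
  show ?thesis
  proof (rule polytime_onI[where P = "While C P" and q = "(q + 1) * (pcompose (qc + qp + 1) r)"])
    fix x
    obtain t where t: "exec (While C P) (e x) (e (g x)) t" "t \<le> (\<mu> x + 1) * ?K (\<Phi> x)" using main by blast
    note t(2)
    also have "(\<mu> x + 1) * ?K (\<Phi> x) \<le> (poly q (size (e x)) + 1) * ?K (poly r (size (e x)))"
      by (intro mult_mono K_mono add_mono \<mu>(2) \<Phi>(3)) auto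
    finally show "\<exists>t. exec (While C P) (e x) (e (g x)) t \<and>
        t \<le> poly ((q + 1) * (pcompose (qc + qp + 1) r)) (size (e x))"
      using t(1) by (auto simp: poly_pcompose)
  qed
qed

section \<open>Lists\<close>

fun hdd :: "'a \<Rightarrow> 'a list \<Rightarrow> 'a" where
  "hdd d [] = d"
| "hdd d (x # xs) = x"

lemma pt_Cons:
  "polytime_on A e e1 f \<Longrightarrow> polytime_on A e (enc_list e1) g \<Longrightarrow>
    polytime_on A e (enc_list e1) (\<lambda>z. f z # g z)"
  by (erule (1) pt_recode[OF pt_Pair]) simp

lemma enc_list_tl: "enc_list e (tl l) = right (enc_list e l)"
  by (cases l) auto

lemma enc_list_Leaf_iff: "enc_list e l = Leaf \<longleftrightarrow> l = []"
  by (cases l) auto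

lemma pt_tl: "polytime_on A e (enc_list e1) f \<Longrightarrow> polytime_on A e (enc_list e1) (\<lambda>z. tl (f z))"
  by (erule pt_via_right) (simp add: enc_list_tl)

lemma pt_notNil: "polytime_on A e (enc_list e1) f \<Longrightarrow> polytime_on A e enc_bool (\<lambda>z. f z \<noteq> [])"
  by (erule pt_nonleaf) (simp add: enc_list_Leaf_iff)

lemma pt_isNil: "polytime_on A e (enc_list e1) f \<Longrightarrow> polytime_on A e enc_bool (\<lambda>z. f z = [])"
  using pt_not[OF pt_notNil] by (rule pt_recode) auto

lemma pt_hdd:
  assumes "polytime_on A e e1 d" "polytime_on A e (enc_list e1) l"
  shows "polytime_on A e e1 (\<lambda>z. hdd (d z) (l z))"
proof -
  have "polytime_on {z \<in> A. l z \<noteq> []} e e1 (\<lambda>z. hdd (d z) (l z))"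
  proof (rule pt_via_left)
    show "polytime_on {z \<in> A. l z \<noteq> []} e (enc_list e1) l"
      by (rule polytime_on_subset[OF assms(2)]) auto
    fix x assume "x \<in> {z \<in> A. l z \<noteq> []}"
    then show "e1 (hdd (d x) (l x)) = left (enc_list e1 (l x))" by (cases "l x") auto
  qed
  moreover have "polytime_on {z \<in> A. \<not> l z \<noteq> []} e e1 d"
    by (rule polytime_on_subset[OF assms(1)]) auto
  ultimately have "polytime_on A e e1 (\<lambda>z. if l z \<noteq> [] then hdd (d z) (l z) else d z)"
    by (rule pt_If_on[OF pt_notNil[OF assms(2)]])
  then show ?thesis by (rule pt_recode) auto
qed

lemma length_le_size_enc_list: "length l \<le> size (enc_list e l)"
  by (induction l) auto

lemma pt_fold_gen:
  fixes m :: "'acc \<Rightarrow> nat" and q r r' :: "nat poly"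
  assumes l: "ptime e (enc_list e1) l" and a: "ptime e e2 a"
    and h: "ptime (enc_prod e (enc_prod e1 e2)) e2 (\<lambda>z. h (fst z) (fst (snd z)) (snd (snd z)))"
    and m: "\<And>a. size (e2 a) \<le> poly r (m a)" "\<And>a. m a \<le> poly r' (size (e2 a))"
      "\<And>x y a. m (h x y a) \<le> m a + poly q (size (e x) + size (e1 y))"
  shows "ptime e e2 (\<lambda>z. fold (h z) (l z) (a z))"
proof -
  let ?e = "enc_prod e (enc_prod (enc_list e1) e2)"
  let ?b = "\<lambda>z::'a \<times> 'b list \<times> 'acc. fst (snd z) \<noteq> []"
  let ?f = "\<lambda>z::'a \<times> 'b list \<times> 'acc.
     (fst z, tl (fst (snd z)), h (fst z) (hd (fst (snd z))) (snd (snd z)))"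
  let ?g = "\<lambda>z::'a \<times> 'b list \<times> 'acc. (fst z, [], fold (h (fst z)) (fst (snd z)) (snd (snd z)))"
  let ?X = "\<lambda>z::'a \<times> 'b list \<times> 'acc. size (e (fst z)) + size (enc_list e1 (fst (snd z)))"
  let ?\<Phi> = "\<lambda>z::'a \<times> 'b list \<times> 'acc. ?X z + 2 +
     poly r (m (snd (snd z)) + length (fst (snd z)) * poly q (?X z))"
  have "ptime ?e ?e ?g"
  proof (rule pt_While[where b = ?b and f = ?f and \<mu> = "\<lambda>z. length (fst (snd z))" and \<Phi> = ?\<Phi>
        and q = "[:0, 1:]" and r = "[:2, 1:] + pcompose r (r' + [:0, 1:] * q)"])
    show "ptime ?e enc_bool ?b" by (rule pt_notNil pt_fst pt_snd pt_id)+
    have hd: "polytime_on {z. ?b z} ?e e1 (\<lambda>z. hd (fst (snd z)))"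
    proof (rule pt_via_left)
      show "polytime_on {z. ?b z} ?e (enc_list e1) (\<lambda>z. fst (snd z))" by (rule pt_fst pt_snd pt_id)+
      fix z assume "z \<in> {z. ?b z}"
      then show "e1 (hd (fst (snd z))) = left (enc_list e1 (fst (snd z)))"
        by (cases "fst (snd z)") auto
    qed
    have "polytime_on {z. ?b z} ?e (enc_prod e (enc_prod e1 e2)) (\<lambda>z. (fst z, hd (fst (snd z)), snd (snd z)))"
      by (rule pt_Pair hd pt_fst pt_snd pt_id)+
    from pt_comp[OF this h] have "polytime_on {z. ?b z} ?e e2 (\<lambda>z. h (fst z) (hd (fst (snd z))) (snd (snd z)))"
      by simp
    moreover have "polytime_on {z. ?b z} ?e (enc_list e1) (\<lambda>z. tl (fst (snd z)))"
      by (rule pt_tl pt_fst pt_snd pt_id)+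
    ultimately show "polytime_on {z. ?b z} ?e ?e ?f"
      by - (assumption | rule pt_Pair pt_fst pt_snd pt_id)+
    show "?g z = (if ?b z then ?g (?f z) else z)" for z
      by (cases "fst (snd z)") (auto simp: prod_eq_iff)
    show "length (fst (snd (?f z))) < length (fst (snd z))" if "?b z" for z using that by simp
    have len: "length (fst (snd z)) \<le> size (?e z)" for z :: "'a \<times> 'b list \<times> 'acc"
      using length_le_size_enc_list[of "fst (snd z)" e1] by (simp add: enc_prod_def)
    then show "length (fst (snd z)) \<le> poly [:0, 1:] (size (?e z))" for z :: "'a \<times> 'b list \<times> 'acc"
      by simp
    show "size (?e z) \<le> ?\<Phi> z" for z
    proof -
      have "size (e2 (snd (snd z))) \<le> poly r (m (snd (snd z)))" by (rule m(1))
      also have "\<dots> \<le> poly r (m (snd (snd z)) + length (fst (snd z)) * poly q (?X z))"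
        by (rule poly_nat_mono) simp
      finally show ?thesis by (simp add: enc_prod_def)
    qed
    show "?\<Phi> (?f z) \<le> ?\<Phi> z" if "?b z" for z
    proof -
      obtain x l a where xla: "z = (x, l, a)" by (cases z)
      then obtain y ys where z: "z = (x, y # ys, a)" using \<open>?b z\<close> by (cases l) auto
      have X: "?X (?f z) \<le> ?X z" by (simp add: z)
      have "m (h x y a) + length ys * poly q (?X (?f z)) \<le>
          (m a + poly q (size (e x) + size (e1 y))) + length ys * poly q (?X z)"
        by (intro add_mono m(3) mult_mono poly_nat_mono X) auto
      also have "poly q (size (e x) + size (e1 y)) \<le> poly q (?X z)" by (rule poly_nat_mono) (simp add: z)
      finally have "m (h x y a) + length ys * poly q (?X (?f z)) \<le> m a + length (y # ys) * poly q (?X z)"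
        by simp
      then have "poly r (m (h x y a) + length ys * poly q (?X (?f z))) \<le>
          poly r (m a + length (y # ys) * poly q (?X z))"
        by (rule poly_nat_mono)
      with X show ?thesis by (simp add: z)
    qed
    show "?\<Phi> z \<le> poly ([:2, 1:] + pcompose r (r' + [:0, 1:] * q)) (size (?e z))" for z
    proof -
      have "size (e2 (snd (snd z))) \<le> size (?e z)" by (simp add: enc_prod_def)
      then have "m (snd (snd z)) \<le> poly r' (size (?e z))"
        using m(2) poly_nat_mono le_trans by blast
      moreover have "length (fst (snd z)) * poly q (?X z) \<le> size (?e z) * poly q (size (?e z))"
        by (intro mult_mono len poly_nat_mono) (auto simp: enc_prod_def)
      ultimately have "poly r (m (snd (snd z)) + length (fst (snd z)) * poly q (?X z))
          \<le> poly r (poly r' (size (?e z)) + size (?e z) * poly q (size (?e z)))"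
        by (intro poly_nat_mono add_mono)
      then show ?thesis by (simp add: poly_pcompose enc_prod_def)
    qed
  qed
  from pt_comp[OF pt_Pair[OF pt_id pt_Pair[OF l a]] this]
  have "ptime e ?e (\<lambda>z. (z, [], fold (h z) (l z) (a z)))" by simp
  from pt_snd[OF pt_snd[OF this]] show ?thesis by simp
qed

lemma pt_fold:
  assumes "ptime e (enc_list e1) l" "ptime e e2 a"
    and "ptime (enc_prod e (enc_prod e1 e2)) e2 (\<lambda>z. h (fst z) (fst (snd z)) (snd (snd z)))"
    and "\<And>x y a. size (e2 (h x y a)) \<le> size (e2 a) + poly q (size (e x) + size (e1 y))"
  shows "ptime e e2 (\<lambda>z. fold (h z) (l z) (a z))"
  by (rule pt_fold_gen[OF assms(1-3), where m = "\<lambda>a. size (e2 a)" and r = "[:0, 1:]" and r' = "[:0, 1:]"])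
    (use assms(4) in auto)

lemma pt_rev:
  assumes "ptime e (enc_list e1) l"
  shows "ptime e (enc_list e1) (\<lambda>z. rev (l z))"
proof -
  have "ptime e (enc_list e1) (\<lambda>z. fold (\<lambda>y a. y # a) (l z) [])"
    by (rule pt_fold[OF assms, where q = "[:1, 1:]"])
      ((rule pt_const pt_Cons pt_fst pt_snd pt_id)+, simp)
  then show ?thesis by (simp add: rev_conv_fold)
qed

lemma fold_Cons_map: "fold (\<lambda>y a. h y # a) l a = rev (map h l) @ a"
  by (induction l arbitrary: a) auto

lemma pt_map:
  assumes l: "ptime e (enc_list e1) l" and h: "ptime (enc_prod e e1) e2 (\<lambda>z. h (fst z) (snd z))"
  shows "ptime e (enc_list e2) (\<lambda>z. map (h z) (l z))"
proof -
  obtain q where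
    q': "\<forall>z\<in>UNIV. size (e2 (h (fst z) (snd z))) \<le> poly q (size (enc_prod e e1 z))"
    by (rule polytime_on_size[OF h])
  have q: "size (e2 (h x y)) \<le> poly q (size (enc_prod e e1 (x, y)))" for x y
    using q'[rule_format, of "(x, y)"] by simp
  have "ptime e (enc_list e2) (\<lambda>z. fold (\<lambda>y a. h z y # a) (rev (l z)) [])"
  proof (rule pt_fold[OF pt_rev[OF l] pt_const, where q = "1 + pcompose q [:1, 1:]"])
    have "ptime (enc_prod e (enc_prod e1 (enc_list e2))) (enc_prod e e1) (\<lambda>z. (fst z, fst (snd z)))"
      by (rule pt_Pair pt_fst pt_snd pt_id)+
    from pt_comp[OF this h]
    show "ptime (enc_prod e (enc_prod e1 (enc_list e2))) (enc_list e2)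
       (\<lambda>z. h (fst z) (fst (snd z)) # snd (snd z))"
      by - (assumption | rule pt_Cons pt_snd pt_id | simp)+
  qed (use q in \<open>auto simp: poly_pcompose\<close>)
  then show ?thesis by (simp add: fold_Cons_map rev_map)
qed

lemma pt_append:
  assumes "ptime e (enc_list e1) l" "ptime e (enc_list e1) l'"
  shows "ptime e (enc_list e1) (\<lambda>z. l z @ l' z)"
proof -
  have "ptime e (enc_list e1) (\<lambda>z. fold (\<lambda>y a. y # a) (rev (l z)) (l' z))"
    by (rule pt_fold[OF pt_rev[OF assms(1)] assms(2), where q = "[:1, 1:]"])
      ((rule pt_Cons pt_fst pt_snd pt_id)+, simp)
  then show ?thesis by (simp add: fold_Cons_map[of "\<lambda>x. x", simplified])
qed

lemma size_enc_list_append [simp]: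
  "size (enc_list e (l @ l')) = size (enc_list e l) + size (enc_list e l')"
  by (induction l) auto

lemma fold_append_concat: "fold (\<lambda>y a. y @ a) l a = concat (rev l) @ a"
  by (induction l arbitrary: a) auto

lemma pt_concat:
  assumes "ptime e (enc_list (enc_list e1)) l"
  shows "ptime e (enc_list e1) (\<lambda>z. concat (l z))"
proof -
  have "ptime e (enc_list e1) (\<lambda>z. fold (\<lambda>y a. y @ a) (rev (l z)) [])"
    by (rule pt_fold[OF pt_rev[OF assms] pt_const, where q = "[:0, 1:]"])
      ((rule pt_append pt_fst pt_snd pt_id)+, simp)
  then show ?thesis by (simp add: fold_append_concat)
qed

lemma filter_conv_concat_map: "filter P l = concat (map (\<lambda>x. if P x then [x] else []) l)"
  by (induction l) auto

lemma pt_filter: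
  assumes "ptime e (enc_list e1) l" "ptime (enc_prod e e1) enc_bool (\<lambda>z. P (fst z) (snd z))"
  shows "ptime e (enc_list e1) (\<lambda>z. filter (P z) (l z))"
  unfolding filter_conv_concat_map
  by (rule pt_concat pt_map[OF assms(1)] pt_If[OF assms(2)] pt_Cons pt_const pt_snd pt_id)+

lemma pt_ex:
  assumes "ptime e (enc_list e1) l" "ptime (enc_prod e e1) enc_bool (\<lambda>z. P (fst z) (snd z))"
  shows "ptime e enc_bool (\<lambda>z. \<exists>x\<in>set (l z). P z x)"
  using pt_notNil[OF pt_filter[OF assms]] by (rule pt_recode) (auto simp: filter_empty_conv)

lemma pt_all:
  assumes "ptime e (enc_list e1) l" "ptime (enc_prod e e1) enc_bool (\<lambda>z. P (fst z) (snd z))"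
  shows "ptime e enc_bool (\<lambda>z. \<forall>x\<in>set (l z). P z x)"
  using pt_not[OF pt_ex[OF assms(1) pt_not[OF assms(2)]]] by simp

named_theorems pt_intros

lemmas [pt_intros] = pt_const pt_id pt_fst pt_snd pt_Pair pt_Cons pt_hdd pt_tl pt_isNil pt_rev pt_map
  pt_append pt_concat pt_filter pt_ex pt_all pt_If pt_not pt_conj pt_disj

section \<open>Unary numbers and equality tests\<close>

fun enc_un :: "nat \<Rightarrow> tree" where
  "enc_un 0 = Leaf"
| "enc_un (Suc n) = Node Leaf (enc_un n)"

lemma size_enc_un [simp]: "size (enc_un n) = n"
  by (induction n) auto

lemma pt_Suc [pt_intros]:
  "polytime_on A e enc_un f \<Longrightarrow> polytime_on A e enc_un (\<lambda>z. Suc (f z))"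
  by (erule pt_recode[OF pt_Pair[OF pt_const[where c = "()" and e' = "\<lambda>_. Leaf"]]]) simp

lemma pt_pred: "polytime_on A e enc_un f \<Longrightarrow> polytime_on A e enc_un (\<lambda>z. f z - Suc 0)"
proof (erule pt_via_right)
  show "enc_un (f x - Suc 0) = right (enc_un (f x))" for x by (cases "f x") auto
qed

lemma enc_un_length: "enc_un (length l) = enc_list (\<lambda>_. Leaf) l"
  by (induction l) auto

lemma pt_length [pt_intros]:
  assumes "ptime e (enc_list e1) l"
  shows "ptime e enc_un (\<lambda>z. length (l z))"
  by (rule pt_recode[OF pt_map[OF assms pt_const[where c = "()" and e' = "\<lambda>_. Leaf"]]])
    (simp add: enc_un_length[symmetric])

lemma pt_units: "polytime_on A e enc_un n \<Longrightarrow> polytime_on A e (enc_list (\<lambda>_. Leaf)) (\<lambda>z. replicate (n z) ())"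
  by (erule pt_recode) (simp add: enc_un_length[symmetric])

lemma pt_funpow:
  assumes "ptime e enc_un n" "ptime e e2 a" "ptime (enc_prod e e2) e2 (\<lambda>z. h (fst z) (snd z))"
    and "\<And>x a. size (e2 (h x a)) \<le> size (e2 a) + poly q (size (e x))"
  shows "ptime e e2 (\<lambda>z. (h z ^^ n z) (a z))"
proof -
  have "ptime e e2 (\<lambda>z. fold (\<lambda>_. h z) (replicate (n z) ()) (a z))"
  proof (rule pt_fold[OF pt_units[OF assms(1)] assms(2)])
    have "ptime (enc_prod e (enc_prod (\<lambda>_. Leaf) e2)) (enc_prod e e2) (\<lambda>z. (fst z, snd (snd z)))"
      by (rule pt_intros)+
    from pt_comp[OF this assms(3)]
    show "ptime (enc_prod e (enc_prod (\<lambda>_. Leaf) e2)) e2 (\<lambda>z. h (fst z) (snd (snd z)))" by simp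
    show "size (e2 (h x a)) \<le> size (e2 a) + poly q (size (e x) + size Leaf)" for x a
      using assms(4) by simp
  qed
  then show ?thesis by (simp add: fold_replicate)
qed

lemma pt_drop [pt_intros]:
  fixes l :: "'a \<Rightarrow> 'b list"
  assumes "ptime e enc_un n" "ptime e (enc_list e1) l"
  shows "ptime e (enc_list e1) (\<lambda>z. drop (n z) (l z))"
proof -
  have "(tl ^^ k) xs = drop k xs" for k and xs :: "'b list"
    by (induction k) (simp_all add: drop_Suc tl_drop)
  moreover have "size (enc_list e1 (tl a)) \<le> size (enc_list e1 a)" for a by (cases a) auto
  then have "ptime e (enc_list e1) (\<lambda>z. (tl ^^ n z) (l z))"
    by - (rule pt_funpow[OF assms, where q = 0], (rule pt_intros)+, simp)
  ultimately show ?thesis by simp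
qed

lemma pt_minus_un [pt_intros]:
  assumes "ptime e enc_un f" "ptime e enc_un g"
  shows "ptime e enc_un (\<lambda>z. f z - g z)"
proof -
  have "((\<lambda>r. r - Suc 0) ^^ k) m = m - k" for k m :: nat
    by (induction k) auto
  moreover have "ptime e enc_un (\<lambda>z. ((\<lambda>r. r - Suc 0) ^^ g z) (f z))"
    by (rule pt_funpow[OF assms(2,1), where q = 0]) (rule pt_pred pt_intros | simp)+
  ultimately show ?thesis by simp
qed

lemma pt_add_un [pt_intros]:
  assumes "ptime e enc_un f" "ptime e enc_un g"
  shows "ptime e enc_un (\<lambda>z. f z + g z)"
proof -
  have "(Suc ^^ k) m = k + m" for k m :: nat
    by (induction k) auto
  moreover have "ptime e enc_un (\<lambda>z. (Suc ^^ f z) (g z))"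
    by (rule pt_funpow[OF assms, where q = 1]) (rule pt_intros | simp)+
  ultimately show ?thesis by simp
qed

lemma pt_mult_un [pt_intros]:
  assumes "ptime e enc_un f" "ptime e enc_un g"
  shows "ptime e enc_un (\<lambda>z. f z * g z)"
proof -
  obtain q where q: "\<forall>z\<in>UNIV. size (enc_un (g z)) \<le> poly q (size (e z))"
    by (rule polytime_on_size[OF assms(2)])
  have "((+) m ^^ k) 0 = k * m" for k m :: nat
    by (induction k) auto
  moreover have "ptime e enc_un (\<lambda>z. ((+) (g z) ^^ f z) 0)"
  proof (rule pt_funpow[OF assms(1) pt_const, where q = q])
    have "ptime (enc_prod e enc_un) enc_un (\<lambda>z. g (fst z))"
      by (rule pt_comp[OF _ assms(2)]) (rule pt_intros)+
    then show "ptime (enc_prod e enc_un) enc_un (\<lambda>z. g (fst z) + snd z)"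
      by - (assumption | rule pt_intros)+
  qed (use q in auto)
  ultimately show ?thesis by simp
qed

lemma pt_power_un [pt_intros]:
  assumes "ptime e enc_un f"
  shows "ptime e enc_un (\<lambda>z. f z ^ k)"
proof (induction k)
  case (Suc k)
  from pt_mult_un[OF assms Suc] show ?case by simp
qed (simp add: pt_const)

lemma pt_le_un [pt_intros]:
  assumes "ptime e enc_un f" "ptime e enc_un g"
  shows "ptime e enc_bool (\<lambda>z. f z \<le> g z)"
proof -
  have leaf: "enc_un n = Leaf \<longleftrightarrow> n = 0" for n by (cases n) auto
  have "ptime e enc_bool (\<lambda>z. \<not> f z \<le> g z)"
    by (rule pt_nonleaf[OF pt_minus_un[OF assms]]) (simp add: leaf)
  from pt_not[OF this] show ?thesis by simp
qed

lemma pt_less_un [pt_intros]: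
  assumes "ptime e enc_un f" "ptime e enc_un g"
  shows "ptime e enc_bool (\<lambda>z. f z < g z)"
  using pt_not[OF pt_le_un[OF assms(2,1)]] by (simp add: not_le)

lemma pt_min_un [pt_intros]:
  assumes "ptime e enc_un f" "ptime e enc_un g"
  shows "ptime e enc_un (\<lambda>z. min (f z) (g z))"
  unfolding min_def by (rule assms pt_intros)+

lemma pt_replicate [pt_intros]:
  assumes "ptime e enc_un n" "ptime e e1 f"
  shows "ptime e (enc_list e1) (\<lambda>z. replicate (n z) (f z))"
proof -
  have "ptime e (enc_list e1) (\<lambda>z. map (\<lambda>_. f z) (replicate (n z) ()))"
  proof (rule pt_map[OF pt_units[OF assms(1)]])
    show "ptime (enc_prod e (\<lambda>_. Leaf)) e1 (\<lambda>z. f (fst z))"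
      by (rule pt_comp[OF _ assms(2)]) (rule pt_intros)+
  qed
  then show ?thesis by simp
qed

lemma pt_upt [pt_intros]:
  assumes "ptime e enc_un n"
  shows "ptime e (enc_list enc_un) (\<lambda>z. [0..<n z])"
proof -
  obtain q where q: "\<forall>z\<in>UNIV. size (enc_un (n z)) \<le> poly q (size (e z))"
    by (rule polytime_on_size[OF assms])
  let ?h = "\<lambda>z a. (Suc (fst a), (if fst a \<le> n z then fst a else 0) # snd a)"
  have "ptime e (enc_prod enc_un (enc_list enc_un)) (\<lambda>z. (?h z ^^ n z) (0, []))"
  proof (rule pt_funpow[OF assms pt_const, where q = "q + 2"])
    have "ptime (enc_prod e (enc_prod enc_un (enc_list enc_un))) enc_un (\<lambda>z. n (fst z))"
      by (rule pt_comp[OF _ assms]) (rule pt_intros)+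
    then show "ptime (enc_prod e (enc_prod enc_un (enc_list enc_un))) (enc_prod enc_un (enc_list enc_un))
       (\<lambda>z. (Suc (fst (snd z)), (if fst (snd z) \<le> n (fst z) then fst (snd z) else 0) # snd (snd z)))"
      by - (assumption | rule pt_intros)+
    show "size (enc_prod enc_un (enc_list enc_un) (?h x a))
       \<le> size (enc_prod enc_un (enc_list enc_un) a) + poly (q + 2) (size (e x))" for x a
      using q[rule_format, of x] by (auto simp: enc_prod_def)
  qed
  moreover have "(?h z ^^ k) (0, []) = (k, rev [0..<k])" if "k \<le> n z" for z k
    using that by (induction k) auto
  ultimately have "ptime e (enc_prod enc_un (enc_list enc_un)) (\<lambda>z. (n z, rev [0..<n z]))" by simp
  from pt_rev[OF pt_snd[OF this]] show ?thesis by simp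
qed

lemma pt_tree_eq:
  assumes "ptime e e1 f" "ptime e e2 g"
  shows "ptime e enc_bool (\<lambda>z. e1 (f z) = e2 (g z))"
proof -
  let ?e = "enc_prod (enc_list (enc_prod (\<lambda>t. t) (\<lambda>t. t))) enc_bool"
  let ?b = "\<lambda>s :: (tree \<times> tree) list \<times> bool. fst s \<noteq> []"
  let ?p = "\<lambda>s :: (tree \<times> tree) list \<times> bool. hdd (Leaf, Leaf) (fst s)"
  let ?x = "\<lambda>s. fst (?p s)" and ?y = "\<lambda>s. snd (?p s)"
  let ?f = "\<lambda>s. if ?x s = Leaf then (tl (fst s), snd s \<and> ?y s = Leaf)
     else if ?y s = Leaf then (tl (fst s), False)
     else ((left (?x s), left (?y s)) # (right (?x s), right (?y s)) # tl (fst s), snd s)"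
  let ?g = "\<lambda>s :: (tree \<times> tree) list \<times> bool. ([] :: (tree \<times> tree) list, snd s \<and> (\<forall>p\<in>set (fst s). fst p = snd p))"
  let ?\<mu> = "\<lambda>s :: (tree \<times> tree) list \<times> bool. \<Sum>p\<leftarrow>fst s. 2 * size (fst p) + 1"
  let ?\<Phi> = "\<lambda>s :: (tree \<times> tree) list \<times> bool. 2 + (\<Sum>p\<leftarrow>fst s. 3 * (size (fst p) + size (snd p)) + 2)"
  have isLeaf: "ptime e' enc_bool (\<lambda>z. h z = Leaf)" if "ptime e' (\<lambda>t. t) h" for e' :: "'z \<Rightarrow> tree" and h
    using pt_not[OF pt_nonleaf[OF that]] by simp
  have "ptime ?e ?e ?g"
  proof (rule pt_While[where b = ?b and f = ?f and \<mu> = ?\<mu> and \<Phi> = ?\<Phi> and q = "[:1, 2:]" and r = "[:2, 3:]"])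
    show "ptime ?e enc_bool ?b" by (rule pt_intros)+
    have "ptime ?e ?e ?f"
      by (rule pt_intros isLeaf pt_comp[OF _ pt_left] pt_comp[OF _ pt_right])+
    then show "polytime_on {s. ?b s} ?e ?e ?f" by (rule polytime_on_subset) simp
    fix s :: "(tree \<times> tree) list \<times> bool"
    obtain W ok where s: "s = (W, ok)" by (cases s)
    have split: thesis if "\<And>x y W'. W = (x, y) # W' \<Longrightarrow> thesis" "?b s" for thesis
      using that s by (metis fst_conv list.exhaust surj_pair)
    show "?g s = (if ?b s then ?g (?f s) else s)"
    proof (cases "?b s")
      case True
      then obtain x y W' where "W = (x, y) # W'" by (metis split)
      with s show ?thesis by (cases x; cases y) auto
    qed (auto simp: s)
    show "?\<mu> (?f s) < ?\<mu> s" if b: "?b s"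
    proof -
      obtain x y W' where "W = (x, y) # W'" using b by (metis split)
      with s show ?thesis by (cases x; cases y) auto
    qed
    show "?\<Phi> (?f s) \<le> ?\<Phi> s" if b: "?b s"
    proof -
      obtain x y W' where "W = (x, y) # W'" using b by (metis split)
      with s show ?thesis by (cases x; cases y) auto
    qed
    have "(\<Sum>p\<leftarrow>W. 2 * size (fst p) + 1) \<le> 2 * size (enc_list (enc_prod (\<lambda>t. t) (\<lambda>t. t)) W)"
      by (induction W) (auto simp: enc_prod_def)
    then show "?\<mu> s \<le> poly [:1, 2:] (size (?e s))" by (simp add: s)
    have "size (enc_list (enc_prod (\<lambda>t. t) (\<lambda>t. t)) W) \<le> (\<Sum>p\<leftarrow>W. 3 * (size (fst p) + size (snd p)) + 2)"
      by (induction W) (auto simp: enc_prod_def)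
    then show "size (?e s) \<le> ?\<Phi> s" by (simp add: s enc_bool_def)
    have "(\<Sum>p\<leftarrow>W. 3 * (size (fst p) + size (snd p)) + 2) \<le> 3 * size (enc_list (enc_prod (\<lambda>t. t) (\<lambda>t. t)) W)"
      by (induction W) (auto simp: enc_prod_def)
    then show "?\<Phi> s \<le> poly [:2, 3:] (size (?e s))" by (simp add: s)
  qed
  moreover have "ptime e ?e (\<lambda>z. ([(e1 (f z), e2 (g z))], True))"
    by (rule pt_Pair pt_Cons pt_const pt_recode[OF assms(1)] pt_recode[OF assms(2)] refl)+
  ultimately have "ptime e ?e (\<lambda>z. ([], True \<and> (\<forall>p\<in>set [(e1 (f z), e2 (g z))]. fst p = snd p)))"
    using pt_comp by fastforce
  from pt_snd[OF this] show ?thesis by simp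
qed

lemma pt_eq [pt_intros]:
  assumes "ptime e e1 f" "ptime e e1 g" "inj e1"
  shows "ptime e enc_bool (\<lambda>z. f z = g z)"
  using pt_tree_eq[OF assms(1,2)] assms(3) by (simp add: inj_eq)

lemma inj_enc_bool [pt_intros]: "inj enc_bool"
  by (auto simp: inj_def enc_bool_def)

lemma inj_enc_un [pt_intros]: "inj enc_un"
  by (metis injI size_enc_un)

lemma inj_enc_list [pt_intros]:
  assumes "inj e"
  shows "inj (enc_list e)"
proof (rule injI)
  show "enc_list e l = enc_list e l' \<Longrightarrow> l = l'" for l l'
  proof (induction l arbitrary: l')
    case Nil
    then show ?case by (cases l') auto
  next
    case (Cons x l)
    then show ?case using assms by (cases l') (auto dest: injD)
  qed
qed

lemma fold_remdups: "fold (\<lambda>x acc. if \<exists>y\<in>set acc. y = x then acc else x # acc) (rev l) [] = remdups l"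
  by (induction l) auto

lemma pt_remdups [pt_intros]:
  assumes "ptime e (enc_list e1) l" "inj e1"
  shows "ptime e (enc_list e1) (\<lambda>z. remdups (l z))"
  unfolding fold_remdups[symmetric]
  by (rule pt_fold[where q = "[:1, 1:]"]) (rule assms pt_intros | simp)+

lemma pt_mem [pt_intros]:
  assumes "ptime e e1 f" "ptime e (enc_list e1) l" "inj e1"
  shows "ptime e enc_bool (\<lambda>z. f z \<in> set (l z))"
proof -
  have "ptime e enc_bool (\<lambda>z. \<exists>x\<in>set (l z). x = f z)"
    by (rule assms pt_intros pt_comp[OF _ assms(1)])+
  then show ?thesis by (simp add: Bex_def)
qed

section \<open>Binary arithmetic\<close>

function bits :: "nat \<Rightarrow> bool list" where
  "bits n = (if n = 0 then [] else odd n # bits (n div 2))"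
  by auto
termination by (relation "measure (\<lambda>n. n)") auto

declare bits.simps [simp del]

lemma bits_0 [simp]: "bits 0 = []"
  by (simp add: bits.simps)

lemma enc_nat_0 [simp]: "enc_nat 0 = Leaf"
  by (simp add: enc_nat.simps)

lemma enc_nat_bits: "enc_nat n = enc_list enc_bool (bits n)"
proof (induction n rule: less_induct)
  case (less n)
  then show ?case
    by (cases "n = 0") (simp_all add: enc_nat.simps[of n] bits.simps[of n])
qed

lemma enc_nat_Leaf_iff [simp]: "enc_nat n = Leaf \<longleftrightarrow> n = 0"
  by (simp add: enc_nat.simps[of n])

lemma less_2_power_bits: "n < 2 ^ length (bits n)"
proof (induction n rule: less_induct)
  case (less n)
  then show ?case
  proof (cases "n = 0")
    case False
    with less have "n div 2 < 2 ^ length (bits (n div 2))" by simp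
    then show ?thesis using False by (simp add: bits.simps[of n])
  qed simp
qed

lemma length_bits_le: "n < 2 ^ k \<Longrightarrow> length (bits n) \<le> k"
proof (induction k arbitrary: n)
  case (Suc k)
  then have "n div 2 < 2 ^ k" by simp
  then show ?case using Suc.IH by (simp add: bits.simps[of n])
qed auto

lemma size_enc_bool_le: "size (enc_bool b) \<le> 1"
  by (simp add: enc_bool_def)

lemma size_enc_list_bool: "size (enc_list enc_bool bs) \<le> 2 * length bs"
proof (induction bs)
  case (Cons b bs)
  then show ?case using size_enc_bool_le[of b] by simp
qed simp

lemma size_enc_nat_le: "size (enc_nat n) \<le> 2 * length (bits n)"
  by (simp add: enc_nat_bits size_enc_list_bool)

lemma length_bits_le_size: "length (bits n) \<le> size (enc_nat n)"
  by (simp add: enc_nat_bits length_le_size_enc_list)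

lemma length_bits_le_self: "length (bits n) \<le> n"
  by (rule length_bits_le) simp

lemma inj_enc_nat [pt_intros]: "inj enc_nat"
proof (rule injI)
  show "enc_nat m = enc_nat n \<Longrightarrow> m = n" for m n
  proof (induction m arbitrary: n rule: less_induct)
    case (less m)
    show ?case
    proof (cases "m = 0")
      case True
      with less.prems enc_nat_Leaf_iff[of n] show ?thesis by simp
    next
      case False
      with less.prems have "n \<noteq> 0" by (metis enc_nat_0 enc_nat_Leaf_iff)
      with False less.prems have "enc_bool (odd m) = enc_bool (odd n)" "enc_nat (m div 2) = enc_nat (n div 2)"
        by (simp_all add: enc_nat.simps[of m] enc_nat.simps[of n])
      with less.IH[of "m div 2" "n div 2"] False have "odd m = odd n" "m div 2 = n div 2"
        by (auto simp: enc_bool_def split: if_splits)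
      then show ?thesis by (metis odd_two_times_div_two_succ dvd_mult_div_cancel)
    qed
  qed
qed

lemma inj_enc_int [pt_intros]: "inj enc_int"
proof (rule injI)
  fix i j assume "enc_int i = enc_int j"
  then have "enc_bool (i < 0) = enc_bool (j < 0)" "enc_nat (nat \<bar>i\<bar>) = enc_nat (nat \<bar>j\<bar>)"
    by (simp_all add: enc_int_def)
  then have "(i < 0) = (j < 0)" "nat \<bar>i\<bar> = nat \<bar>j\<bar>"
    using inj_enc_bool inj_enc_nat by (auto dest: injD)
  then show "i = j" by linarith
qed

lemma pt_bits: "polytime_on A e enc_nat f \<Longrightarrow> polytime_on A e (enc_list enc_bool) (\<lambda>z. bits (f z))"
  by (erule pt_recode) (simp add: enc_nat_bits)

lemma pt_odd: "polytime_on A e enc_nat f \<Longrightarrow> polytime_on A e enc_bool (\<lambda>z. odd (f z))"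
proof (erule pt_via_left)
  show "enc_bool (odd (f x)) = left (enc_nat (f x))" for x
    by (cases "f x = 0") (simp_all add: enc_nat.simps[of "f x"] enc_bool_def)
qed

lemma pt_half: "polytime_on A e enc_nat f \<Longrightarrow> polytime_on A e enc_nat (\<lambda>z. f z div 2)"
proof (erule pt_via_right)
  show "enc_nat (f x div 2) = right (enc_nat (f x))" for x
    by (cases "f x = 0") (simp_all add: enc_nat.simps[of "f x"])
qed

lemma enc_nat_double: "enc_nat (2 * n + of_bool b) =
    (if b \<or> n \<noteq> 0 then Node (enc_bool b) (enc_nat n) else Leaf)"
  by (subst enc_nat.simps) auto

lemma pt_double:
  assumes "polytime_on A e enc_nat f" "polytime_on A e enc_bool b"
  shows "polytime_on A e enc_nat (\<lambda>z. 2 * f z + of_bool (b z))"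
proof -
  have 0: "polytime_on A e enc_bool (\<lambda>z. f z \<noteq> 0)" by (rule pt_nonleaf[OF assms(1)]) simp
  have "polytime_on A e (\<lambda>t. t) (\<lambda>z. if b z \<or> f z \<noteq> 0 then Node (enc_bool (b z)) (enc_nat (f z)) else Leaf)"
    by (rule pt_If pt_disj 0 assms pt_const pt_recode[OF pt_Pair[OF assms(2,1)]] enc_prod_Pair[symmetric])+
  then show ?thesis by (rule pt_recode) (simp add: enc_nat_double)
qed

definition unbits :: "bool list \<Rightarrow> nat" where
  "unbits bs = fold (\<lambda>b r. 2 * r + of_bool b) bs 0"

lemma pt_unbits:
  assumes "ptime e (enc_list enc_bool) f"
  shows "ptime e enc_nat (\<lambda>z. unbits (f z))"
  unfolding unbits_def
proof (rule pt_fold[OF assms pt_const, where q = 2])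
  show "ptime (enc_prod e (enc_prod enc_bool enc_nat)) enc_nat (\<lambda>z. 2 * snd (snd z) + of_bool (fst (snd z)))"
    by (rule pt_double pt_intros)+
  show "size (enc_nat (2 * a + of_bool y)) \<le> size (enc_nat a) + poly 2 (size (e x) + size (enc_bool y))" for x y a
    using size_enc_bool_le[of y] by (simp add: enc_nat_double)
qed

lemma unbits_fold: "fold (\<lambda>b r. 2 * r + of_bool b) bs r = 2 ^ length bs * r + unbits bs"
proof (induction bs arbitrary: r)
  case (Cons b bs)
  show ?case
    using Cons[of "2 * r + of_bool b"] Cons[of "of_bool b"]
    by (simp add: unbits_def algebra_simps)
qed (simp add: unbits_def)

lemma unbits_Cons: "unbits (b # bs) = 2 ^ length bs * of_bool b + unbits bs"
  using unbits_fold[of bs "of_bool b"] by (simp add: unbits_def)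

lemma unbits_less: "unbits bs < 2 ^ length bs"
proof (induction bs)
  case Nil
  then show ?case by (simp add: unbits_def)
next
  case (Cons b bs)
  then show ?case by (cases b) (simp_all add: unbits_Cons)
qed

lemma unbits_snoc: "unbits (bs @ [b]) = 2 * unbits bs + of_bool b"
  by (simp add: unbits_def)

lemma unbits_rev_bits: "unbits (rev (bits n)) = n"
proof (induction n rule: less_induct)
  case (less n)
  then show ?case
    by (cases "n = 0") (simp_all add: bits.simps[of n] unbits_snoc, simp add: unbits_def)
qed

text \<open>
  The ripple-carry adder; with the flag set it subtracts, and the carry becomes a borrow.
  The output bits are collected with the most significant bit first.
\<close>

fun ripple :: "bool \<Rightarrow> (nat \<times> nat) \<times> bool \<times> bool list \<Rightarrow> (nat \<times> nat) \<times> bool \<times> bool list" where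
  "ripple s ((a, b), c, out) =
     ((a div 2, b div 2),
      ((odd a \<noteq> s) \<and> odd b \<or> (odd a \<noteq> s) \<and> c \<or> odd b \<and> c),
      ((odd a \<noteq> odd b) \<noteq> c) # out)"

lemma ripple_funpow:
  fixes \<sigma> :: int
  assumes "\<sigma> = (if s then -1 else 1)" "(ripple s ^^ n) ((a, b), False, []) = ((a', b'), c', out)"
  shows "length out = n \<and> a' = a div 2 ^ n \<and> b' = b div 2 ^ n \<and>
     int a + \<sigma> * int b = int (unbits out) + 2 ^ n * (int a' + \<sigma> * int b' + \<sigma> * of_bool c')"
  using assms(2)
proof (induction n arbitrary: a' b' c' out)
  case 0
  then show ?case by (simp add: unbits_def)
next
  case (Suc n)
  obtain a1 b1 c1 out1 where 1: "(ripple s ^^ n) ((a, b), False, []) = ((a1, b1), c1, out1)"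
    by (metis surj_pair)
  note IH = Suc.IH[OF 1]
  define bit where "bit = ((odd a1 \<noteq> odd b1) \<noteq> c1)"
  have new: "a' = a1 div 2" "b' = b1 div 2" "out = bit # out1"
    "c' = ((odd a1 \<noteq> s) \<and> odd b1 \<or> (odd a1 \<noteq> s) \<and> c1 \<or> odd b1 \<and> c1)"
    using Suc.prems 1 by (auto simp: bit_def)
  have "int a1 = 2 * int a' + of_bool (odd a1)" "int b1 = 2 * int b' + of_bool (odd b1)"
    unfolding new by (simp_all add: zdiv_int mod_2_eq_odd[symmetric] of_nat_mod)
  then have "int a1 + \<sigma> * int b1 + \<sigma> * of_bool c1 = of_bool bit + 2 * (int a' + \<sigma> * int b' + \<sigma> * of_bool c')"
    using assms(1) unfolding new(4) bit_def
    by (cases "odd a1"; cases "odd b1"; cases c1; cases s) auto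
  then have "int a + \<sigma> * int b = int (unbits out1) + 2 ^ n * (of_bool bit + 2 * (int a' + \<sigma> * int b' + \<sigma> * of_bool c'))"
    using IH by simp
  also have "\<dots> = int (unbits out) + 2 ^ Suc n * (int a' + \<sigma> * int b' + \<sigma> * of_bool c')"
    using IH by (simp add: new(3) unbits_Cons distrib_left)
  finally have eq: "int a + \<sigma> * int b = \<dots>" .
  have "m div 2 ^ n div 2 = m div 2 ^ Suc n" for m :: nat
    unfolding power_Suc2 by (simp only: div_mult2_eq)
  then show ?case using IH eq new(1-3) by simp
qed

definition rounds :: "nat \<Rightarrow> nat \<Rightarrow> nat" where
  "rounds a b = Suc (length (bits a) + length (bits b))"

lemma less_rounds: "a < 2 ^ rounds a b" "b < 2 ^ rounds a b" "a + b < 2 ^ rounds a b"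
proof -
  have "(2::nat) ^ length (bits a) \<le> 2 ^ (length (bits a) + length (bits b))"
    "(2::nat) ^ length (bits b) \<le> 2 ^ (length (bits a) + length (bits b))"
    by (intro power_increasing, simp_all)+
  with less_2_power_bits[of a] less_2_power_bits[of b] show
    "a < 2 ^ rounds a b" "b < 2 ^ rounds a b" "a + b < 2 ^ rounds a b"
    unfolding rounds_def power_Suc by linarith+
qed

definition ripple_run :: "bool \<Rightarrow> nat \<Rightarrow> nat \<Rightarrow> bool \<times> bool list" where
  "ripple_run s a b = snd ((ripple s ^^ rounds a b) ((a, b), False, []))"

lemma ripple_run:
  fixes \<sigma> :: int
  assumes "\<sigma> = (if s then -1 else 1)" "ripple_run s a b = (c, out)"
  shows "length out = rounds a b" "int a + \<sigma> * int b = int (unbits out) + 2 ^ rounds a b * \<sigma> * of_bool c"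
proof -
  obtain a' b' where "(ripple s ^^ rounds a b) ((a, b), False, []) = ((a', b'), c, out)"
    using assms(2) by (metis ripple_run_def prod.collapse)
  from ripple_funpow[OF assms(1) this] less_rounds[of a b]
  show "length out = rounds a b" "int a + \<sigma> * int b = int (unbits out) + 2 ^ rounds a b * \<sigma> * of_bool c"
    by simp_all
qed

lemma ripple_add: "unbits (snd (ripple_run False a b)) = a + b"
proof -
  obtain c out where r: "ripple_run False a b = (c, out)" by fastforce
  note eq = ripple_run(2)[OF _ r, of 1]
  have "\<not> c"
  proof
    assume c
    with eq have "2 ^ rounds a b \<le> int (a + b)" by simp
    moreover have "int (a + b) < 2 ^ rounds a b" using less_rounds(3)[of a b] by (metis of_nat_less_iff of_nat_numeral of_nat_power)
    ultimately show False by simp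
  qed
  with eq r show ?thesis by simp
qed

lemma ripple_sub: "(if fst (ripple_run True a b) then 0 else unbits (snd (ripple_run True a b))) = a - b"
proof -
  obtain c out where r: "ripple_run True a b = (c, out)" by fastforce
  note eq = ripple_run(2)[OF _ r, of "-1"] and len = ripple_run(1)[OF _ r, of "-1"]
  have less: "int (unbits out) < 2 ^ rounds a b"
    using unbits_less[of out] len by (metis of_nat_less_iff of_nat_numeral of_nat_power)
  show ?thesis
  proof (cases c)
    case True
    with eq have "int a = int b + int (unbits out) - 2 ^ rounds a b" by simp
    with less have "a < b" by linarith
    with r True show ?thesis by simp
  next
    case False
    with eq have "int a - int b = int (unbits out)" by simp
    then show ?thesis using r False by simp
  qed
qed

lemma pt_ripple_run:
  assumes "ptime e enc_nat f" "ptime e enc_nat g"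
  shows "ptime e (enc_prod enc_bool (enc_list enc_bool)) (\<lambda>z. ripple_run s (f z) (g z))"
  unfolding ripple_run_def rounds_def
proof (rule pt_snd, rule pt_funpow[where q = 3])
  show "ptime e enc_un (\<lambda>z. Suc (length (bits (f z)) + length (bits (g z))))"
    by (rule pt_intros pt_bits assms)+
  show "ptime e (enc_prod (enc_prod enc_nat enc_nat) (enc_prod enc_bool (enc_list enc_bool)))
     (\<lambda>z. ((f z, g z), False, []))"
    by (rule pt_intros assms)+
  let ?e = "enc_prod (enc_prod enc_nat enc_nat) (enc_prod enc_bool (enc_list enc_bool))"
  have eq: "ripple s z = (((fst (fst z)) div 2, snd (fst z) div 2),
      ((odd (fst (fst z)) \<noteq> s) \<and> odd (snd (fst z)) \<or> (odd (fst (fst z)) \<noteq> s) \<and> fst (snd z) \<or> odd (snd (fst z)) \<and> fst (snd z)),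
      ((odd (fst (fst z)) \<noteq> odd (snd (fst z))) \<noteq> fst (snd z)) # snd (snd z))" for s z
    by (metis ripple.simps prod.collapse)
  show "ptime (enc_prod e ?e) ?e (\<lambda>z. ripple s (snd z))"
    unfolding eq by (rule pt_Pair pt_half pt_odd pt_Cons pt_disj pt_conj pt_not pt_beq pt_fst pt_snd pt_id pt_const)+
  show "size (?e (ripple s z)) \<le> size (?e z) + poly 3 (size (e x))" for x z
  proof -
    have half: "size (enc_nat (n div 2)) \<le> size (enc_nat n)" for n
      by (cases "n = 0") (simp_all add: enc_nat.simps[of n])
    obtain a b c out where "z = ((a, b), c, out)" by (metis surj_pair)
    then show ?thesis using half[of a] half[of b] by (simp add: enc_bool_def)
  qed
qed

lemma pt_add_nat [pt_intros]:
  assumes "ptime e enc_nat f" "ptime e enc_nat g"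
  shows "ptime e enc_nat (\<lambda>z. f z + g z)"
  unfolding ripple_add[symmetric] by (rule pt_unbits pt_snd pt_ripple_run assms)+

lemma pt_minus_nat [pt_intros]:
  assumes "ptime e enc_nat f" "ptime e enc_nat g"
  shows "ptime e enc_nat (\<lambda>z. f z - g z)"
  unfolding ripple_sub[symmetric] by (rule pt_If pt_unbits pt_snd pt_fst pt_const pt_ripple_run assms)+

lemma pt_le_nat [pt_intros]:
  assumes "ptime e enc_nat f" "ptime e enc_nat g"
  shows "ptime e enc_bool (\<lambda>z. f z \<le> g z)"
proof -
  have "ptime e enc_bool (\<lambda>z. \<not> f z \<le> g z)"
    by (rule pt_nonleaf[OF pt_minus_nat[OF assms]]) simp
  from pt_not[OF this] show ?thesis by simp
qed

lemma pt_abs [pt_intros]: "polytime_on A e enc_int f \<Longrightarrow> polytime_on A e enc_nat (\<lambda>z. nat \<bar>f z\<bar>)"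
  by (erule pt_via_right) (simp add: enc_int_def)

lemma pt_neg_test [pt_intros]: "polytime_on A e enc_int f \<Longrightarrow> polytime_on A e enc_bool (\<lambda>z. f z < 0)"
  by (erule pt_via_left) (simp add: enc_int_def)

lemma pt_int [pt_intros]:
  assumes "polytime_on A e enc_nat f"
  shows "polytime_on A e enc_int (\<lambda>z. int (f z))"
  by (rule pt_recode[OF pt_Pair[OF pt_const[where c = False and e' = enc_bool] assms]])
    (simp add: enc_int_def)

lemma pt_neg_int:
  assumes "polytime_on A e enc_nat f"
  shows "polytime_on A e enc_int (\<lambda>z. - int (f z))"
proof -
  have "polytime_on A e enc_bool (\<lambda>z. f z \<noteq> 0)" by (rule pt_nonleaf[OF assms]) simp
  from pt_Pair[OF this assms] show ?thesis by (rule pt_recode) (simp add: enc_int_def)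
qed

lemma int_diff_cases: "x - y =
   (if (x < 0) = (y < 0) then
      if (x < 0) = (nat \<bar>y\<bar> \<le> nat \<bar>x\<bar>) then - int ((nat \<bar>x\<bar> - nat \<bar>y\<bar>) + (nat \<bar>y\<bar> - nat \<bar>x\<bar>))
      else int ((nat \<bar>x\<bar> - nat \<bar>y\<bar>) + (nat \<bar>y\<bar> - nat \<bar>x\<bar>))
    else if x < 0 then - int (nat \<bar>x\<bar> + nat \<bar>y\<bar>) else int (nat \<bar>x\<bar> + nat \<bar>y\<bar>))"
  by auto

lemma pt_minus_int [pt_intros]:
  assumes "ptime e enc_int f" "ptime e enc_int g"
  shows "ptime e enc_int (\<lambda>z. f z - g z)"
proof -
  note * = pt_abs[OF assms(1)] pt_abs[OF assms(2)] pt_neg_test[OF assms(1)] pt_neg_test[OF assms(2)]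
  note d = pt_add_nat[OF pt_minus_nat[OF *(1,2)] pt_minus_nat[OF *(2,1)]] and s = pt_add_nat[OF *(1,2)]
  show ?thesis
    by (subst int_diff_cases)
      (rule pt_If pt_beq pt_le_nat pt_neg_int[OF d] pt_int[OF d] pt_neg_int[OF s] pt_int[OF s] *)+
qed

definition slot :: "int \<Rightarrow> bool list \<Rightarrow> int" where
  "slot c bs = fold (\<lambda>b r. if b then 0 else r - c) (rev bs) 0"

lemma slot_Nil [simp]: "slot c [] = 0"
  by (simp add: slot_def)

lemma slot_Cons [simp]: "slot c (b # bs) = (if b then 0 else slot c bs - c)"
  by (simp add: slot_def)

lemma length_bits_diff:
  "length (bits (nat \<bar>r - c\<bar>)) \<le> length (bits (nat \<bar>r\<bar>)) + Suc (length (bits (nat \<bar>c\<bar>)))"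
proof (rule length_bits_le)
  let ?a = "nat \<bar>r\<bar>" and ?b = "nat \<bar>c\<bar>"
  have "nat \<bar>r - c\<bar> \<le> ?a + ?b" by linarith
  also have "\<dots> < 2 ^ rounds ?a ?b" by (rule less_rounds)
  finally show "nat \<bar>r - c\<bar> < 2 ^ (length (bits ?a) + Suc (length (bits ?b)))" by (simp add: rounds_def)
qed

lemma pt_slot [pt_intros]:
  assumes "ptime e enc_int c" "ptime e (enc_list enc_bool) bs"
  shows "ptime e enc_int (\<lambda>z. slot (c z) (bs z))"
proof -
  obtain q where q: "\<forall>z\<in>UNIV. size (enc_int (c z)) \<le> poly q (size (e z))"
    by (rule polytime_on_size[OF assms(1)])
  show ?thesis
    unfolding slot_def
  proof (rule pt_fold_gen[OF pt_rev[OF assms(2)] pt_const,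
        where m = "\<lambda>r. length (bits (nat \<bar>r\<bar>))" and r = "[:2, 2:]" and r' = "[:0, 1:]" and q = "q + 1"])
    have "ptime (enc_prod e (enc_prod enc_bool enc_int)) enc_int (\<lambda>z. c (fst z))"
      by (rule pt_comp[OF _ assms(1)]) (rule pt_intros)+
    then show "ptime (enc_prod e (enc_prod enc_bool enc_int)) enc_int
        (\<lambda>z. if fst (snd z) then 0 else snd (snd z) - c (fst z))"
      by - (assumption | rule pt_intros)+
    show "size (enc_int a) \<le> poly [:2, 2:] (length (bits (nat \<bar>a\<bar>)))" for a
      using size_enc_nat_le[of "nat \<bar>a\<bar>"] size_enc_bool_le[of "a < 0"] by (simp add: enc_int_def)
    show "length (bits (nat \<bar>a\<bar>)) \<le> poly [:0, 1:] (size (enc_int a))" for a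
      using length_bits_le_size[of "nat \<bar>a\<bar>"] by (simp add: enc_int_def)
    show "length (bits (nat \<bar>if y then 0 else a - c x\<bar>))
       \<le> length (bits (nat \<bar>a\<bar>)) + poly (q + 1) (size (e x) + size (enc_bool y))" for x y a
    proof -
      have "length (bits (nat \<bar>c x\<bar>)) \<le> size (enc_int (c x))"
        using length_bits_le_size[of "nat \<bar>c x\<bar>"] by (simp add: enc_int_def)
      also have "\<dots> \<le> poly q (size (e x))" using q by simp
      also have "\<dots> \<le> poly q (size (e x) + size (enc_bool y))" by (rule poly_nat_mono) simp
      finally show ?thesis using length_bits_diff[of a "c x"] by auto
    qed
  qed
qed

lemma pt_un_to_nat:
  assumes "ptime e enc_un f"
  shows "ptime e enc_nat f"
proof -
  have "slot 1 (replicate n False) = - int n" for n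
    by (induction n) auto
  moreover have "ptime e enc_nat (\<lambda>z. nat \<bar>slot 1 (replicate (f z) False)\<bar>)"
    by (rule assms pt_intros)+
  ultimately show ?thesis by simp
qed

text \<open>Unary conversion is polynomial only when capped.\<close>

lemma fold_min_double:
  "fold (\<lambda>b r. min m (2 * r + of_bool b)) bs (min m r) = min m (fold (\<lambda>b r. 2 * r + of_bool b) bs (r::nat))"
proof (induction bs arbitrary: r)
  case (Cons b bs)
  have "min m (2 * min m r + of_bool b) = min m (2 * r + of_bool b)" by auto
  with Cons show ?case by simp
qed simp

lemma pt_min_nat:
  assumes "ptime e enc_un m" "ptime e enc_nat f"
  shows "ptime e enc_un (\<lambda>z. min (m z) (f z))"
proof -
  obtain q where q: "\<forall>z\<in>UNIV. size (enc_un (m z)) \<le> poly q (size (e z))"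
    by (rule polytime_on_size[OF assms(1)])
  have "ptime e enc_un (\<lambda>z. fold (\<lambda>b r. min (m z) ((r + r) + (if b then Suc 0 else 0))) (rev (bits (f z))) 0)"
  proof (rule pt_fold[OF pt_rev[OF pt_bits[OF assms(2)]] pt_const, where q = q])
    have "ptime (enc_prod e (enc_prod enc_bool enc_un)) enc_un (\<lambda>z. m (fst z))"
      by (rule pt_comp[OF _ assms(1)]) (rule pt_intros)+
    then show "ptime (enc_prod e (enc_prod enc_bool enc_un)) enc_un
       (\<lambda>z. min (m (fst z)) ((snd (snd z) + snd (snd z)) + (if fst (snd z) then Suc 0 else 0)))"
      by - (assumption | rule pt_intros)+
    show "size (enc_un (min (m x) ((a + a) + (if y then Suc 0 else 0)))) \<le>
       size (enc_un a) + poly q (size (e x) + size (enc_bool y))" for x y a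
    proof -
      have "m x \<le> poly q (size (e x))" using q by simp
      also have "\<dots> \<le> poly q (size (e x) + size (enc_bool y))" by (rule poly_nat_mono) simp
      finally show ?thesis by simp
    qed
  qed
  moreover have "fold (\<lambda>b r. min k ((r + r) + (if b then Suc 0 else 0))) (rev (bits n)) 0 = min k n" for k n
  proof -
    have "(\<lambda>b r. min k ((r + r) + (if b then Suc 0 else 0))) = (\<lambda>b r. min k (2 * r + of_bool b))"
      by (intro ext) (simp add: mult_2)
    with fold_min_double[of k "rev (bits n)" 0] unbits_rev_bits[of n] show ?thesis
      by (simp add: unbits_def)
  qed
  ultimately show ?thesis by simp
qed

section \<open>Transversals\<close>

lemma hall:
  assumes "finite I" "\<And>i. i \<in> I \<Longrightarrow> finite (A i)" "\<And>K. K \<subseteq> I \<Longrightarrow> card K \<le> card (\<Union>i\<in>K. A i)"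
  shows "\<exists>r. inj_on r I \<and> (\<forall>i\<in>I. r i \<in> A i)"
  using assms
proof (induction "card I" arbitrary: I A rule: less_induct)
  case less
  note fin = less.prems(1,2) and hall = less.prems(3)
  show ?case
  proof (cases "\<exists>K. K \<subset> I \<and> K \<noteq> {} \<and> card (\<Union>i\<in>K. A i) = card K")
    case True
    then obtain K where K: "K \<subset> I" "K \<noteq> {}" "card (\<Union>i\<in>K. A i) = card K" by blast
    let ?U = "\<Union>i\<in>K. A i"
    have finK: "finite K" using K(1) fin(1) finite_subset by blast
    have finU: "finite ?U" using finK K(1) fin(2) by blast
    have "card K < card I" using K(1) fin(1) by (simp add: psubset_card_mono)
    then have "\<exists>r. inj_on r K \<and> (\<forall>i\<in>K. r i \<in> A i)"
      using K(1) fin hall finK by (intro less.hyps) auto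
    then obtain r1 where r1: "inj_on r1 K" "\<forall>i\<in>K. r1 i \<in> A i" by blast
    have "card (I - K) < card I" using K finK fin(1)
      by (metis Diff_subset card_seteq double_diff not_le psubsetE Diff_cancel order_refl)
    moreover have "card L \<le> card (\<Union>i\<in>L. A i - ?U)" if L: "L \<subseteq> I - K" for L
    proof -
      have finL: "finite L" using L fin(1) finite_subset by blast
      have "card L + card K = card (L \<union> K)"
        using L finL finK by (intro card_Un_disjoint[symmetric]) auto
      also have "\<dots> \<le> card (\<Union>i\<in>L \<union> K. A i)" using L K(1) by (intro hall) auto
      also have "(\<Union>i\<in>L \<union> K. A i) = (\<Union>i\<in>L. A i - ?U) \<union> ?U" by auto
      also have "card \<dots> \<le> card (\<Union>i\<in>L. A i - ?U) + card ?U" by (rule card_Un_le)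
      finally show ?thesis using K(3) by simp
    qed
    ultimately have "\<exists>r. inj_on r (I - K) \<and> (\<forall>i\<in>I - K. r i \<in> A i - ?U)"
      using fin by (intro less.hyps) auto
    then obtain r2 where r2: "inj_on r2 (I - K)" "\<forall>i\<in>I - K. r2 i \<in> A i - ?U" by blast
    let ?r = "\<lambda>i. if i \<in> K then r1 i else r2 i"
    have "inj_on ?r I"
    proof (rule inj_onI)
      fix i j assume ij: "i \<in> I" "j \<in> I" "?r i = ?r j"
      consider "i \<in> K" "j \<in> K" | "i \<notin> K" "j \<notin> K" | "i \<in> K" "j \<notin> K" | "i \<notin> K" "j \<in> K" by blast
      then show "i = j"
      proof cases
        case 1 then show ?thesis using ij r1(1) by (auto dest: inj_onD)
      next
        case 2 then show ?thesis using ij r2(1) by (auto dest: inj_onD)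
      next
        case 3
        then have "r2 j \<in> A i" using r1(2) ij(3) by auto
        then show ?thesis using r2(2) 3 ij(1,2) by blast
      next
        case 4
        then have "r2 i \<in> A j" using r1(2) ij(3) by auto
        then show ?thesis using r2(2) 4 ij(1,2) by blast
      qed
    qed
    then show ?thesis using r1(2) r2(2) by (intro exI[of _ ?r]) auto
  next
    case False
    show ?thesis
    proof (cases "I = {}")
      case False
      then obtain i where i: "i \<in> I" by blast
      have "card {i} \<le> card (\<Union>i\<in>{i}. A i)" using i by (intro hall) auto
      then have "A i \<noteq> {}" by auto
      then obtain y where y: "y \<in> A i" by blast
      have card_insert: "card (insert y S) \<le> Suc (card S)" for S
        by (cases "finite S") (auto simp: card_insert_if)
      have "card L \<le> card (\<Union>j\<in>L. A j - {y})" if L: "L \<subseteq> I - {i}" for L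
      proof (cases "L = {}")
        case False
        have "L \<subset> I" using L i by blast
        with False \<open>\<not> (\<exists>K. K \<subset> I \<and> K \<noteq> {} \<and> card (\<Union>i\<in>K. A i) = card K)\<close> hall[of L]
        have "card L < card (\<Union>j\<in>L. A j)" by (metis le_neq_implies_less psubset_imp_subset)
        also have "(\<Union>j\<in>L. A j) \<subseteq> insert y (\<Union>j\<in>L. A j - {y})" by auto
        then have "card (\<Union>j\<in>L. A j) \<le> card (insert y (\<Union>j\<in>L. A j - {y}))"
          using L fin finite_subset[OF L] by (intro card_mono) auto
        also have "\<dots> \<le> Suc (card (\<Union>j\<in>L. A j - {y}))"
          by (rule card_insert)
        finally show ?thesis by simp
      qed simp
      moreover have "card (I - {i}) < card I" using fin(1) i by (rule card_Diff1_less)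
      ultimately have "\<exists>r. inj_on r (I - {i}) \<and> (\<forall>j\<in>I - {i}. r j \<in> A j - {y})"
        using fin by (intro less.hyps) auto
      then obtain r where r: "inj_on r (I - {i})" "\<forall>j\<in>I - {i}. r j \<in> A j - {y}" by blast
      have "inj_on (r(i := y)) I"
      proof (rule inj_onI)
        fix j l assume jl: "j \<in> I" "l \<in> I" "(r(i := y)) j = (r(i := y)) l"
        show "j = l"
        proof (cases "j = i \<or> l = i")
          case True
          then show ?thesis using jl r(2) by (auto split: if_splits)
        next
          case False
          then show ?thesis using jl r(1) by (auto dest: inj_onD)
        qed
      qed
      then show ?thesis using r(2) y by (intro exI[of _ "r(i := y)"]) auto
    qed simp
  qed
qed

lemma card_fibers:
  assumes "finite U" "finite I" "f ` U \<subseteq> I" "\<And>i. i \<in> I \<Longrightarrow> card {u \<in> U. f u = i} = s"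
  shows "card U = card I * s"
proof -
  have "card U = (\<Sum>u\<in>U. 1)" by simp
  also have "\<dots> = (\<Sum>i\<in>I. \<Sum>u\<in>{u \<in> U. f u = i}. 1)"
    by (rule sum.group[symmetric]) (use assms in auto)
  also have "\<dots> = (\<Sum>i\<in>I. card {u \<in> U. f u = i})" by simp
  also have "\<dots> = card I * s" using assms(4) by simp
  finally show ?thesis .
qed

lemma common_transversal:
  assumes "finite U" "finite I" "finite J" "f ` U \<subseteq> I" "g ` U \<subseteq> J" "s > 0"
    and "\<And>i. i \<in> I \<Longrightarrow> card {u \<in> U. f u = i} = s" "\<And>j. j \<in> J \<Longrightarrow> card {u \<in> U. g u = j} = s"
  shows "\<exists>T\<subseteq>U. bij_betw f T I \<and> bij_betw g T J"
proof -
  let ?A = "\<lambda>i. g ` {u \<in> U. f u = i}"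
  have "card K \<le> card (\<Union>i\<in>K. ?A i)" if K: "K \<subseteq> I" for K
  proof -
    let ?U = "{u \<in> U. f u \<in> K}"
    have fin: "finite K" "finite ?U" using K assms(1,2) finite_subset by auto
    have eq: "{u \<in> ?U. f u = i} = {u \<in> U. f u = i}" if "i \<in> K" for i using that by auto
    have "card K * s = card ?U"
      by (rule card_fibers[symmetric, where f = f]) (use fin K assms(7) eq in auto)
    also have "\<dots> = (\<Sum>j\<in>g ` ?U. card {u \<in> ?U. g u = j})"
      using sum.group[of ?U "g ` ?U" g "\<lambda>_. 1 :: nat"] fin by simp
    also have "\<dots> \<le> (\<Sum>j\<in>g ` ?U. s)"
    proof (rule sum_mono)
      fix j assume "j \<in> g ` ?U"
      then have "j \<in> J" using assms(5) by auto
      have "card {u \<in> ?U. g u = j} \<le> card {u \<in> U. g u = j}"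
        by (rule card_mono) (use assms(1) in auto)
      then show "card {u \<in> ?U. g u = j} \<le> s" using assms(8)[OF \<open>j \<in> J\<close>] by simp
    qed
    also have "\<dots> = card (g ` ?U) * s" by simp
    also have "g ` ?U = (\<Union>i\<in>K. ?A i)" by auto
    finally show ?thesis using assms(6) by simp
  qed
  then obtain r where r: "inj_on r I" "\<forall>i\<in>I. r i \<in> ?A i"
    using hall[of I ?A] assms(1,2) by auto
  have "\<forall>i\<in>I. \<exists>u. u \<in> U \<and> f u = i \<and> g u = r i" using r(2) by force
  then obtain t where t: "\<forall>i\<in>I. t i \<in> U \<and> f (t i) = i \<and> g (t i) = r i" by metis
  have "card I * s = card J * s"
    by (rule trans[OF card_fibers[OF assms(1,2,4,7), symmetric] card_fibers[OF assms(1,3,5,8)]])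
  then have "card I = card J" using assms(6) by (metis mult_right_cancel not_gr_zero)
  have "r ` I \<subseteq> J" using r(2) assms(5) by auto
  with \<open>card I = card J\<close> r(1) assms(3) have "r ` I = J"
    by (simp add: card_image card_subset_eq)
  have "bij_betw f (t ` I) I" using t by (intro bij_betw_byWitness[where f' = t]) auto
  moreover have "bij_betw g (t ` I) J"
    unfolding bij_betw_def
  proof
    show "inj_on g (t ` I)" using t r(1) by (auto simp: inj_on_def)
    show "g ` t ` I = J" using t \<open>r ` I = J\<close> by (force simp: image_image)
  qed
  moreover have "t ` I \<subseteq> U" using t by auto
  ultimately show ?thesis by blast
qed

text \<open>
  Removing transversals one after the other partitions \<open>U\<close> into \<open>s\<close> of them, so one of them
  has at most the average weight.
\<close>

lemma light_transversal:
  fixes w :: "'u \<Rightarrow> real"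
  assumes "finite U" "finite I" "finite J" "f ` U \<subseteq> I" "g ` U \<subseteq> J" "s > 0"
    and "\<And>i. i \<in> I \<Longrightarrow> card {u \<in> U. f u = i} = s" "\<And>j. j \<in> J \<Longrightarrow> card {u \<in> U. g u = j} = s"
  shows "\<exists>T\<subseteq>U. bij_betw f T I \<and> bij_betw g T J \<and> real s * sum w T \<le> sum w U"
  using assms(6,1,4,5,7,8)
proof (induction s arbitrary: U rule: nat_induct_non_zero)
  case 1
  then obtain T where T: "T \<subseteq> U" "bij_betw f T I" "bij_betw g T J"
    using common_transversal[of U I J f g 1] assms(2,3) by auto
  have "card U = card I" using card_fibers[OF 1(1) assms(2) 1(2), of 1] 1(4) by simp
  then have "T = U" using T 1(1) bij_betw_same_card[OF T(2)] by (intro card_subset_eq) auto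
  then show ?case using T by auto
next
  case (Suc s)
  then obtain T where T: "T \<subseteq> U" "bij_betw f T I" "bij_betw g T J"
    using common_transversal[of U I J f g "Suc s"] assms(2,3) by auto
  have fiber: "card {u \<in> U - T. h u = i} = s"
    if h: "bij_betw h T K" and i: "i \<in> K" "card {u \<in> U. h u = i} = Suc s" for h :: "'u \<Rightarrow> 'z" and K i
  proof -
    obtain t where t: "t \<in> T" "h t = i" using h i(1) unfolding bij_betw_def by force
    have "{u \<in> U - T. h u = i} = {u \<in> U. h u = i} - {t}"
      using t h unfolding bij_betw_def inj_on_def by auto
    then show ?thesis using t T(1) i(2) Suc.prems(1) by auto
  qed
  have "\<exists>T'\<subseteq>U - T. bij_betw f T' I \<and> bij_betw g T' J \<and> real s * sum w T' \<le> sum w (U - T)"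
  proof (rule Suc.IH)
    show "card {u \<in> U - T. f u = i} = s" if "i \<in> I" for i by (rule fiber[OF T(2) that Suc.prems(4)[OF that]])
    show "card {u \<in> U - T. g u = j} = s" if "j \<in> J" for j by (rule fiber[OF T(3) that Suc.prems(5)[OF that]])
  qed (use Suc.prems in auto)
  then obtain T' where T': "T' \<subseteq> U - T" "bij_betw f T' I" "bij_betw g T' J" "real s * sum w T' \<le> sum w (U - T)"
    by blast
  have split: "sum w U = sum w T + sum w (U - T)"
    using T(1) Suc.prems(1) by (simp add: sum_diff finite_subset)
  show ?case
  proof (cases "sum w T \<le> sum w T'")
    case True
    have "real (Suc s) * sum w T = sum w T + real s * sum w T" by (simp add: algebra_simps)
    also have "\<dots> \<le> sum w T + real s * sum w T'" using True by (simp add: mult_left_mono)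
    also have "\<dots> \<le> sum w U" using T'(4) split by simp
    finally show ?thesis using T by blast
  next
    case False
    have "real (Suc s) * sum w T' = sum w T' + real s * sum w T'" by (simp add: algebra_simps)
    also have "\<dots> \<le> sum w U" using T'(4) split False by simp
    finally show ?thesis using T' by (intro exI[of _ T']) auto
  qed
qed

lemma chunk_fun:
  assumes "finite A" "s > 0"
  shows "\<exists>f :: 'a \<Rightarrow> nat. (\<forall>i < card A div s. card {u \<in> A. f u = i} = s) \<and>
    (\<forall>u\<in>A. s dvd card A \<longrightarrow> f u < card A div s)"
proof -
  obtain e where e: "bij_betw e A {0..<card A}" using ex_bij_betw_finite_nat[OF assms(1)] by blast
  have "card {u \<in> A. e u div s = i} = s" if "i < card A div s" for i
  proof -
    have "Suc i * s \<le> card A" using that assms(2)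
      by (metis Suc_leI div_times_less_eq_dividend le_trans mult_le_mono1)
    then have le: "i * s + s \<le> card A" by simp
    have "x div s = i \<longleftrightarrow> x \<in> {i * s..<i * s + s}" for x
      using assms(2) dividend_less_div_times[of s x] by (auto simp: mult.commute intro: div_nat_eqI)
    then have "{u \<in> A. e u div s = i} = {u \<in> A. e u \<in> {i * s..<i * s + s}}" by simp
    moreover have "bij_betw e {u \<in> A. e u \<in> {i * s..<i * s + s}} {i * s..<i * s + s}"
    proof (rule bij_betw_imageI)
      show "inj_on e {u \<in> A. e u \<in> {i * s..<i * s + s}}"
        using e by (auto simp: bij_betw_def intro: inj_on_subset)
      have "{i * s..<i * s + s} \<subseteq> e ` A" using e le by (auto simp: bij_betw_def)
      then show "e ` {u \<in> A. e u \<in> {i * s..<i * s + s}} = {i * s..<i * s + s}" by blast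
    qed
    ultimately show ?thesis by (simp add: bij_betw_same_card)
  qed
  moreover have "e u div s < card A div s" if "u \<in> A" "s dvd card A" for u
  proof -
    have "e u < card A" using e that(1) unfolding bij_betw_def by auto
    then show ?thesis using that(2) assms(2) by (auto simp: less_mult_imp_div_less mult.commute)
  qed
  ultimately show ?thesis by (intro exI[of _ "\<lambda>u. e u div s"]) blast
qed

section \<open>Costs of clusters\<close>

definition others :: "'a \<Rightarrow> 'a multiset \<Rightarrow> 'a multiset" where
  "others x T = filter_mset (\<lambda>y. y \<noteq> x) T"

lemma count_others: "T = replicate_mset (count T x) x + others x T"
  unfolding others_def by (metis (mono_tags, lifting) filter_eq_replicate_mset filter_mset_cong multiset_partition)

lemma size_others: "size (others x T) = size T - count T x"
proof -
  have "size T = count T x + size (others x T)"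
    by (subst count_others[of T x]) (simp only: size_union size_replicate_mset)
  then show ?thesis by simp
qed

lemma count_le_size': "count T x \<le> size T"
proof -
  have "size T = count T x + size (others x T)"
    by (subst count_others[of T x]) (simp only: size_union size_replicate_mset)
  then show ?thesis by simp
qed

lemma others_subset: "set_mset T \<subseteq> A \<Longrightarrow> set_mset (others x T) \<subseteq> A"
  by (auto simp: others_def)

lemma others_mem: "z \<in># others x T \<longleftrightarrow> z \<in># T \<and> z \<noteq> x"
  by (auto simp: others_def)

text \<open>The \<open>quad\<close> axiom combines the triangle inequalities along \<open>c'\<close>, \<open>x\<close>, \<open>c\<close>, \<open>z\<close>.\<close>

locale center_metric =
  fixes CC :: "'c set" and PP :: "'p set" and \<delta> :: "'c \<Rightarrow> 'p \<Rightarrow> real" and emb :: "'p \<Rightarrow> 'c"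
  assumes nonneg: "c \<in> CC \<Longrightarrow> x \<in> PP \<Longrightarrow> 0 \<le> \<delta> c x"
    and quad: "c \<in> CC \<Longrightarrow> c' \<in> CC \<Longrightarrow> x \<in> PP \<Longrightarrow> z \<in> PP \<Longrightarrow> \<delta> c' z \<le> \<delta> c z + \<delta> c x + \<delta> c' x"
    and emb: "x \<in> PP \<Longrightarrow> emb x \<in> CC" "x \<in> PP \<Longrightarrow> \<delta> (emb x) x = 0"
    and sep: "c \<in> CC \<Longrightarrow> x \<in> PP \<Longrightarrow> y \<in> PP \<Longrightarrow> x \<noteq> y \<Longrightarrow> 1 \<le> \<delta> c x + \<delta> c y"
    and CC_ne: "CC \<noteq> {}"
begin

definition wsum :: "'c \<Rightarrow> 'p multiset \<Rightarrow> real" where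
  "wsum c T = (\<Sum>x\<in>#T. \<delta> c x)"

definition mcost :: "'p multiset \<Rightarrow> real" where
  "mcost T = (INF c\<in>CC. wsum c T)"

lemma emb_le: "c \<in> CC \<Longrightarrow> x \<in> PP \<Longrightarrow> z \<in> PP \<Longrightarrow> \<delta> (emb x) z \<le> \<delta> c z + \<delta> c x"
  using quad[of c "emb x" x z] emb[of x] by simp

lemma wsum_nonneg: "c \<in> CC \<Longrightarrow> set_mset T \<subseteq> PP \<Longrightarrow> 0 \<le> wsum c T"
  unfolding wsum_def by (induction T) (auto intro: add_nonneg_nonneg nonneg)

lemma wsum_union [simp]: "wsum c (S + T) = wsum c S + wsum c T"
  by (simp add: wsum_def)

lemma wsum_mono: "c \<in> CC \<Longrightarrow> S \<subseteq># T \<Longrightarrow> set_mset T \<subseteq> PP \<Longrightarrow> wsum c S \<le> wsum c T"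
  using wsum_nonneg[of c "T - S"] by (metis in_diffD le_add_same_cancel1 subset_iff subset_mset.add_diff_inverse wsum_union)

lemma mcost_le: "c \<in> CC \<Longrightarrow> set_mset T \<subseteq> PP \<Longrightarrow> mcost T \<le> wsum c T"
  unfolding mcost_def by (rule cINF_lower) (auto intro!: bdd_belowI[of _ 0] wsum_nonneg)

lemma mcost_ge: "(\<And>c. c \<in> CC \<Longrightarrow> v \<le> wsum c T) \<Longrightarrow> v \<le> mcost T"
  unfolding mcost_def using CC_ne by (rule cINF_greatest)

lemma mcost_nonneg: "set_mset T \<subseteq> PP \<Longrightarrow> 0 \<le> mcost T"
  by (rule mcost_ge) (rule wsum_nonneg)

lemma mcost_approx:
  assumes "set_mset T \<subseteq> PP" "\<epsilon> > 0"
  obtains c where "c \<in> CC" "wsum c T < mcost T + \<epsilon>"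
proof -
  have "\<not> mcost T + \<epsilon> \<le> mcost T" using assms(2) by simp
  then have "\<exists>c\<in>CC. \<not> mcost T + \<epsilon> \<le> wsum c T" using mcost_ge by blast
  then show thesis using that by auto
qed

lemma wsum_ge_size:
  assumes "\<And>x. x \<in># T \<Longrightarrow> k \<le> \<delta> c x"
  shows "real (size T) * k \<le> wsum c T"
  using assms unfolding wsum_def
proof (induction T)
  case (add x T)
  have "real (size T) * k \<le> (\<Sum>x\<in>#T. \<delta> c x)" "k \<le> \<delta> c x" using add by auto
  then show ?case by (simp add: algebra_simps)
qed simp

lemma wsum_split: "wsum c T = real (count T x) * \<delta> c x + wsum c (others x T)"
proof -
  have "wsum c (replicate_mset n x) = real n * \<delta> c x" for n
    unfolding wsum_def by (induction n) (auto simp: algebra_simps)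
  then show ?thesis by (subst count_others[of T x]) simp
qed

lemma wsum_others_ge:
  assumes "c \<in> CC" "set_mset T \<subseteq> PP" "x \<in> PP"
  shows "real (size T - count T x) * (1 - \<delta> c x) \<le> wsum c (others x T)"
proof -
  have "real (size (others x T)) * (1 - \<delta> c x) \<le> wsum c (others x T)"
  proof (rule wsum_ge_size)
    fix z assume "z \<in># others x T"
    then show "1 - \<delta> c x \<le> \<delta> c z" using sep[of c x z] assms by (auto simp: others_mem)
  qed
  then show ?thesis by (simp add: size_others)
qed

lemma pair_bound:
  assumes "set_mset T \<subseteq> PP" "x \<in> PP"
  shows "real (min (count T x) (size T - count T x)) \<le> mcost T"
proof (rule mcost_ge)
  fix c assume c: "c \<in> CC"
  let ?a = "real (count T x)" and ?r = "real (size T - count T x)" and ?m = "real (min (count T x) (size T - count T x))"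
  have v: "0 \<le> \<delta> c x" using nonneg c assms(2) by simp
  show "?m \<le> wsum c T"
  proof (cases "\<delta> c x \<ge> 1")
    case True
    have "?m \<le> ?a * 1" by simp
    also have "\<dots> \<le> ?a * \<delta> c x" using True by (intro mult_left_mono) auto
    also have "\<dots> \<le> wsum c T" unfolding wsum_split[of c T x]
      using wsum_nonneg[OF c others_subset[OF assms(1)]] by simp
    finally show ?thesis .
  next
    case False
    have "?m = ?m * \<delta> c x + ?m * (1 - \<delta> c x)" by (simp add: algebra_simps)
    also have "\<dots> \<le> ?a * \<delta> c x + ?r * (1 - \<delta> c x)"
      using False v by (intro add_mono mult_right_mono) auto
    also have "\<dots> \<le> wsum c T" unfolding wsum_split[of c T x] using wsum_others_ge[OF c assms] by simp
    finally show ?thesis .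
  qed
qed

lemma majority_center:
  assumes "set_mset T \<subseteq> PP" "x \<in> PP" "c \<in> CC" "size T \<le> 2 * count T x"
  shows "wsum (emb x) T \<le> wsum c T"
proof -
  let ?R = "others x T"
  have "wsum (emb x) T = wsum (emb x) ?R" using wsum_split[of "emb x" T x] emb(2)[OF assms(2)] by simp
  also have "\<dots> \<le> wsum c ?R + real (size ?R) * \<delta> c x"
  proof -
    have "wsum (emb x) S \<le> wsum c S + real (size S) * \<delta> c x" if "set_mset S \<subseteq> PP" for S
      using that unfolding wsum_def
    proof (induction S)
      case (add z S)
      then have "\<delta> (emb x) z \<le> \<delta> c z + \<delta> c x" using emb_le[OF assms(3,2)] by simp
      then show ?case using add by (simp add: algebra_simps)
    qed simp
    from this[OF others_subset[OF assms(1)]] show ?thesis .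
  qed
  also have "real (size ?R) * \<delta> c x \<le> real (count T x) * \<delta> c x"
    using assms(4) nonneg[OF assms(3,2)] by (intro mult_right_mono) (auto simp: size_others)
  also have "wsum c ?R + real (count T x) * \<delta> c x = wsum c T" by (simp add: wsum_split[of c T x])
  finally show ?thesis by simp
qed

lemma majority_mcost:
  assumes "set_mset T \<subseteq> PP" "x \<in> PP" "size T \<le> 2 * count T x"
  shows "mcost T = wsum (emb x) T"
  using majority_center[OF assms(1,2) _ assms(3)] mcost_le[OF emb(1)[OF assms(2)] assms(1)]
  by (intro antisym mcost_ge)

lemma no_majority:
  assumes "set_mset T \<subseteq> PP" "\<And>x. 2 * count T x \<le> size T"
  shows "real (size T) / 2 \<le> mcost T"
proof (rule mcost_ge)
  fix c assume c: "c \<in> CC"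
  show "real (size T) / 2 \<le> wsum c T"
  proof (cases "\<forall>x\<in>#T. 1 / 2 \<le> \<delta> c x")
    case True
    then show ?thesis using wsum_ge_size[of T "1/2" c] by simp
  next
    case False
    then obtain x where x: "x \<in># T" "\<delta> c x < 1 / 2" by force
    then have "x \<in> PP" using assms(1) by auto
    have "real (size T - count T x) = real (size T) - real (count T x)"
      using count_le_size'[of T x] by (simp add: of_nat_diff)
    then have "real (count T x) * \<delta> c x + (real (size T) - real (count T x)) * (1 - \<delta> c x) \<le> wsum c T"
      unfolding wsum_split[of c T x] using wsum_others_ge[OF c assms(1) \<open>x \<in> PP\<close>] by simp
    moreover have "0 \<le> (real (size T) - 2 * real (count T x)) * (1 / 2 - \<delta> c x)"
      using assms(2)[of x] x(2) by (intro mult_nonneg_nonneg) auto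
    ultimately show ?thesis by (simp add: algebra_simps)
  qed
qed

lemma distinct_bound:
  assumes "set_mset T \<subseteq> PP" "card (set_mset T) \<ge> 2"
  shows "real (card (set_mset T)) / 2 \<le> mcost T"
proof -
  let ?S = "mset_set (set_mset T)"
  have "?S \<subseteq># T"
    by (simp add: mset_subset_eqI count_mset_set' Suc_leI)
  have "real (size ?S) / 2 \<le> mcost ?S"
    using assms by (intro no_majority) (auto simp: count_mset_set')
  also have "\<dots> \<le> mcost T"
  proof (rule mcost_ge)
    fix c assume c: "c \<in> CC"
    have "mcost ?S \<le> wsum c ?S" using c assms(1) by (intro mcost_le) auto
    also have "\<dots> \<le> wsum c T" using c \<open>?S \<subseteq># T\<close> assms(1) by (rule wsum_mono)
    finally show "mcost ?S \<le> wsum c T" .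
  qed
  finally show ?thesis by simp
qed

lemma pair_dist:
  assumes "set_mset T \<subseteq> PP" "x \<in># T" "y \<in># T" "x \<noteq> y"
  shows "\<delta> (emb x) y \<le> mcost T"
proof (rule mcost_ge)
  fix c assume c: "c \<in> CC"
  have xy: "x \<in> PP" "y \<in> PP" using assms by auto
  have "{#x, y#} \<subseteq># T" using assms(2-4) by (simp add: insert_subset_eq_iff in_diff_count)
  then have "wsum c {#x, y#} \<le> wsum c T" using c assms(1) by (intro wsum_mono)
  then show "\<delta> (emb x) y \<le> wsum c T" using emb_le[OF c xy] by (simp add: wsum_def)
qed

lemma mcost_replicate: "x \<in> PP \<Longrightarrow> mcost (replicate_mset n x) = 0"
proof (rule antisym)
  assume x: "x \<in> PP"
  have "wsum (emb x) (replicate_mset n x) = 0" unfolding wsum_def by (simp add: emb(2)[OF x] image_replicate_mset)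
  then show "mcost (replicate_mset n x) \<le> 0"
    using mcost_le[OF emb(1)[OF x], of "replicate_mset n x"] x by (simp add: subset_eq)
  show "0 \<le> mcost (replicate_mset n x)" using x by (intro mcost_nonneg) (auto simp: subset_eq)
qed

end

definition clus :: "nat \<Rightarrow> 'a multiset \<Rightarrow> 'a list list \<Rightarrow> bool" where
  "clus s M C \<longleftrightarrow> mset (concat C) = M \<and> (\<forall>T\<in>set C. length T = s)"

lemma mset_concat_nth: "mset (concat C) = (\<Sum>j<length C. mset (C ! j))"
  by (simp add: sum_list_mset_eq[symmetric] sum_list_sum_nth atLeast0LessThan)

lemma count_concat_nth: "count (mset (concat C)) x = (\<Sum>j<length C. count (mset (C ! j)) x)"
  by (simp add: mset_concat_nth count_sum)

lemma clus_size: "clus s M C \<Longrightarrow> size M = length C * s"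
proof -
  assume C: "clus s M C"
  then have "size M = length (concat C)" by (auto simp: clus_def)
  also have "\<dots> = (\<Sum>j<length C. length (C ! j))"
    by (simp add: length_concat sum_list_sum_nth atLeast0LessThan)
  also have "\<dots> = length C * s" using C by (simp add: clus_def)
  finally show ?thesis .
qed

lemma clus_sub: "clus s M C \<Longrightarrow> T \<in> set C \<Longrightarrow> set T \<subseteq> set_mset M"
  by (auto simp: clus_def)

lemma finite_clus: "s > 0 \<Longrightarrow> finite {C. clus s M C}"
proof (rule finite_subset)
  assume "s > 0"
  let ?A = "{T. set T \<subseteq> set_mset M \<and> length T \<le> s}"
  show "{C. clus s M C} \<subseteq> {C. set C \<subseteq> ?A \<and> length C \<le> size M}"
  proof clarify
    fix C assume C: "clus s M C"
    then show "set C \<subseteq> ?A \<and> length C \<le> size M"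
      using clus_size[OF C] \<open>s > 0\<close> clus_sub[OF C] by (auto simp: clus_def)
  qed
  show "finite {C. set C \<subseteq> ?A \<and> length C \<le> size M}"
    by (intro finite_lists_length_le) auto
qed

lemma image_mset_set_sum: "finite U \<Longrightarrow> image_mset f (mset_set U) = (\<Sum>u\<in>U. {#f u#})"
  by (induction U rule: finite_induct) auto

lemma card_Collect_Un:
  "finite A \<Longrightarrow> finite B \<Longrightarrow> A \<inter> B = {} \<Longrightarrow>
    card ({x \<in> A. P x} \<union> {x \<in> B. Q x}) = card {x \<in> A. P x} + card {x \<in> B. Q x}"
  by (subst card_Un_disjoint) auto

context center_metric
begin

lemma dissolve_step:
  assumes "finite U" "cl ` U \<subseteq> J" "\<And>j. j \<in> J \<Longrightarrow> card {u \<in> U. cl u = j} = s"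
    and pt: "pt ` U \<subseteq> PP" and c: "c ` J \<subseteq> CC"
    and S: "S \<subseteq> U" "card S = s" "\<And>u. u \<in> S \<Longrightarrow> pt u = x" "x \<in> PP"
    and j0: "j0 \<in> J" "r \<le> card {u \<in> S. cl u = j0}"
  shows "\<exists>cl'. cl' ` (U - S) \<subseteq> J - {j0} \<and> (\<forall>j\<in>J - {j0}. card {u \<in> U - S. cl' u = j} = s) \<and>
    (\<forall>u\<in>U - S. cl u \<noteq> j0 \<longrightarrow> cl' u = cl u) \<and>
    (\<Sum>u\<in>U - S. \<delta> (c (cl' u)) (pt u)) \<le> (\<Sum>u\<in>U. \<delta> (c (cl u)) (pt u)) + (real s - 2 * real r) * \<delta> (c j0) x"
proof -
  let ?F = "{u \<in> U. cl u = j0}"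
  define A B D E where "A = ?F - S" and "B = S - ?F" and "D = S \<inter> ?F" and "E = U - S - ?F"
  have fin: "finite S" "finite A" "finite B" "finite D" "finite E"
    using assms(1) S(1) by (auto simp: A_def B_def D_def E_def intro: finite_subset)
  have D_eq: "D = {u \<in> S. cl u = j0}" using S(1) by (auto simp: D_def)
  have "card ?F = card A + card D"
    using fin by (subst card_Un_disjoint[symmetric]) (auto simp: A_def D_def intro: arg_cong[where f = card])
  moreover have "card S = card B + card D"
    using fin by (subst card_Un_disjoint[symmetric]) (auto simp: B_def D_def intro: arg_cong[where f = card])
  ultimately have AB: "card A = card B" "card A + card D = s" using assms(3)[OF j0(1)] S(2) by auto
  obtain \<sigma> where \<sigma>: "bij_betw \<sigma> A B" using finite_same_card_bij[OF fin(2,3) AB(1)] by blast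
  have \<sigma>B: "\<sigma> u \<in> B" if "u \<in> A" for u using that \<sigma> by (auto simp: bij_betw_def)
  define cl' where "cl' u = (if u \<in> A then cl (\<sigma> u) else cl u)" for u
  have US: "U - S = A \<union> E" "A \<inter> E = {}" by (auto simp: A_def E_def)
  have U: "U = A \<union> E \<union> (B \<union> D)" "(A \<union> E) \<inter> (B \<union> D) = {}" "B \<inter> D = {}"
    using S(1) by (auto simp: A_def B_def D_def E_def)
  have cl'A: "cl' u = cl (\<sigma> u)" if "u \<in> A" for u using that by (simp add: cl'_def)
  have cl'E: "cl' u = cl u" if "u \<in> E" for u using that US(2) by (auto simp: cl'_def)
  have clB: "cl u \<in> J" "cl u \<noteq> j0" if "u \<in> B" for u using that S(1) assms(2) by (auto simp: B_def)
  have img: "cl' ` (U - S) \<subseteq> J - {j0}"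
  proof
    fix j assume "j \<in> cl' ` (U - S)"
    then obtain u where u: "j = cl' u" "u \<in> A \<or> u \<in> E" unfolding US(1) by blast
    show "j \<in> J - {j0}"
    proof (cases "u \<in> A")
      case True
      then show ?thesis using u(1) cl'A clB \<sigma>B by simp
    next
      case False
      then have "u \<in> E" using u by simp
      then show ?thesis using u(1) cl'E assms(2) by (auto simp: E_def)
    qed
  qed
  have fib: "card {u \<in> U - S. cl' u = j} = s" if j: "j \<in> J - {j0}" for j
  proof -
    have "{u \<in> U - S. cl' u = j} = {u \<in> A. cl (\<sigma> u) = j} \<union> {u \<in> E. cl u = j}"
      unfolding US(1) by (auto simp: cl'A cl'E)
    then have "card {u \<in> U - S. cl' u = j} = card {u \<in> A. cl (\<sigma> u) = j} + card {u \<in> E. cl u = j}"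
      using card_Collect_Un[OF fin(2,5) US(2), of "\<lambda>u. cl (\<sigma> u) = j" "\<lambda>u. cl u = j"] by simp
    also have "bij_betw \<sigma> {u \<in> A. cl (\<sigma> u) = j} {v \<in> B. cl v = j}"
    proof (rule bij_betw_imageI)
      show "inj_on \<sigma> {u \<in> A. cl (\<sigma> u) = j}" using \<sigma> by (auto simp: bij_betw_def intro: inj_on_subset)
      have "B = \<sigma> ` A" using \<sigma> by (simp add: bij_betw_def)
      then show "\<sigma> ` {u \<in> A. cl (\<sigma> u) = j} = {v \<in> B. cl v = j}" by auto
    qed
    then have "card {u \<in> A. cl (\<sigma> u) = j} = card {v \<in> B. cl v = j}" by (rule bij_betw_same_card)
    also have "card {v \<in> B. cl v = j} + card {u \<in> E. cl u = j} = card {u \<in> U. cl u = j}"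
    proof -
      have "{u \<in> U. cl u = j} = {v \<in> B. cl v = j} \<union> {u \<in> E. cl u = j}"
        using j S(1) by (auto simp: B_def E_def)
      moreover have "B \<inter> E = {}" using U(2) by blast
      ultimately show ?thesis
        using card_Collect_Un[OF fin(3,5), of "\<lambda>v. cl v = j" "\<lambda>u. cl u = j"] by simp
    qed
    finally show ?thesis using assms(3) j by simp
  qed
  have J: "c j \<in> CC" if "j \<in> J" for j using that c by auto
  let ?d = "\<delta> (c j0) x"
  have "(\<Sum>u\<in>U - S. \<delta> (c (cl' u)) (pt u)) = (\<Sum>u\<in>A. \<delta> (c (cl (\<sigma> u))) (pt u)) + (\<Sum>u\<in>E. \<delta> (c (cl u)) (pt u))"
    unfolding US(1) sum.union_disjoint[OF fin(2,5) US(2)] by (simp add: cl'A cl'E)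
  also have "(\<Sum>u\<in>A. \<delta> (c (cl (\<sigma> u))) (pt u)) \<le> (\<Sum>u\<in>A. \<delta> (c (cl u)) (pt u) + ?d + \<delta> (c (cl (\<sigma> u))) (pt (\<sigma> u)))"
  proof (rule sum_mono)
    fix u assume u: "u \<in> A"
    have "pt (\<sigma> u) = x" using S(3) \<sigma>B[OF u] by (auto simp: B_def)
    moreover have "cl u = j0" "pt u \<in> PP" using u pt by (auto simp: A_def)
    ultimately show "\<delta> (c (cl (\<sigma> u))) (pt u) \<le> \<delta> (c (cl u)) (pt u) + ?d + \<delta> (c (cl (\<sigma> u))) (pt (\<sigma> u))"
      using quad[of "c j0" "c (cl (\<sigma> u))" x "pt u"] J j0(1) clB(1)[OF \<sigma>B[OF u]] S(4) by simp
  qed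
  also have "\<dots> = (\<Sum>u\<in>A. \<delta> (c (cl u)) (pt u)) + real (card A) * ?d + (\<Sum>v\<in>B. \<delta> (c (cl v)) (pt v))"
    using sum.reindex_bij_betw[OF \<sigma>, of "\<lambda>v. \<delta> (c (cl v)) (pt v)"] by (simp add: sum.distrib)
  finally have 1: "(\<Sum>u\<in>U - S. \<delta> (c (cl' u)) (pt u)) \<le> (\<Sum>u\<in>A. \<delta> (c (cl u)) (pt u)) + real (card A) * ?d
      + (\<Sum>v\<in>B. \<delta> (c (cl v)) (pt v)) + (\<Sum>u\<in>E. \<delta> (c (cl u)) (pt u))" by simp
  have "(\<Sum>u\<in>D. \<delta> (c (cl u)) (pt u)) = (\<Sum>u\<in>D. ?d)"
    by (rule sum.cong) (auto simp: D_def S(3))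
  then have 2: "(\<Sum>u\<in>U. \<delta> (c (cl u)) (pt u)) = (\<Sum>u\<in>A. \<delta> (c (cl u)) (pt u)) + (\<Sum>u\<in>E. \<delta> (c (cl u)) (pt u))
      + (\<Sum>v\<in>B. \<delta> (c (cl v)) (pt v)) + real (card D) * ?d"
    unfolding arg_cong[OF U(1), of "sum (\<lambda>u. \<delta> (c (cl u)) (pt u))"] using fin
    by (simp only: sum.union_disjoint[OF _ _ U(2)] sum.union_disjoint[OF _ _ US(2)]
        sum.union_disjoint[OF _ _ U(3)] finite_UnI simp_thms sum_constant add.assoc)
  have "?d \<ge> 0" using nonneg J j0(1) S(4) by simp
  then have "(real (card A) - real (card D)) * ?d \<le> (real s - 2 * real r) * ?d"
    using j0(2) AB(2) D_eq by (intro mult_right_mono) auto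
  with 1 2 have "(\<Sum>u\<in>U - S. \<delta> (c (cl' u)) (pt u)) \<le>
      (\<Sum>u\<in>U. \<delta> (c (cl u)) (pt u)) + (real s - 2 * real r) * ?d"
    by (simp add: algebra_simps)
  with img fib show ?thesis
    by (intro exI[of _ cl']) (auto simp: cl'_def A_def)
qed

lemma dissolve:
  assumes "finite H" "finite U" "cl ` U \<subseteq> J" "\<And>j. j \<in> J \<Longrightarrow> card {u \<in> U. cl u = j} = s"
    and "pt ` U \<subseteq> PP" "c ` J \<subseteq> CC"
    and "\<And>h. h \<in> H \<Longrightarrow> S h \<subseteq> U \<and> card (S h) = s \<and> (\<forall>u\<in>S h. pt u = x h) \<and> x h \<in> PP"
    and "\<And>h h'. h \<in> H \<Longrightarrow> h' \<in> H \<Longrightarrow> h \<noteq> h' \<Longrightarrow> S h \<inter> S h' = {}"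
    and "inj_on jm H" "jm ` H \<subseteq> J" "\<And>h. h \<in> H \<Longrightarrow> r \<le> card {u \<in> S h. cl u = jm h}"
  shows "\<exists>cl'. cl' ` (U - \<Union>(S ` H)) \<subseteq> J - jm ` H \<and>
    (\<forall>j\<in>J - jm ` H. card {u \<in> U - \<Union>(S ` H). cl' u = j} = s) \<and>
    (\<Sum>u\<in>U - \<Union>(S ` H). \<delta> (c (cl' u)) (pt u)) \<le>
      (\<Sum>u\<in>U. \<delta> (c (cl u)) (pt u)) + (\<Sum>h\<in>H. (real s - 2 * real r) * \<delta> (c (jm h)) (x h))"
  using assms
proof (induction H arbitrary: U cl J rule: finite_induct)
  case empty
  then show ?case by (intro exI[of _ cl]) auto
next
  case (insert h H)
  have finS: "finite (S h')" if "h' \<in> insert h H" for h'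
    using finite_subset[of "S h'" U] insert.prems(1) insert.prems(6)[OF that] by simp
  have Sh: "S h \<subseteq> U" "card (S h) = s" "\<And>u. u \<in> S h \<Longrightarrow> pt u = x h" "x h \<in> PP"
    "jm h \<in> J" "r \<le> card {u \<in> S h. cl u = jm h}"
    using insert.prems(6)[of h] insert.prems(9) insert.prems(10)[of h] by auto
  obtain cl1 where cl1: "cl1 ` (U - S h) \<subseteq> J - {jm h}"
    "\<forall>j\<in>J - {jm h}. card {u \<in> U - S h. cl1 u = j} = s"
    "\<forall>u\<in>U - S h. cl u \<noteq> jm h \<longrightarrow> cl1 u = cl u"
    "(\<Sum>u\<in>U - S h. \<delta> (c (cl1 u)) (pt u)) \<le>
      (\<Sum>u\<in>U. \<delta> (c (cl u)) (pt u)) + (real s - 2 * real r) * \<delta> (c (jm h)) (x h)"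
    using dissolve_step[where U = U and cl = cl and J = J, OF insert.prems(1-5) Sh] by blast
  have "\<exists>cl'. cl' ` (U - S h - \<Union>(S ` H)) \<subseteq> J - {jm h} - jm ` H \<and>
    (\<forall>j\<in>J - {jm h} - jm ` H. card {u \<in> U - S h - \<Union>(S ` H). cl' u = j} = s) \<and>
    (\<Sum>u\<in>U - S h - \<Union>(S ` H). \<delta> (c (cl' u)) (pt u)) \<le>
      (\<Sum>u\<in>U - S h. \<delta> (c (cl1 u)) (pt u)) + (\<Sum>h\<in>H. (real s - 2 * real r) * \<delta> (c (jm h)) (x h))"
  proof (rule insert.IH)
    show "finite (U - S h)" using insert.prems(1) by simp
    show "cl1 ` (U - S h) \<subseteq> J - {jm h}" by (rule cl1(1))
    show "card {u \<in> U - S h. cl1 u = j} = s" if "j \<in> J - {jm h}" for j using cl1(2) that by blast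
    show "pt ` (U - S h) \<subseteq> PP" using insert.prems(4) by auto
    show "c ` (J - {jm h}) \<subseteq> CC" using insert.prems(5) by auto
    show "S h' \<subseteq> U - S h \<and> card (S h') = s \<and> (\<forall>u\<in>S h'. pt u = x h') \<and> x h' \<in> PP" if "h' \<in> H" for h'
    proof -
      have "S h' \<inter> S h = {}" using insert.prems(7)[of h' h] insert.hyps(2) that by auto
      then show ?thesis using insert.prems(6)[of h'] that by auto
    qed
    show "S h1 \<inter> S h2 = {}" if "h1 \<in> H" "h2 \<in> H" "h1 \<noteq> h2" for h1 h2
      using insert.prems(7) that by auto
    show "inj_on jm H" using insert.prems(8) by (rule inj_on_subset) auto
    show "jm ` H \<subseteq> J - {jm h}"
      using insert.prems(8,9) insert.hyps(2) by (auto simp: inj_on_def)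
    show "r \<le> card {u \<in> S h'. cl1 u = jm h'}" if h': "h' \<in> H" for h'
    proof -
      have "S h' \<inter> S h = {}" using insert.prems(7)[of h' h] insert.hyps(2) h' by auto
      moreover have "S h' \<subseteq> U" using insert.prems(6)[of h'] h' by auto
      moreover have "jm h' \<noteq> jm h" using insert.prems(8) insert.hyps(2) h' by (auto simp: inj_on_def)
      ultimately have "cl1 u = jm h'" if "u \<in> S h'" "cl u = jm h'" for u
        using cl1(3)[rule_format, of u] that by auto
      then have "{u \<in> S h'. cl u = jm h'} \<subseteq> {u \<in> S h'. cl1 u = jm h'}" by blast
      then have "card {u \<in> S h'. cl u = jm h'} \<le> card {u \<in> S h'. cl1 u = jm h'}"
        using finS[of h'] h' by (intro card_mono) auto
      then show ?thesis using insert.prems(10)[of h'] h' by simp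
    qed
  qed
  moreover have "U - S h - \<Union>(S ` H) = U - \<Union>(S ` insert h H)" "J - {jm h} - jm ` H = J - jm ` insert h H" by auto
  ultimately obtain cl' where cl': "cl' ` (U - \<Union>(S ` insert h H)) \<subseteq> J - jm ` insert h H"
    "\<forall>j\<in>J - jm ` insert h H. card {u \<in> U - \<Union>(S ` insert h H). cl' u = j} = s"
    "(\<Sum>u\<in>U - \<Union>(S ` insert h H). \<delta> (c (cl' u)) (pt u)) \<le>
      (\<Sum>u\<in>U - S h. \<delta> (c (cl1 u)) (pt u)) + (\<Sum>h\<in>H. (real s - 2 * real r) * \<delta> (c (jm h)) (x h))"
    by (elim exE conjE) (simp only:)
  note cl'(3)
  also have "(\<Sum>u\<in>U - S h. \<delta> (c (cl1 u)) (pt u)) + (\<Sum>h\<in>H. (real s - 2 * real r) * \<delta> (c (jm h)) (x h)) \<le>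
      (\<Sum>u\<in>U. \<delta> (c (cl u)) (pt u)) + (\<Sum>h\<in>insert h H. (real s - 2 * real r) * \<delta> (c (jm h)) (x h))"
    using cl1(4) insert.hyps by simp
  finally show ?case using cl'(1,2) by blast
qed

definition lcost :: "'p list list \<Rightarrow> real" where
  "lcost C = (\<Sum>T\<leftarrow>C. mcost (mset T))"

lemma lcost_nth: "lcost C = (\<Sum>j<length C. mcost (mset (C ! j)))"
  by (simp add: lcost_def sum_list_sum_nth atLeast0LessThan)

lemma family_to_list:
  assumes "finite U" "finite J" "cl ` U \<subseteq> J" "\<And>j. j \<in> J \<Longrightarrow> card {u \<in> U. cl u = j} = s"
    and "pt ` U \<subseteq> PP" "c ` J \<subseteq> CC"
  shows "\<exists>C. clus s (image_mset pt (mset_set U)) C \<and> lcost C \<le> (\<Sum>u\<in>U. \<delta> (c (cl u)) (pt u))"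
proof -
  obtain js where js: "set js = J" "distinct js" using finite_distinct_list[OF assms(2)] by blast
  let ?F = "\<lambda>j. image_mset pt (mset_set {u \<in> U. cl u = j})"
  have "\<exists>l. mset l = ?F j" for j using ex_mset by blast
  then obtain L where L: "mset (L j) = ?F j" for j by metis
  let ?C = "map L js"
  have "mset (concat ?C) = (\<Sum>j\<leftarrow>js. mset (L j))" by (simp add: sum_list_mset_eq[symmetric] comp_def)
  also have "\<dots> = (\<Sum>j\<in>J. ?F j)" by (simp add: L sum_list_distinct_conv_sum_set js)
  also have "\<dots> = (\<Sum>j\<in>J. \<Sum>u\<in>{u \<in> U. cl u = j}. {#pt u#})"
    using assms(1) by (simp add: image_mset_set_sum)
  also have "\<dots> = (\<Sum>u\<in>U. {#pt u#})" by (rule sum.group) (use assms in auto)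
  finally have 1: "mset (concat ?C) = image_mset pt (mset_set U)" using assms(1) by (simp add: image_mset_set_sum)
  have 2: "length (L j) = s" if "j \<in> J" for j
    using assms(4)[OF that] by (metis L size_mset size_image_mset size_mset_set)
  have "lcost ?C = (\<Sum>j\<in>J. mcost (?F j))"
    by (simp add: lcost_def comp_def L sum_list_distinct_conv_sum_set js)
  also have "\<dots> \<le> (\<Sum>j\<in>J. \<Sum>u\<in>{u \<in> U. cl u = j}. \<delta> (c (cl u)) (pt u))"
  proof (rule sum_mono)
    fix j assume j: "j \<in> J"
    have "mcost (?F j) \<le> wsum (c j) (?F j)"
      using assms j by (intro mcost_le) auto
    also have "\<dots> = (\<Sum>u\<in>{u \<in> U. cl u = j}. \<delta> (c j) (pt u))"
      using assms(1) by (simp add: wsum_def image_mset.compositionality comp_def sum_unfold_sum_mset)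
    also have "\<dots> = (\<Sum>u\<in>{u \<in> U. cl u = j}. \<delta> (c (cl u)) (pt u))" by (rule sum.cong) auto
    finally show "mcost (?F j) \<le> (\<Sum>u\<in>{u \<in> U. cl u = j}. \<delta> (c (cl u)) (pt u))" .
  qed
  also have "\<dots> = (\<Sum>u\<in>U. \<delta> (c (cl u)) (pt u))" by (rule sum.group) (use assms in auto)
  finally show ?thesis using 1 2 js by (intro exI[of _ ?C]) (auto simp: clus_def)
qed

lemma clus_PP: "clus s M C \<Longrightarrow> set_mset M \<subseteq> PP \<Longrightarrow> j < length C \<Longrightarrow> set (C ! j) \<subseteq> PP"
  using clus_sub nth_mem by blast

lemma clus_mcost_nonneg: "clus s M C \<Longrightarrow> set_mset M \<subseteq> PP \<Longrightarrow> j < length C \<Longrightarrow> 0 \<le> mcost (mset (C ! j))"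
  using clus_PP by (intro mcost_nonneg) simp

lemma mcost_le_lcost:
  assumes "clus s M C" "set_mset M \<subseteq> PP" "j < length C"
  shows "mcost (mset (C ! j)) \<le> lcost C"
  unfolding lcost_nth using assms(3)
  by (intro member_le_sum) (auto intro!: clus_mcost_nonneg[OF assms(1,2)])

lemma minority_total:
  assumes C: "clus s M C" "set_mset M \<subseteq> PP" "x \<in> PP" "lcost C \<le> real B"
    and J: "J \<subseteq> {..<length C}" "\<And>j. j \<in> J \<Longrightarrow> 2 * count (mset (C ! j)) x \<le> s"
  shows "(\<Sum>j\<in>J. count (mset (C ! j)) x) \<le> B"
proof -
  have "real (count (mset (C ! j)) x) \<le> mcost (mset (C ! j))" if j: "j \<in> J" for j
  proof -
    have "size (mset (C ! j)) = s" using j J(1) C(1) by (auto simp: clus_def)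
    then have "min (count (mset (C ! j)) x) (size (mset (C ! j)) - count (mset (C ! j)) x) = count (mset (C ! j)) x"
      using J(2)[OF j] by simp
    moreover have "set_mset (mset (C ! j)) \<subseteq> PP" using clus_PP[OF C(1,2)] j J(1) by auto
    ultimately show ?thesis using pair_bound[of "mset (C ! j)" x] C(3) by simp
  qed
  then have "real (\<Sum>j\<in>J. count (mset (C ! j)) x) \<le> (\<Sum>j\<in>J. mcost (mset (C ! j)))"
    unfolding of_nat_sum by (rule sum_mono)
  also have "\<dots> \<le> lcost C"
    unfolding lcost_nth using J(1)
    by (intro sum_mono2) (auto intro!: clus_mcost_nonneg[OF C(1,2)])
  finally show ?thesis using C(4) by linarith
qed

text \<open>
  The slots \<open>(j, i)\<close> of a clustering hold its points. For every point the copies are cut into chunks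
  of size \<open>s\<close>, which become homogeneous clusters, and a remainder; every chunk dissolves one cluster.
\<close>

lemma residue_slots:
  assumes C: "clus s M C" "set_mset M \<subseteq> PP" and s: "s > 0"
    and M': "\<forall>x. count M' x = count M x mod s"
    and c: "\<forall>j<length C. c j \<in> CC"
  shows "\<exists>H U S. finite H \<and> U = {..<length C} \<times> {..<s} \<and>
    (\<Sum>u\<in>U. \<delta> (c (fst u)) (C ! fst u ! snd u)) = (\<Sum>j<length C. wsum (c j) (mset (C ! j))) \<and>
    (\<forall>h\<in>H. fst h \<in># M \<and> snd h < count M (fst h) div s \<and>
      S h \<subseteq> U \<and> card (S h) = s \<and> (\<forall>u\<in>S h. C ! fst u ! snd u = fst h)) \<and>
    (\<forall>h\<in>H. \<forall>h'\<in>H. h \<noteq> h' \<longrightarrow> S h \<inter> S h' = {}) \<and>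
    (\<forall>jm r. inj_on jm H \<longrightarrow> jm ` H \<subseteq> {..<length C} \<longrightarrow> (\<forall>h\<in>H. r \<le> card {u \<in> S h. fst u = jm h}) \<longrightarrow>
      (\<exists>C'. clus s M' C' \<and> lcost C' \<le> (\<Sum>j<length C. wsum (c j) (mset (C ! j))) +
        (\<Sum>h\<in>H. (real s - 2 * real (r :: nat)) * \<delta> (c (jm h)) (fst h))))"
proof -
  let ?k = "length C"
  define U where "U = {..<?k} \<times> {..<s}"
  define pt where "pt u = C ! fst u ! snd u" for u
  have finU: "finite U" by (simp add: U_def)
  have len: "length (C ! j) = s" if "j < ?k" for j using that C(1) by (auto simp: clus_def)
  have sum_U: "(\<Sum>u\<in>U. g (fst u) (pt u)) = (\<Sum>j<?k. \<Sum>x\<in>#mset (C ! j). g j x)" for g :: "nat \<Rightarrow> 'p \<Rightarrow> 'z::comm_monoid_add"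
  proof -
    have "(\<Sum>u\<in>U. g (fst u) (pt u)) = (\<Sum>j<?k. \<Sum>i<s. g j (C ! j ! i))"
      unfolding U_def pt_def by (simp add: sum.cartesian_product case_prod_beta)
    also have "\<dots> = (\<Sum>j<?k. \<Sum>x\<leftarrow>C ! j. g j x)"
      by (intro sum.cong refl) (simp add: sum_list_sum_nth len atLeast0LessThan)
    finally show ?thesis by (simp flip: mset_map sum_mset_sum_list)
  qed
  have M_U: "M = image_mset pt (mset_set U)"
  proof -
    have "image_mset pt (mset_set U) = (\<Sum>u\<in>U. {#pt u#})" by (rule image_mset_set_sum[OF finU])
    also have "\<dots> = (\<Sum>j<?k. mset (C ! j))" by (subst sum_U) simp
    finally show ?thesis using C(1) by (simp add: clus_def mset_concat_nth)
  qed
  have count: "count (image_mset pt (mset_set V)) x = card {u \<in> V. pt u = x}" if "finite V" for V x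
  proof -
    have "count (image_mset pt (mset_set V)) x = (\<Sum>u\<in>V. if pt u = x then 1 else 0)"
      by (simp add: image_mset_set_sum[OF that] count_sum cong: if_cong)
    also have "\<dots> = (\<Sum>u\<in>{u \<in> V. pt u = x}. 1)" by (rule sum.inter_filter[OF that, symmetric])
    finally show ?thesis by simp
  qed
  define A where "A x = {u \<in> U. pt u = x}" for x
  have finA: "finite (A x)" for x using finU by (simp add: A_def)
  have cardA: "card (A x) = count M x" for x by (simp add: M_U count[OF finU] A_def)
  have "\<exists>f :: nat \<times> nat \<Rightarrow> nat. \<forall>i < card (A x) div s. card {u \<in> A x. f u = i} = s" for x
    using chunk_fun[OF finA s, of x] by blast
  then obtain f :: "'p \<Rightarrow> nat \<times> nat \<Rightarrow> nat" where f: "\<forall>i < card (A x) div s. card {u \<in> A x. f x u = i} = s" for x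
    by metis
  define H where "H = Sigma (set_mset M) (\<lambda>x. {..<count M x div s})"
  define S where "S h = {u \<in> A (fst h). f (fst h) u = snd h}" for h
  have finH: "finite H" by (simp add: H_def)
  have S: "S h \<subseteq> U \<and> card (S h) = s \<and> (\<forall>u\<in>S h. pt u = fst h) \<and> fst h \<in> PP" if "h \<in> H" for h
  proof -
    have "snd h < card (A (fst h)) div s" using that by (auto simp: H_def cardA)
    then have "card (S h) = s" using f[of "fst h"] by (simp add: S_def)
    then show ?thesis using that C(2) by (auto simp: H_def S_def A_def)
  qed
  have disj: "S h \<inter> S h' = {}" if "h \<in> H" "h' \<in> H" "h \<noteq> h'" for h h'
    using that by (auto simp: S_def A_def prod_eq_iff)
  have finS: "finite (S h)" for h using finA by (simp add: S_def)
  have card_S: "card (\<Union>(S ` {h \<in> H. fst h = x})) = s * (count M x div s)" for x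
  proof -
    have "card (\<Union>(S ` {h \<in> H. fst h = x})) = (\<Sum>h\<in>{h \<in> H. fst h = x}. card (S h))"
      using finH finS disj by (intro card_UN_disjoint) auto
    also have "\<dots> = (\<Sum>h\<in>{h \<in> H. fst h = x}. s)" using S by (intro sum.cong) auto
    also have "\<dots> = card {h \<in> H. fst h = x} * s" by simp
    moreover have "{h \<in> H. fst h = x} = Pair x ` {..<count M x div s}"
    proof (cases "x \<in># M")
      case False
      then have "count M x = 0" by (simp add: not_in_iff)
      with False show ?thesis by (auto simp: H_def)
    qed (auto simp: H_def)
    moreover have "card (Pair x ` {..<count M x div s}) = count M x div s" by (simp add: card_image inj_on_def)
    ultimately show ?thesis by simp
  qed
  have res: "image_mset pt (mset_set (U - \<Union>(S ` H))) = M'"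
  proof (rule multiset_eqI)
    fix x
    have "{u \<in> U - \<Union>(S ` H). pt u = x} = A x - \<Union>(S ` {h \<in> H. fst h = x})"
      by (auto simp: S_def A_def)
    moreover have sub: "\<Union>(S ` {h \<in> H. fst h = x}) \<subseteq> A x" by (auto simp: S_def)
    ultimately have "card {u \<in> U - \<Union>(S ` H). pt u = x} = count M x - s * (count M x div s)"
      using card_Diff_subset[OF finite_subset[OF sub finA] sub] by (simp only: card_S cardA)
    then show "count (image_mset pt (mset_set (U - \<Union>(S ` H)))) x = count M' x"
      using finU by (simp add: count M' minus_mult_div_eq_mod)
  qed
  have fib: "card {u \<in> U. fst u = j} = s" if "j \<in> {..<?k}" for j
  proof -
    have "{u \<in> U. fst u = j} = Pair j ` {..<s}" using that by (auto simp: U_def)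
    then show ?thesis by (simp add: card_image inj_on_def)
  qed
  have pt: "pt ` U \<subseteq> PP"
  proof -
    have "set_mset (image_mset pt (mset_set U)) \<subseteq> PP" using C(2) M_U by simp
    then show ?thesis using finU by simp
  qed
  have W: "(\<Sum>u\<in>U. \<delta> (c (fst u)) (pt u)) = (\<Sum>j<?k. wsum (c j) (mset (C ! j)))"
    unfolding wsum_def by (rule sum_U)
  have "\<exists>C'. clus s M' C' \<and> lcost C' \<le> (\<Sum>j<?k. wsum (c j) (mset (C ! j))) +
        (\<Sum>h\<in>H. (real s - 2 * real r) * \<delta> (c (jm h)) (fst h))"
    if jm: "inj_on jm H" "jm ` H \<subseteq> {..<?k}" "\<forall>h\<in>H. r \<le> card {u \<in> S h. fst u = jm h}" for jm and r :: nat
  proof -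
    have cC: "c ` {..<?k} \<subseteq> CC" using c by auto
    have "\<exists>cl. cl ` (U - \<Union>(S ` H)) \<subseteq> {..<?k} - jm ` H \<and>
      (\<forall>j\<in>{..<?k} - jm ` H. card {u \<in> U - \<Union>(S ` H). cl u = j} = s) \<and>
      (\<Sum>u\<in>U - \<Union>(S ` H). \<delta> (c (cl u)) (pt u)) \<le>
        (\<Sum>u\<in>U. \<delta> (c (fst u)) (pt u)) + (\<Sum>h\<in>H. (real s - 2 * real r) * \<delta> (c (jm h)) (fst h))"
    proof (rule dissolve[OF finH finU])
      show "fst ` U \<subseteq> {..<?k}" by (auto simp: U_def)
      show "card {u \<in> U. fst u = j} = s" if "j \<in> {..<?k}" for j using that by (rule fib)
      show "S h \<subseteq> U \<and> card (S h) = s \<and> (\<forall>u\<in>S h. pt u = fst h) \<and> fst h \<in> PP" if "h \<in> H" for h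
        using that by (rule S)
      show "S h \<inter> S h' = {}" if "h \<in> H" "h' \<in> H" "h \<noteq> h'" for h h' using that by (rule disj)
      show "r \<le> card {u \<in> S h. fst u = jm h}" if "h \<in> H" for h using jm(3) that by blast
    qed (fact pt cC jm(1) jm(2))+
    then obtain cl where cl: "cl ` (U - \<Union>(S ` H)) \<subseteq> {..<?k} - jm ` H"
      "\<forall>j\<in>{..<?k} - jm ` H. card {u \<in> U - \<Union>(S ` H). cl u = j} = s"
      "(\<Sum>u\<in>U - \<Union>(S ` H). \<delta> (c (cl u)) (pt u)) \<le>
        (\<Sum>u\<in>U. \<delta> (c (fst u)) (pt u)) + (\<Sum>h\<in>H. (real s - 2 * real r) * \<delta> (c (jm h)) (fst h))"
      by blast
    have "\<exists>C'. clus s (image_mset pt (mset_set (U - \<Union>(S ` H)))) C' \<and>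
      lcost C' \<le> (\<Sum>u\<in>U - \<Union>(S ` H). \<delta> (c (cl u)) (pt u))"
    proof (rule family_to_list[where J = "{..<?k} - jm ` H"])
      show "finite (U - \<Union>(S ` H))" "finite ({..<?k} - jm ` H)" using finU by auto
      show "cl ` (U - \<Union>(S ` H)) \<subseteq> {..<?k} - jm ` H" by (rule cl(1))
      show "card {u \<in> U - \<Union>(S ` H). cl u = j} = s" if "j \<in> {..<?k} - jm ` H" for j using cl(2) that by blast
      show "pt ` (U - \<Union>(S ` H)) \<subseteq> PP" using pt by auto
      show "c ` ({..<?k} - jm ` H) \<subseteq> CC" using cC by auto
    qed
    then obtain C' where C': "clus s M' C'" "lcost C' \<le> (\<Sum>u\<in>U - \<Union>(S ` H). \<delta> (c (cl u)) (pt u))"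
      unfolding res by blast
    with C' cl(3) W show ?thesis by (intro exI[of _ C']) auto
  qed
  then have n3: "\<forall>jm r. inj_on jm H \<longrightarrow> jm ` H \<subseteq> {..<?k} \<longrightarrow> (\<forall>h\<in>H. r \<le> card {u \<in> S h. fst u = jm h}) \<longrightarrow>
      (\<exists>C'. clus s M' C' \<and> lcost C' \<le> (\<Sum>j<?k. wsum (c j) (mset (C ! j))) +
        (\<Sum>h\<in>H. (real s - 2 * real (r :: nat)) * \<delta> (c (jm h)) (fst h)))" by blast
  have n1: "\<forall>h\<in>H. fst h \<in># M \<and> snd h < count M (fst h) div s \<and>
      S h \<subseteq> U \<and> card (S h) = s \<and> (\<forall>u\<in>S h. C ! fst u ! snd u = fst h)"
    using S by (auto simp: H_def pt_def)
  have n2: "\<forall>h\<in>H. \<forall>h'\<in>H. h \<noteq> h' \<longrightarrow> S h \<inter> S h' = {}" using disj by blast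
  show ?thesis
    by (rule exI[of _ H], rule exI[of _ U], rule exI[of _ S])
      (intro conjI finH U_def W[unfolded pt_def] n1 n2 n3)
qed

lemma residue_factor:
  assumes C: "clus s M C" "set_mset M \<subseteq> PP" and s: "s > 0"
    and M': "\<forall>x. count M' x = count M x mod s"
    and c: "\<forall>j<length C. c j \<in> CC"
  shows "\<exists>C'. clus s M' C' \<and> lcost C' \<le> (2 - 2 / real s) * (\<Sum>j<length C. wsum (c j) (mset (C ! j)))"
proof (cases "s = 1")
  case True
  then have "M' = {#}" using M' by (intro multiset_eqI) simp
  then show ?thesis using True by (intro exI[of _ "[]"]) (simp add: clus_def lcost_def)
next
  case False
  then have s2: "s \<ge> 2" using s by simp
  let ?k = "length C" and ?W = "\<Sum>j<length C. wsum (c j) (mset (C ! j))"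
  let ?pt = "\<lambda>u. C ! fst u ! snd u"
  let ?w = "\<lambda>u. \<delta> (c (fst u)) (?pt u)"
  obtain H U S where HUS: "finite H" "U = {..<?k} \<times> {..<s}" "(\<Sum>u\<in>U. ?w u) = ?W"
    "\<forall>h\<in>H. fst h \<in># M \<and> snd h < count M (fst h) div s \<and>
      S h \<subseteq> U \<and> card (S h) = s \<and> (\<forall>u\<in>S h. ?pt u = fst h)"
    "\<forall>h\<in>H. \<forall>h'\<in>H. h \<noteq> h' \<longrightarrow> S h \<inter> S h' = {}"
    "\<forall>jm r. inj_on jm H \<longrightarrow> jm ` H \<subseteq> {..<length C} \<longrightarrow> (\<forall>h\<in>H. r \<le> card {u \<in> S h. fst u = jm h}) \<longrightarrow>
      (\<exists>C'. clus s M' C' \<and> lcost C' \<le> ?W +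
        (\<Sum>h\<in>H. (real s - 2 * real (r :: nat)) * \<delta> (c (jm h)) (fst h)))"
    using residue_slots[where c = c, OF C s M' c] by (elim exE conjE) (rule that)
  have finU: "finite U" by (simp add: HUS(2))
  have SU: "S h \<subseteq> U" "card (S h) = s" if "h \<in> H" for h using HUS(4) that by auto
  have finS: "finite (S h)" if "h \<in> H" for h using SU[OF that] finU finite_subset by blast
  let ?V = "\<Union>(S ` H)" let ?R = "U - ?V"
  have cardV: "card ?V = card H * s"
  proof -
    have "card ?V = (\<Sum>h\<in>H. card (S h))" using HUS(1,5) finS by (intro card_UN_disjoint) auto
    then show ?thesis using SU(2) by simp
  qed
  have VU: "?V \<subseteq> U" using SU by auto
  have cardU: "card U = ?k * s" by (simp add: HUS(2) card_cartesian_product)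
  have "card ?R = (?k - card H) * s"
    using card_Diff_subset[OF finite_subset[OF VU finU] VU] by (simp add: cardU cardV diff_mult_distrib)
  then have dvdR: "s dvd card ?R" by simp
  obtain f :: "nat \<times> nat \<Rightarrow> nat" where f: "\<forall>i < card ?R div s. card {u \<in> ?R. f u = i} = s"
    "\<forall>u\<in>?R. f u < card ?R div s"
    using chunk_fun[of ?R s] finU s dvdR by auto
  define owner where "owner u = (THE h. h \<in> H \<and> u \<in> S h)" for u
  have owner: "owner u = h" if "h \<in> H" "u \<in> S h" for h u
    unfolding owner_def using that HUS(5) by (intro the_equality) auto
  define \<phi> where "\<phi> u = (if u \<in> ?V then Inl (owner u) else Inr (f u))" for u
  let ?I = "Inl ` H \<union> Inr ` {..<card ?R div s}"
  have \<phi>_S: "\<phi> u = Inl h" if "h \<in> H" "u \<in> S h" for h u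
  proof -
    have "u \<in> ?V" using that by blast
    then show ?thesis by (simp only: \<phi>_def if_True owner[OF that])
  qed
  have S_\<phi>: "u \<in> S h" if "\<phi> u = Inl h" for h u
  proof -
    have "u \<in> ?V" using that unfolding \<phi>_def by (metis sum.distinct(1))
    then obtain h' where "h' \<in> H" "u \<in> S h'" by blast
    with \<phi>_S[of h' u] that show ?thesis by simp
  qed
  have \<phi>_Inl: "{u \<in> U. \<phi> u = Inl h} = S h" if "h \<in> H" for h
    using SU(1)[OF that] \<phi>_S[OF that] S_\<phi> by blast
  have \<phi>_Inr: "{u \<in> U. \<phi> u = Inr i} = {u \<in> ?R. f u = i}" for i
    unfolding \<phi>_def by (intro Collect_cong) (metis DiffD1 DiffD2 DiffI sum.distinct(1) sum.inject(2))
  have "\<exists>T\<subseteq>U. bij_betw \<phi> T ?I \<and> bij_betw fst T {..<?k} \<and> real s * sum ?w T \<le> sum ?w U"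
  proof (rule light_transversal)
    show "\<phi> ` U \<subseteq> ?I"
    proof
      fix z assume "z \<in> \<phi> ` U"
      then obtain u where u: "u \<in> U" "z = \<phi> u" by blast
      show "z \<in> ?I"
      proof (cases "u \<in> ?V")
        case True
        then obtain h where "h \<in> H" "u \<in> S h" by blast
        then show ?thesis using u(2) \<phi>_S[of h u] by simp
      next
        case False
        then have "\<phi> u = Inr (f u)" by (simp only: \<phi>_def if_False)
        moreover have "f u < card ?R div s" using False u(1) f(2) by blast
        ultimately show ?thesis using u(2) by blast
      qed
    qed
    show "fst ` U \<subseteq> {..<?k}" by (auto simp: HUS(2))
    show "card {u \<in> U. \<phi> u = i} = s" if "i \<in> ?I" for i
      using that \<phi>_Inl \<phi>_Inr SU(2) f(1) by auto
    show "card {u \<in> U. fst u = j} = s" if "j \<in> {..<?k}" for j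
    proof -
      have "{u \<in> U. fst u = j} = Pair j ` {..<s}" using that by (auto simp: HUS(2))
      then show ?thesis by (simp add: card_image inj_on_def)
    qed
  qed (use finU HUS(1) s in auto)
  then obtain T where T: "T \<subseteq> U" "bij_betw \<phi> T ?I" "bij_betw fst T {..<?k}" "real s * sum ?w T \<le> ?W"
    using HUS(3) by auto
  have "\<exists>u\<in>T. \<phi> u = Inl h" if "h \<in> H" for h
    using T(2) that unfolding bij_betw_def by (metis UnI1 imageE imageI)
  then obtain t where t: "t h \<in> T" "\<phi> (t h) = Inl h" if "h \<in> H" for h by metis
  have tS: "t h \<in> S h" if "h \<in> H" for h using t[OF that] \<phi>_Inl[OF that] T(1) by auto
  have inj_t: "inj_on t H" using t by (metis inj_onI sum.inject(1))
  define jm where "jm h = fst (t h)" for h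
  have "inj_on jm H"
    using T(3) t(1) inj_t unfolding jm_def bij_betw_def inj_on_def by blast
  moreover have "jm ` H \<subseteq> {..<?k}" using T(3) t(1) by (auto simp: jm_def bij_betw_def)
  moreover have "\<forall>h\<in>H. 1 \<le> card {u \<in> S h. fst u = jm h}"
  proof
    fix h assume h: "h \<in> H"
    have "{t h} \<subseteq> {u \<in> S h. fst u = jm h}" using tS[OF h] by (simp add: jm_def)
    then have "card {t h} \<le> card {u \<in> S h. fst u = jm h}" using finS[OF h] by (intro card_mono) auto
    then show "1 \<le> card {u \<in> S h. fst u = jm h}" by simp
  qed
  ultimately obtain C' where C': "clus s M' C'"
    "lcost C' \<le> ?W + (\<Sum>h\<in>H. (real s - 2 * real (1 :: nat)) * \<delta> (c (jm h)) (fst h))"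
    using HUS(6) by blast
  have "(\<Sum>h\<in>H. \<delta> (c (jm h)) (fst h)) = (\<Sum>h\<in>H. ?w (t h))"
  proof (rule sum.cong)
    fix h assume "h \<in> H"
    then show "\<delta> (c (jm h)) (fst h) = ?w (t h)" using HUS(4) tS by (auto simp: jm_def)
  qed simp
  also have "\<dots> = sum ?w (t ` H)" using inj_t by (simp add: sum.reindex)
  also have "\<dots> \<le> sum ?w T"
  proof (rule sum_mono2)
    show "finite T" using T(1) finU finite_subset by blast
    show "t ` H \<subseteq> T" using t by auto
    fix u assume "u \<in> T - t ` H"
    then have "fst u < ?k" "snd u < s" using T(1) HUS(2) by auto
    then have "c (fst u) \<in> CC" "?pt u \<in> PP"
      using c clus_PP[OF C] C(1) by (auto simp: clus_def subset_iff)
    then show "0 \<le> ?w u" by (rule nonneg)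
  qed
  also have "\<dots> \<le> ?W / real s" using T(4) s by (simp add: field_simps)
  finally have "(real s - 2) * (\<Sum>h\<in>H. \<delta> (c (jm h)) (fst h)) \<le> (real s - 2) * (?W / real s)"
    using s2 by (intro mult_left_mono) auto
  then have "lcost C' \<le> ?W + (real s - 2) * (?W / real s)"
    using C'(2) by (simp add: sum_distrib_left)
  also have "\<dots> = (2 - 2 / real s) * ?W" using s by (simp add: field_simps)
  finally show ?thesis using C'(1) by blast
qed

lemma two_majorities:
  assumes "size T < 2 * count T x" "size T < 2 * count T y"
  shows "x = y"
proof (rule ccontr)
  assume "x \<noteq> y"
  then have "count (others x T) y = count T y" by (simp add: others_def)
  then have "count T y \<le> size T - count T x" using count_le_size'[of "others x T" y] by (simp add: size_others)
  with assms show False by simp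
qed

lemma residue_lossless:
  assumes C: "clus s M C" "set_mset M \<subseteq> PP" and s: "B < s"
    and B: "lcost C \<le> real B"
    and M': "\<forall>x. count M' x = count M x mod s"
    and c: "\<forall>j<length C. c j \<in> CC"
  shows "\<exists>C'. clus s M' C' \<and> lcost C' \<le> (\<Sum>j<length C. wsum (c j) (mset (C ! j)))"
proof -
  let ?k = "length C"
  have size: "size (mset (C ! j)) = s" if "j < ?k" for j using that C(1) by (auto simp: clus_def)
  define J where "J x = {j \<in> {..<?k}. s < 2 * count (mset (C ! j)) x}" for x
  have J_disj: "x = y" if "j \<in> J x" "j \<in> J y" for j x y
    using that two_majorities[of "mset (C ! j)" x y] size[of j] by (auto simp: J_def)
  define c' where "c' j = (if \<exists>x. j \<in> J x then emb (THE x. j \<in> J x) else c j)" for j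
  have c'_J: "c' j = emb x" if "j \<in> J x" for j x
    using that J_disj by (auto simp: c'_def the_equality intro!: arg_cong[where f = emb])
  have PP: "x \<in> PP" if "j \<in> J x" for j x
  proof -
    have "s < 2 * count (mset (C ! j)) x" "j < ?k" using that by (auto simp: J_def)
    then have "0 < count (mset (C ! j)) x" by linarith
    then have "x \<in> set (C ! j)" by (simp only: count_greater_zero_iff set_mset_mset)
    then show ?thesis using clus_PP[OF C \<open>j < ?k\<close>] by blast
  qed
  have c'CC: "c' j \<in> CC" if "j < ?k" for j
  proof (cases "\<exists>x. j \<in> J x")
    case True
    then show ?thesis using c'_J PP emb by metis
  next
    case False
    then show ?thesis using c that by (simp add: c'_def)
  qed
  have W: "(\<Sum>j<?k. wsum (c' j) (mset (C ! j))) \<le> (\<Sum>j<?k. wsum (c j) (mset (C ! j)))"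
  proof (rule sum_mono)
    fix j assume j: "j \<in> {..<?k}"
    show "wsum (c' j) (mset (C ! j)) \<le> wsum (c j) (mset (C ! j))"
    proof (cases "\<exists>x. j \<in> J x")
      case True
      then obtain x where x: "j \<in> J x" by blast
      then have "size (mset (C ! j)) \<le> 2 * count (mset (C ! j)) x" using j size by (simp add: J_def)
      then show ?thesis unfolding c'_J[OF x]
        using majority_center[of "mset (C ! j)" x "c j"] clus_PP[OF C] j PP[OF x] c by simp
    next
      case False
      then show ?thesis by (simp add: c'_def)
    qed
  qed
  have s': "s > 0" using s by simp
  have c'CC': "\<forall>j<?k. c' j \<in> CC" using c'CC by blast
  obtain H U S where HUS0: "finite H" "U = {..<?k} \<times> {..<s}"
    "(\<Sum>u\<in>U. \<delta> (c' (fst u)) (C ! fst u ! snd u)) = (\<Sum>j<?k. wsum (c' j) (mset (C ! j)))"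
    "\<forall>h\<in>H. fst h \<in># M \<and> snd h < count M (fst h) div s \<and>
      S h \<subseteq> U \<and> card (S h) = s \<and> (\<forall>u\<in>S h. C ! fst u ! snd u = fst h)"
    "\<forall>h\<in>H. \<forall>h'\<in>H. h \<noteq> h' \<longrightarrow> S h \<inter> S h' = {}"
    "\<forall>jm r. inj_on jm H \<longrightarrow> jm ` H \<subseteq> {..<?k} \<longrightarrow> (\<forall>h\<in>H. r \<le> card {u \<in> S h. fst u = jm h}) \<longrightarrow>
      (\<exists>C'. clus s M' C' \<and> lcost C' \<le> (\<Sum>j<?k. wsum (c' j) (mset (C ! j))) +
        (\<Sum>h\<in>H. (real s - 2 * real (r :: nat)) * \<delta> (c' (jm h)) (fst h)))"
    using residue_slots[where c = c', OF C s' M' c'CC'] by (elim exE conjE) (rule that)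
  have HUS: "finite H" "\<forall>h\<in>H. fst h \<in># M \<and> snd h < count M (fst h) div s" using HUS0(1,4) by auto
  note HUS = HUS HUS0(6)
  have cardJ: "count M x div s \<le> card (J x)" if "x \<in># M" for x
  proof -
    have Jk: "J x \<subseteq> {..<?k}" by (auto simp: J_def)
    have "count M x = (\<Sum>j<?k. count (mset (C ! j)) x)"
      using C(1) by (simp add: clus_def flip: count_concat_nth)
    also have "\<dots> = (\<Sum>j\<in>{..<?k} - J x. count (mset (C ! j)) x) + (\<Sum>j\<in>J x. count (mset (C ! j)) x)"
      by (rule sum.subset_diff) (use Jk in auto)
    also have "(\<Sum>j\<in>{..<?k} - J x. count (mset (C ! j)) x) \<le> B"
      using C(2) that B by (intro minority_total[OF C]) (auto simp: J_def)
    also have "(\<Sum>j\<in>J x. count (mset (C ! j)) x) \<le> (\<Sum>j\<in>J x. s)"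
    proof (rule sum_mono)
      fix j assume "j \<in> J x"
      then have "size (mset (C ! j)) = s" using size Jk by blast
      then show "count (mset (C ! j)) x \<le> s" using count_le_size'[of "mset (C ! j)" x] by simp
    qed
    finally have "count M x \<le> B + card (J x) * s" by simp
    then have "count M x < Suc (card (J x)) * s" using s by simp
    then have "count M x div s < Suc (card (J x))" by (rule less_mult_imp_div_less)
    then show ?thesis by simp
  qed
  have "\<exists>e :: nat \<Rightarrow> nat. inj_on e {..<count M x div s} \<and> e ` {..<count M x div s} \<subseteq> J x" if "x \<in># M" for x
    using cardJ[OF that] card_le_inj[of "{..<count M x div s}" "J x"] by (auto simp: J_def)
  then obtain e where e: "inj_on (e x) {..<count M x div s}" "e x ` {..<count M x div s} \<subseteq> J x"
    if "x \<in># M" for x by metis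
  define jm where "jm h = e (fst h) (snd h)" for h :: "'p \<times> nat"
  have jmJ: "jm h \<in> J (fst h)" if "h \<in> H" for h
    using HUS(2) that e(2)[of "fst h"] by (auto simp: jm_def)
  have "inj_on jm H"
  proof (rule inj_onI)
    fix h h' assume h: "h \<in> H" "h' \<in> H" "jm h = jm h'"
    have "fst h = fst h'" using J_disj jmJ h by metis
    moreover from this have "snd h = snd h'"
    proof -
      have "snd h < count M (fst h) div s" "snd h' < count M (fst h') div s" "fst h \<in># M"
        using h(1,2) HUS(2) by auto
      then show ?thesis
        using inj_onD[OF e(1)[of "fst h"], of "snd h" "snd h'"] h(3) \<open>fst h = fst h'\<close> by (simp add: jm_def)
    qed
    ultimately show "h = h'" by (simp add: prod_eq_iff)
  qed
  moreover have "jm ` H \<subseteq> {..<?k}" using jmJ by (auto simp: J_def)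
  ultimately obtain C' where C': "clus s M' C'" "lcost C' \<le> (\<Sum>j<?k. wsum (c' j) (mset (C ! j))) +
        (\<Sum>h\<in>H. (real s - 2 * real (0 :: nat)) * \<delta> (c' (jm h)) (fst h))"
    using HUS(3) by blast
  have "\<delta> (c' (jm h)) (fst h) = 0" if "h \<in> H" for h
    using c'_J[OF jmJ[OF that]] emb(2) PP[OF jmJ[OF that]] by simp
  then have "(\<Sum>h\<in>H. (real s - 2 * real (0 :: nat)) * \<delta> (c' (jm h)) (fst h)) = 0" by simp
  with C' W show ?thesis by (intro exI[of _ C']) auto
qed

lemma lcost_approx:
  assumes C: "clus s M C" "set_mset M \<subseteq> PP" and "\<epsilon> > 0"
  shows "\<exists>c. (\<forall>j<length C. c j \<in> CC) \<and> (\<Sum>j<length C. wsum (c j) (mset (C ! j))) \<le> lcost C + \<epsilon>"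
proof (cases "length C = 0")
  case False
  let ?\<epsilon> = "\<epsilon> / real (length C)"
  have "\<exists>c\<in>CC. wsum c (mset (C ! j)) < mcost (mset (C ! j)) + ?\<epsilon>" if "j < length C" for j
    using mcost_approx[of "mset (C ! j)" ?\<epsilon>] clus_PP[OF C that] assms(3) False by auto
  then obtain c where c: "\<forall>j<length C. c j \<in> CC \<and> wsum (c j) (mset (C ! j)) < mcost (mset (C ! j)) + ?\<epsilon>"
    by metis
  then have "(\<Sum>j<length C. wsum (c j) (mset (C ! j))) \<le> (\<Sum>j<length C. mcost (mset (C ! j)) + ?\<epsilon>)"
    by (intro sum_mono less_imp_le) auto
  also have "\<dots> = lcost C + \<epsilon>" using False by (simp add: lcost_nth sum.distrib)
  finally show ?thesis using c by blast
qed (use assms(3) in \<open>simp add: lcost_def\<close>)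

theorem residue:
  assumes C: "clus s M C" "set_mset M \<subseteq> PP" and s: "s > 0"
    and B: "lcost C \<le> real B"
    and M': "\<forall>x. count M' x = count M x mod s"
  shows "\<exists>C'. clus s M' C' \<and> lcost C' \<le> (if s \<le> B then 2 - 2 / real s else 1) * lcost C"
proof -
  let ?K = "if s \<le> B then 2 - 2 / real s else 1" and ?F = "{C. clus s M' C}"
  have K: "?K \<ge> 0" using s by (auto simp: field_simps)
  have step: "\<exists>C'. clus s M' C' \<and> lcost C' \<le> ?K * (\<Sum>j<length C. wsum (c j) (mset (C ! j)))"
    if "\<forall>j<length C. c j \<in> CC" for c
    using residue_factor[OF C s M' that] residue_lossless[OF C _ B M' that] by auto
  have "?F \<noteq> {}" using step lcost_approx[OF C, of 1] by auto
  then obtain C' where C': "clus s M' C'" "\<forall>C''\<in>?F. lcost C' \<le> lcost C''"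
    using finite_clus[OF s] by (metis (no_types, lifting) arg_min_if_finite(1) arg_min_least mem_Collect_eq)
  have "lcost C' \<le> ?K * lcost C"
  proof (rule field_le_epsilon)
    fix \<epsilon> :: real assume "\<epsilon> > 0"
    then have pos: "\<epsilon> / (?K + 1) > 0" using K by (intro divide_pos_pos) linarith+
    obtain c where c: "\<forall>j<length C. c j \<in> CC"
      "(\<Sum>j<length C. wsum (c j) (mset (C ! j))) \<le> lcost C + \<epsilon> / (?K + 1)"
      using lcost_approx[OF C pos] by blast
    obtain C'' where "clus s M' C''" "lcost C'' \<le> ?K * (\<Sum>j<length C. wsum (c j) (mset (C ! j)))"
      using step[OF c(1)] by blast
    then have "lcost C' \<le> ?K * (\<Sum>j<length C. wsum (c j) (mset (C ! j)))" using C'(2) by force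
    also have "\<dots> \<le> ?K * (lcost C + \<epsilon> / (?K + 1))" by (rule mult_left_mono[OF c(2) K])
    also have "\<dots> = ?K * lcost C + ?K / (?K + 1) * \<epsilon>" by (simp only: distrib_left times_divide_eq_right times_divide_eq_left)
    also have "?K / (?K + 1) * \<epsilon> \<le> 1 * \<epsilon>"
      using K \<open>\<epsilon> > 0\<close> by (intro mult_right_mono) (auto simp: divide_le_eq_1)
    finally show "lcost C' \<le> ?K * lcost C + \<epsilon>" by simp
  qed
  with C'(1) show ?thesis by blast
qed

lemma indivisible_bound:
  assumes C: "clus s M C" "set_mset M \<subseteq> PP" and B: "lcost C \<le> real B"
  shows "card {x \<in> set_mset M. \<not> s dvd count M x} \<le> 2 * B"
proof -
  let ?k = "length C"
  define J where "J = {j \<in> {..<?k}. 2 \<le> card (set (C ! j))}"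
  have sub: "{x \<in> set_mset M. \<not> s dvd count M x} \<subseteq> (\<Union>j\<in>J. set (C ! j))"
  proof
    fix x assume x: "x \<in> {x \<in> set_mset M. \<not> s dvd count M x}"
    show "x \<in> (\<Union>j\<in>J. set (C ! j))"
    proof (rule ccontr)
      assume no: "x \<notin> (\<Union>j\<in>J. set (C ! j))"
      have "s dvd count (mset (C ! j)) x" if j: "j < ?k" for j
      proof (cases "x \<in> set (C ! j)")
        case True
        then have "\<not> 2 \<le> card (set (C ! j))" using no j by (auto simp: J_def)
        then have "card (set (C ! j)) \<le> 1" by simp
        then have "set (C ! j) = {x}" using True
          by (metis List.finite_set card_1_singletonE card_0_eq empty_iff le_Suc_eq le_zero_eq One_nat_def singletonD)
        then have "count (mset (C ! j)) x = length (C ! j)"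
          by (simp add: count_mset filter_True count_list_eq_length_filter)
        then show ?thesis using C(1) j by (simp add: clus_def)
      qed (simp add: count_mset_0_iff[THEN iffD2])
      then have "s dvd (\<Sum>j<?k. count (mset (C ! j)) x)" by (intro dvd_sum) auto
      then show False using x C(1) by (simp add: clus_def flip: count_concat_nth)
    qed
  qed
  have "card {x \<in> set_mset M. \<not> s dvd count M x} \<le> card (\<Union>j\<in>J. set (C ! j))"
    by (rule card_mono[OF _ sub]) (simp add: J_def)
  also have "\<dots> \<le> (\<Sum>j\<in>J. card (set (C ! j)))" by (rule card_UN_le) (simp add: J_def)
  finally have "real (card {x \<in> set_mset M. \<not> s dvd count M x}) \<le> (\<Sum>j\<in>J. real (card (set (C ! j))))"
    by (simp flip: of_nat_sum)
  also have "\<dots> \<le> (\<Sum>j\<in>J. 2 * mcost (mset (C ! j)))"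
  proof (rule sum_mono)
    fix j assume "j \<in> J"
    then show "real (card (set (C ! j))) \<le> 2 * mcost (mset (C ! j))"
      using distinct_bound[of "mset (C ! j)"] clus_PP[OF C, of j] by (simp add: J_def)
  qed
  also have "\<dots> \<le> (\<Sum>j<?k. 2 * mcost (mset (C ! j)))"
    using clus_mcost_nonneg[OF C] by (intro sum_mono2) (auto simp: J_def)
  also have "\<dots> = 2 * lcost C" by (simp add: lcost_nth sum_distrib_left)
  finally show ?thesis using B by linarith
qed

lemma strict_majority:
  assumes "set_mset T \<subseteq> PP" "mcost T \<le> real B" "2 * B + 2 \<le> size T"
  shows "\<exists>x\<in>PP. size T \<le> count T x + B \<and> (\<forall>y. y \<noteq> x \<longrightarrow> count T y \<le> B)"
proof -
  have "\<not> (\<forall>x. 2 * count T x \<le> size T)"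
  proof
    assume "\<forall>x. 2 * count T x \<le> size T"
    then have "real (size T) / 2 \<le> mcost T" using no_majority[OF assms(1)] by blast
    moreover have "real (2 * B + 2) \<le> real (size T)" using assms(3) by (simp only: of_nat_le_iff)
    ultimately show False using assms(2) by simp
  qed
  then obtain x where x: "size T < 2 * count T x" by (meson not_le)
  then have "0 < count T x" by linarith
  then have "x \<in> PP" using assms(1) by auto
  have "min (count T x) (size T - count T x) \<le> B"
    using pair_bound[OF assms(1) \<open>x \<in> PP\<close>] assms(2) by linarith
  moreover have "B < count T x" using x assms(3) by linarith
  ultimately have le: "size T - count T x \<le> B" by linarith
  have "count T y \<le> B" if "y \<noteq> x" for y
  proof -
    have "count T y = count (others x T) y" using that by (simp add: others_def)
    also have "\<dots> \<le> size (others x T)" by (rule count_le_size')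
    finally show ?thesis using le by (simp add: size_others)
  qed
  then show ?thesis using le \<open>x \<in> PP\<close> by (intro bexI[of _ x]) auto
qed

lemma majority_structure:
  assumes C: "clus s M C" "set_mset M \<subseteq> PP" and B: "lcost C \<le> real B"
    and s: "2 * B + 2 \<le> s" and less: "\<And>x. count M x < s"
  shows "\<exists>m. inj_on m {..<length C} \<and>
    (\<forall>j<length C. m j \<in> PP \<and> s \<le> count (mset (C ! j)) (m j) + B \<and>
      (\<forall>y. y \<noteq> m j \<longrightarrow> count (mset (C ! j)) y \<le> B)) \<and>
    (\<forall>x. B < count M x \<longleftrightarrow> x \<in> m ` {..<length C}) \<and>
    (\<forall>x. B < count M x \<longrightarrow> s \<le> count M x + B)"
proof -
  let ?k = "length C"
  have size: "size (mset (C ! j)) = s" if "j < ?k" for j using that C(1) by (auto simp: clus_def)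
  have "\<exists>x\<in>PP. s \<le> count (mset (C ! j)) x + B \<and> (\<forall>y. y \<noteq> x \<longrightarrow> count (mset (C ! j)) y \<le> B)"
    if j: "j < ?k" for j
    using strict_majority[of "mset (C ! j)" B] clus_PP[OF C j] mcost_le_lcost[OF C j] B s size[OF j] by auto
  then obtain m where m: "\<forall>j<?k. m j \<in> PP \<and> s \<le> count (mset (C ! j)) (m j) + B \<and>
      (\<forall>y. y \<noteq> m j \<longrightarrow> count (mset (C ! j)) y \<le> B)" by metis
  have cnt: "count M x = (\<Sum>j<?k. count (mset (C ! j)) x)" for x
    using C(1) by (simp add: clus_def flip: count_concat_nth)
  have cnt_ge: "count (mset (C ! j)) x \<le> count M x" if "j < ?k" for j x
    unfolding cnt using that by (intro member_le_sum) auto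
  have inj: "inj_on m {..<?k}"
  proof (rule inj_onI, rule ccontr)
    fix i j assume ij: "i \<in> {..<?k}" "j \<in> {..<?k}" "m i = m j" "i \<noteq> j"
    have "(\<Sum>l\<in>{i, j}. count (mset (C ! l)) (m i)) \<le> count M (m i)"
      unfolding cnt using ij by (intro sum_mono2) auto
    then have "count (mset (C ! i)) (m i) + count (mset (C ! j)) (m j) \<le> count M (m i)" using ij by simp
    moreover have "s \<le> count (mset (C ! i)) (m i) + B" "s \<le> count (mset (C ! j)) (m j) + B" using m ij by auto
    ultimately show False using less[of "m i"] s by linarith
  qed
  have big: "s \<le> count M x + B" if x: "x \<in> m ` {..<?k}" for x
  proof -
    obtain j where j: "j < ?k" "x = m j" using x by auto
    then have "s \<le> count (mset (C ! j)) x + B" using m by auto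
    with cnt_ge[OF j(1), of x] show ?thesis by linarith
  qed
  have small: "count M x \<le> B" if x: "x \<notin> m ` {..<?k}" for x
  proof (cases "x \<in> PP")
    case True
    have "count (mset (C ! j)) x \<le> B" if "j < ?k" for j using m x that by blast
    then show ?thesis unfolding cnt
      using minority_total[OF C True B, of "{..<?k}"] s by fastforce
  next
    case False
    then have "x \<notin># M" using C(2) by blast
    then show ?thesis by (simp add: not_in_iff)
  qed
  have iff: "B < count M x \<longleftrightarrow> x \<in> m ` {..<?k}" for x
    using big[of x] small[of x] s by (cases "x \<in> m ` {..<?k}") linarith+
  then show ?thesis using inj m big by (intro exI[of _ m]) blast
qed

lemma count_sum_replicate:
  assumes "inj_on m {..<k :: nat}"
  shows "count (\<Sum>j<k. replicate_mset t (m j)) x = (if x \<in> m ` {..<k} then t else 0)"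
proof -
  have "count (\<Sum>j<k. replicate_mset t (m j)) x = (\<Sum>j<k. if m j = x then t else 0)"
    by (simp add: count_sum eq_commute[of x] cong: if_cong)
  also have "\<dots> = (\<Sum>y\<in>m ` {..<k}. if y = x then t else 0)"
    by (rule sum.reindex[OF assms, symmetric, unfolded comp_def])
  also have "\<dots> = (if x \<in> m ` {..<k} then t else 0)" by (rule sum.delta) simp
  finally show ?thesis .
qed

lemma trim_forward:
  assumes C: "clus s M C" "set_mset M \<subseteq> PP" and B: "lcost C \<le> real B"
    and s: "2 * B + 2 \<le> s" and less: "\<And>x. count M x < s"
    and t: "t = s - (2 * B + 2)"
    and M': "\<And>x. count M' x = count M x - (if B < count M x then t else 0)"
  shows "\<exists>C'. clus (s - t) M' C' \<and> length C' = length C \<and> lcost C' \<le> lcost C"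
    "\<And>x. B < count M x \<Longrightarrow> t + B < count M x"
proof -
  let ?k = "length C"
  from majority_structure[OF C B s less] obtain m where m: "inj_on m {..<?k}"
    "\<forall>j<?k. m j \<in> PP \<and> s \<le> count (mset (C ! j)) (m j) + B \<and> (\<forall>y. y \<noteq> m j \<longrightarrow> count (mset (C ! j)) y \<le> B)"
    "\<forall>x. B < count M x \<longleftrightarrow> x \<in> m ` {..<?k}" "\<forall>x. B < count M x \<longrightarrow> s \<le> count M x + B"
    by blast
  show "t + B < count M x" if "B < count M x" for x using m(4) that t s by force
  define D where "D j = mset (C ! j) - replicate_mset t (m j)" for j
  have sub: "replicate_mset t (m j) \<subseteq># mset (C ! j)" if "j < ?k" for j
  proof -
    have "t \<le> count (mset (C ! j)) (m j)" using m(2) that t s by force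
    then show ?thesis by (simp add: count_le_replicate_mset_subset_eq)
  qed
  have D: "mset (C ! j) = D j + replicate_mset t (m j)" if "j < ?k" for j
    using sub[OF that] by (simp add: D_def)
  have "\<exists>l. mset l = D j" for j by (rule ex_mset)
  then obtain L where L: "mset (L j) = D j" for j by metis
  let ?C = "map L [0..<?k]"
  have "M = (\<Sum>j<?k. D j + replicate_mset t (m j))"
    using C(1) D by (simp add: clus_def flip: mset_concat_nth) (simp add: mset_concat_nth)
  then have M: "M = (\<Sum>j<?k. D j) + (\<Sum>j<?k. replicate_mset t (m j))" by (simp add: sum.distrib)
  have "mset (concat ?C) = (\<Sum>j<?k. D j)"
    by (simp add: mset_concat_nth L)
  also have "\<dots> = M'"
  proof (rule multiset_eqI)
    fix x
    have "count M x = count (\<Sum>j<?k. D j) x + (if x \<in> m ` {..<?k} then t else 0)"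
      by (subst M) (simp add: count_sum_replicate[OF m(1)])
    moreover have "count M' x = count M x - (if x \<in> m ` {..<?k} then t else 0)"
      using m(3) M'[of x] by simp
    ultimately show "count (\<Sum>j<?k. D j) x = count M' x" by linarith
  qed
  finally have "mset (concat ?C) = M'" .
  moreover have "length (L j) = s - t" if "j < ?k" for j
  proof -
    have "length (L j) = size (D j)" by (metis L size_mset)
    also have "\<dots> = s - t"
      unfolding D_def using size_Diff_submset[OF sub[OF that]] C(1) that by (simp add: clus_def)
    finally show ?thesis .
  qed
  ultimately have 1: "clus (s - t) M' ?C" by (auto simp: clus_def)
  have "lcost ?C = (\<Sum>j<?k. mcost (D j))" by (simp add: lcost_nth L)
  also have "\<dots> \<le> (\<Sum>j<?k. mcost (mset (C ! j)))"
  proof (rule sum_mono)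
    fix j assume "j \<in> {..<?k}"
    then have j: "j < ?k" by simp
    have PP: "set_mset (mset (C ! j)) \<subseteq> PP" "m j \<in> PP" using clus_PP[OF C j] m(2) j by auto
    have Dsub: "D j \<subseteq># mset (C ! j)" by (simp add: D_def)
    then have "mcost (D j) \<le> wsum (emb (m j)) (D j)"
      using PP(1) set_mset_mono[OF Dsub] emb(1)[OF PP(2)] by (intro mcost_le) auto
    also have "\<dots> \<le> wsum (emb (m j)) (mset (C ! j))" using Dsub PP emb(1) by (intro wsum_mono) auto
    also have "\<dots> = mcost (mset (C ! j))"
    proof (rule majority_mcost[symmetric, OF PP])
      have "size (mset (C ! j)) = s" using C(1) j by (auto simp: clus_def)
      moreover have "s \<le> count (mset (C ! j)) (m j) + B" using m(2) j by blast
      ultimately show "size (mset (C ! j)) \<le> 2 * count (mset (C ! j)) (m j)" using s by linarith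
    qed
    finally show "mcost (D j) \<le> mcost (mset (C ! j))" .
  qed
  also have "\<dots> = lcost C" by (simp add: lcost_nth)
  finally show "\<exists>C'. clus (s - t) M' C' \<and> length C' = ?k \<and> lcost C' \<le> lcost C"
    using 1 by (intro exI[of _ ?C]) simp
qed

lemma trim_backward:
  assumes C: "clus s M C" "set_mset M \<subseteq> PP" and B: "lcost C \<le> real B"
    and s: "2 * B + 2 \<le> s" and less: "\<And>x. count M x < s"
    and M': "\<And>x. count M' x = count M x + (if B < count M x then t else 0)"
    and w: "\<And>T x. T \<in> set C \<Longrightarrow> B < count (mset T) x \<Longrightarrow> (\<And>y. y \<noteq> x \<Longrightarrow> count (mset T) y \<le> B) \<Longrightarrow> w T = x"
  shows "clus (s + t) M' (map (\<lambda>T. T @ replicate t (w T)) C) \<and>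
    lcost (map (\<lambda>T. T @ replicate t (w T)) C) \<le> lcost C"
proof -
  let ?k = "length C" and ?C = "map (\<lambda>T. T @ replicate t (w T)) C"
  from majority_structure[OF C B s less] obtain m where m: "inj_on m {..<?k}"
    "\<forall>j<?k. m j \<in> PP \<and> s \<le> count (mset (C ! j)) (m j) + B \<and> (\<forall>y. y \<noteq> m j \<longrightarrow> count (mset (C ! j)) y \<le> B)"
    "\<forall>x. B < count M x \<longleftrightarrow> x \<in> m ` {..<?k}" by blast
  have wm: "w (C ! j) = m j" if "j < ?k" for j
  proof (rule w)
    show "C ! j \<in> set C" using that by simp
    show "B < count (mset (C ! j)) (m j)" using m(2) that s by force
    show "count (mset (C ! j)) y \<le> B" if "y \<noteq> m j" for y using m(2) \<open>j < ?k\<close> that by blast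
  qed
  have "mset (concat ?C) = (\<Sum>j<?k. mset (C ! j) + replicate_mset t (m j))"
    by (simp add: mset_concat_nth wm)
  also have "\<dots> = M + (\<Sum>j<?k. replicate_mset t (m j))"
    using C(1) by (simp add: sum.distrib clus_def mset_concat_nth)
  also have "\<dots> = M'"
    by (rule multiset_eqI) (use m(3) in \<open>simp add: M' count_sum_replicate[OF m(1)]\<close>)
  finally have 1: "clus (s + t) M' ?C" using C(1) by (auto simp: clus_def)
  have "lcost ?C = (\<Sum>j<?k. mcost (mset (C ! j) + replicate_mset t (m j)))"
    by (simp add: lcost_nth wm)
  also have "\<dots> \<le> (\<Sum>j<?k. mcost (mset (C ! j)))"
  proof (rule sum_mono)
    fix j assume "j \<in> {..<?k}"
    then have j: "j < ?k" by simp
    have PP: "set_mset (mset (C ! j)) \<subseteq> PP" "m j \<in> PP" using clus_PP[OF C j] m(2) j by auto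
    have "mcost (mset (C ! j) + replicate_mset t (m j)) \<le> wsum (emb (m j)) (mset (C ! j) + replicate_mset t (m j))"
      using PP emb(1) by (intro mcost_le) (auto split: if_splits)
    also have "\<dots> = wsum (emb (m j)) (mset (C ! j))"
      using emb(2)[OF PP(2)] by (simp add: wsum_def image_replicate_mset)
    also have "\<dots> = mcost (mset (C ! j))"
    proof (rule majority_mcost[symmetric, OF PP])
      have "size (mset (C ! j)) = s" using C(1) j by (auto simp: clus_def)
      moreover have "s \<le> count (mset (C ! j)) (m j) + B" using m(2) j by blast
      ultimately show "size (mset (C ! j)) \<le> 2 * count (mset (C ! j)) (m j)" using s by linarith
    qed
    finally show "mcost (mset (C ! j) + replicate_mset t (m j)) \<le> mcost (mset (C ! j))" .
  qed
  also have "\<dots> = lcost C" by (simp add: lcost_nth)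
  finally show ?thesis using 1 by simp
qed

end

section \<open>The norms\<close>

definition nrm :: "nat \<Rightarrow> nat \<Rightarrow> (nat \<Rightarrow> real) \<Rightarrow> real" where
  "nrm p d f = (if p = 0 then real (card {i. i < d \<and> f i \<noteq> 0}) else root p (\<Sum>i<d. \<bar>f i\<bar> ^ p))"

lemma length_vec_diff [simp]: "length (vec_diff c x) = min (length c) (length x)"
  by (simp add: vec_diff_def)

lemma lp_norm_nrm:
  assumes "length c = d" "length x = d"
  shows "lp_norm p (vec_diff c x) = nrm p d (\<lambda>i. c ! i - real_of_int (x ! i))"
proof -
  have nth: "vec_diff c x ! i = c ! i - real_of_int (x ! i)" if "i < d" for i
    using that assms by (simp add: vec_diff_def)
  have "{i. i < d \<and> vec_diff c x ! i \<noteq> 0} = {i. i < d \<and> c ! i - real_of_int (x ! i) \<noteq> 0}"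
    using nth by auto
  moreover have "(\<Sum>a\<leftarrow>vec_diff c x. \<bar>a\<bar> ^ p) = (\<Sum>i<d. \<bar>c ! i - real_of_int (x ! i)\<bar> ^ p)"
    using assms nth by (simp add: sum_list_sum_nth atLeast0LessThan)
  ultimately show ?thesis
    using assms by (simp add: lp_norm_def nrm_def length_filter_conv_card)
qed

lemma nrm_nonneg: "0 \<le> nrm p d f"
  by (auto simp: nrm_def intro!: real_root_ge_zero sum_nonneg)

lemma nrm_cong: "(\<And>i. i < d \<Longrightarrow> \<bar>f i\<bar> = \<bar>g i\<bar>) \<Longrightarrow> nrm p d f = nrm p d g"
proof -
  assume *: "\<And>i. i < d \<Longrightarrow> \<bar>f i\<bar> = \<bar>g i\<bar>"
  then have "(f i \<noteq> 0) = (g i \<noteq> 0)" if "i < d" for i using that by (metis abs_eq_0)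
  then have "{i. i < d \<and> f i \<noteq> 0} = {i. i < d \<and> g i \<noteq> 0}" by blast
  moreover have "(\<Sum>i<d. \<bar>f i\<bar> ^ p) = (\<Sum>i<d. \<bar>g i\<bar> ^ p)" using * by (intro sum.cong) auto
  ultimately show ?thesis by (simp only: nrm_def)
qed

lemma convex_pow:
  fixes u v x y :: real
  assumes "0 \<le> u" "0 \<le> v" "u + v = 1" "0 \<le> x" "0 \<le> y"
  shows "(u * x + v * y) ^ n \<le> u * x ^ n + v * y ^ n"
proof (induction n)
  case (Suc n)
  have "(u * x + v * y) ^ Suc n \<le> (u * x + v * y) * (u * x ^ n + v * y ^ n)"
    using Suc assms by (simp add: mult_left_mono)
  also have "\<dots> = u * (u + v) * x ^ Suc n + v * (u + v) * y ^ Suc n - u * v * ((x - y) * (x ^ n - y ^ n))"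
    by (simp add: algebra_simps)
  also have "\<dots> \<le> u * x ^ Suc n + v * y ^ Suc n"
  proof -
    have "0 \<le> (x - y) * (x ^ n - y ^ n)"
    proof (cases "x \<le> y")
      case True
      then have "x ^ n \<le> y ^ n" using assms by (intro power_mono)
      with True show ?thesis by (simp add: mult_nonpos_nonpos)
    next
      case False
      then have "y ^ n \<le> x ^ n" using assms by (intro power_mono) auto
      with False show ?thesis by simp
    qed
    then have "0 \<le> u * v * ((x - y) * (x ^ n - y ^ n))" using assms by simp
    then show ?thesis using assms(3) by simp
  qed
  finally show ?case .
qed (use assms in simp)

lemma nrm_triangle: "nrm p d (\<lambda>i. f i + g i) \<le> nrm p d f + nrm p d g"
proof (cases "p = 0")
  case True
  have "card {i. i < d \<and> f i + g i \<noteq> 0} \<le> card ({i. i < d \<and> f i \<noteq> 0} \<union> {i. i < d \<and> g i \<noteq> 0})"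
    by (intro card_mono) auto
  also have "\<dots> \<le> card {i. i < d \<and> f i \<noteq> 0} + card {i. i < d \<and> g i \<noteq> 0}" by (rule card_Un_le)
  finally show ?thesis using True by (simp add: nrm_def)
next
  case False
  then have p: "p > 0" by simp
  let ?S = "\<lambda>f. \<Sum>i<d. \<bar>f i\<bar> ^ p"
  have S0: "0 \<le> ?S f" for f :: "nat \<Rightarrow> real" by (intro sum_nonneg) auto
  have zero: "nrm p d (\<lambda>i. f i + g i) \<le> nrm p d f + nrm p d g" if "nrm p d f = 0" for f g
  proof -
    have "?S f = 0" using that p S0[of f] by (simp add: nrm_def)
    then have "\<forall>i<d. \<bar>f i\<bar> ^ p = 0" by (subst (asm) sum_nonneg_eq_0_iff) auto
    then have "nrm p d (\<lambda>i. f i + g i) = nrm p d g" by (intro nrm_cong) auto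
    then show ?thesis using nrm_nonneg[of p d f] by simp
  qed
  define \<alpha> \<beta> where "\<alpha> = nrm p d f" and "\<beta> = nrm p d g"
  show ?thesis
  proof (cases "\<alpha> = 0 \<or> \<beta> = 0")
    case True
    then show ?thesis using zero[of f g] zero[of g f] by (auto simp: \<alpha>_def \<beta>_def add.commute)
  next
    case False
    then have pos: "\<alpha> > 0" "\<beta> > 0"
      using nrm_nonneg[of p d f] nrm_nonneg[of p d g] by (auto simp: \<alpha>_def \<beta>_def)
    have pow: "\<alpha> ^ p = ?S f" "\<beta> ^ p = ?S g"
      using p S0 by (simp_all add: \<alpha>_def \<beta>_def nrm_def real_root_pow_pos2)
    let ?u = "\<alpha> / (\<alpha> + \<beta>)" and ?v = "\<beta> / (\<alpha> + \<beta>)"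
    have "\<alpha> + \<beta> \<noteq> 0" using pos by simp
    have uv: "?u + ?v = 1" using pos by (simp add: add_divide_distrib[symmetric])
    have "?S (\<lambda>i. f i + g i) \<le> (\<Sum>i<d. (\<alpha> + \<beta>) ^ p * (?u * (\<bar>f i\<bar> / \<alpha>) ^ p + ?v * (\<bar>g i\<bar> / \<beta>) ^ p))"
    proof (rule sum_mono)
      fix i
      have "\<bar>f i + g i\<bar> ^ p \<le> (\<bar>f i\<bar> + \<bar>g i\<bar>) ^ p" by (intro power_mono) auto
      also have "\<bar>f i\<bar> + \<bar>g i\<bar> = (\<alpha> + \<beta>) * (?u * (\<bar>f i\<bar> / \<alpha>) + ?v * (\<bar>g i\<bar> / \<beta>))"
        using pos \<open>\<alpha> + \<beta> \<noteq> 0\<close> by (simp add: distrib_left)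
      also have "\<dots> ^ p = (\<alpha> + \<beta>) ^ p * (?u * (\<bar>f i\<bar> / \<alpha>) + ?v * (\<bar>g i\<bar> / \<beta>)) ^ p"
        by (rule power_mult_distrib)
      also have "\<dots> \<le> (\<alpha> + \<beta>) ^ p * (?u * (\<bar>f i\<bar> / \<alpha>) ^ p + ?v * (\<bar>g i\<bar> / \<beta>) ^ p)"
        using pos uv by (intro mult_left_mono convex_pow) auto
      finally show "\<bar>f i + g i\<bar> ^ p \<le> \<dots>" .
    qed
    also have "\<dots> = (\<alpha> + \<beta>) ^ p * (?u * (\<Sum>i<d. (\<bar>f i\<bar> / \<alpha>) ^ p) + ?v * (\<Sum>i<d. (\<bar>g i\<bar> / \<beta>) ^ p))"
      by (simp only: sum_distrib_left[symmetric] sum.distrib)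
    also have "(\<Sum>i<d. (\<bar>f i\<bar> / \<alpha>) ^ p) = 1"
    proof -
      have "(\<Sum>i<d. (\<bar>f i\<bar> / \<alpha>) ^ p) = ?S f / \<alpha> ^ p" by (simp add: power_divide sum_divide_distrib)
      then show ?thesis unfolding pow(1)[symmetric] using pos by simp
    qed
    also have "(\<Sum>i<d. (\<bar>g i\<bar> / \<beta>) ^ p) = 1"
    proof -
      have "(\<Sum>i<d. (\<bar>g i\<bar> / \<beta>) ^ p) = ?S g / \<beta> ^ p" by (simp add: power_divide sum_divide_distrib)
      then show ?thesis unfolding pow(2)[symmetric] using pos by simp
    qed
    finally have "?S (\<lambda>i. f i + g i) \<le> (\<alpha> + \<beta>) ^ p" using uv by simp
    then have "root p (?S (\<lambda>i. f i + g i)) \<le> root p ((\<alpha> + \<beta>) ^ p)" using p by simp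
    also have "\<dots> = \<alpha> + \<beta>" using p pos by (simp add: real_root_power_cancel)
    finally show ?thesis using p by (simp add: nrm_def[of p d "\<lambda>i. f i + g i"] \<alpha>_def \<beta>_def)
  qed
qed

lemma abs_le_nrm:
  assumes "p > 0" "i < d"
  shows "\<bar>f i\<bar> \<le> nrm p d f"
proof -
  have "\<bar>f i\<bar> ^ p \<le> (\<Sum>i<d. \<bar>f i\<bar> ^ p)" 
    using member_le_sum[of i "{..<d}" "\<lambda>i. \<bar>f i\<bar> ^ p"] assms(2) by simp
  then have "root p (\<bar>f i\<bar> ^ p) \<le> root p (\<Sum>i<d. \<bar>f i\<bar> ^ p)" using assms by simp
  then show ?thesis using assms by (simp add: nrm_def real_root_power_cancel)
qed

lemma card_le_nrm:
  assumes "p > 0" "\<And>i. i < d \<Longrightarrow> f i \<noteq> 0 \<Longrightarrow> 1 \<le> \<bar>f i\<bar>"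
  shows "real (card {i. i < d \<and> f i \<noteq> 0}) \<le> nrm p d f ^ p"
proof -
  have "real (card {i. i < d \<and> f i \<noteq> 0}) = (\<Sum>i\<in>{i. i < d \<and> f i \<noteq> 0}. 1)" by simp
  also have "\<dots> \<le> (\<Sum>i\<in>{i. i < d \<and> f i \<noteq> 0}. \<bar>f i\<bar> ^ p)"
    using assms(2) by (intro sum_mono one_le_power) auto
  also have "\<dots> \<le> (\<Sum>i<d. \<bar>f i\<bar> ^ p)" by (intro sum_mono2) auto
  also have "\<dots> = nrm p d f ^ p"
    using assms(1) by (simp add: nrm_def real_root_pow_pos2 sum_nonneg)
  finally show ?thesis .
qed

lemma point_dist_int: "real_of_int a - real_of_int b \<noteq> 0 \<Longrightarrow> 1 \<le> \<bar>real_of_int a - real_of_int b\<bar>"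
  by (simp flip: of_int_diff of_int_abs)

lemma nrm_le_imp_close:
  assumes "nrm p d (\<lambda>i. real_of_int (x ! i) - real_of_int (y ! i)) \<le> real B"
  shows "card {i. i < d \<and> x ! i \<noteq> y ! i} \<le> B ^ max p 1"
    and "p > 0 \<Longrightarrow> i < d \<Longrightarrow> \<bar>x ! i - y ! i\<bar> \<le> int B"
proof -
  let ?f = "\<lambda>i. real_of_int (x ! i) - real_of_int (y ! i)"
  have eq: "{i. i < d \<and> ?f i \<noteq> 0} = {i. i < d \<and> x ! i \<noteq> y ! i}" by auto
  show "card {i. i < d \<and> x ! i \<noteq> y ! i} \<le> B ^ max p 1"
  proof (cases "p = 0")
    case True
    then show ?thesis using assms by (simp add: nrm_def)
  next
    case False
    then have "real (card {i. i < d \<and> ?f i \<noteq> 0}) \<le> nrm p d ?f ^ p"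
      by (intro card_le_nrm point_dist_int) auto
    also have "\<dots> \<le> real B ^ p" using assms nrm_nonneg by (intro power_mono)
    finally have "real (card {i. i < d \<and> x ! i \<noteq> y ! i}) \<le> real (B ^ p)" unfolding eq by simp
    moreover have "max p 1 = p" using False by simp
    ultimately show ?thesis by (simp only: of_nat_le_iff)
  qed
  show "\<bar>x ! i - y ! i\<bar> \<le> int B" if "p > 0" "i < d"
  proof -
    have "\<bar>?f i\<bar> \<le> real B" using abs_le_nrm[OF that, of ?f] assms by simp
    then show ?thesis by linarith
  qed
qed

lemma far_imp_nrm_ge:
  assumes "p = 0 \<Longrightarrow> B < card {i. i < d \<and> x ! i \<noteq> y ! i}"
    and "p > 0 \<Longrightarrow> \<exists>i<d. int B < \<bar>x ! i - y ! i\<bar>"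
  shows "real B + 1 \<le> nrm p d (\<lambda>i. real_of_int (x ! i) - real_of_int (y ! i))"
proof (cases "p = 0")
  case True
  then have "B + 1 \<le> card {i. i < d \<and> x ! i \<noteq> y ! i}" using assms(1) by simp
  then have "real (B + 1) \<le> real (card {i. i < d \<and> x ! i \<noteq> y ! i})" by (simp only: of_nat_le_iff)
  then show ?thesis using True by (simp add: nrm_def)
next
  case False
  then obtain i where i: "i < d" "int B < \<bar>x ! i - y ! i\<bar>" using assms(2) by blast
  then have "real B + 1 \<le> \<bar>real_of_int (x ! i) - real_of_int (y ! i)\<bar>" by linarith
  also have "\<dots> \<le> nrm p d (\<lambda>i. real_of_int (x ! i) - real_of_int (y ! i))"
    using abs_le_nrm[of p i d "\<lambda>i. real_of_int (x ! i) - real_of_int (y ! i)"] False i(1) by simp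
  finally show ?thesis .
qed

interpretation lp: center_metric "{c :: real list. length c = d}" "{x :: point. length x = d}"
  "\<lambda>c x. lp_norm p (vec_diff c x)" "map real_of_int" for p d
proof
  fix c c' :: "real list" and x y z :: point
  have diff: "nrm p d (\<lambda>i. a ! i - b ! i) \<le> nrm p d (\<lambda>i. e ! i - b ! i) + nrm p d (\<lambda>i. e ! i - a ! i)"
    for a b e :: "real list"
  proof -
    have "nrm p d (\<lambda>i. a ! i - b ! i) = nrm p d (\<lambda>i. (e ! i - b ! i) + (a ! i - e ! i))" by (simp add: algebra_simps)
    also have "\<dots> \<le> nrm p d (\<lambda>i. e ! i - b ! i) + nrm p d (\<lambda>i. a ! i - e ! i)" by (rule nrm_triangle)
    also have "nrm p d (\<lambda>i. a ! i - e ! i) = nrm p d (\<lambda>i. e ! i - a ! i)"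
      by (rule nrm_cong) (rule abs_minus_commute)
    finally show ?thesis .
  qed
  have \<delta>: "lp_norm p (vec_diff c x) = nrm p d (\<lambda>i. c ! i - map real_of_int x ! i)"
    if "length c = d" "length x = d" for c x
    using that unfolding lp_norm_nrm[OF that] by (intro nrm_cong) simp
  show "0 \<le> lp_norm p (vec_diff c x)" if "c \<in> {c. length c = d}" "x \<in> {x. length x = d}"
    using that by (simp add: \<delta> nrm_nonneg)
  show "map real_of_int x \<in> {c. length c = d}" if "x \<in> {x. length x = d}" using that by simp
  show "lp_norm p (vec_diff (map real_of_int x) x) = 0" if "x \<in> {x. length x = d}"
    using that by (simp add: \<delta>) (simp add: nrm_def)
  show "{c :: real list. length c = d} \<noteq> {}" by (simp add: Ex_list_of_length)
  show "lp_norm p (vec_diff c' z) \<le> lp_norm p (vec_diff c z) + lp_norm p (vec_diff c x) + lp_norm p (vec_diff c' x)"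
    if c: "c \<in> {c. length c = d}" and c': "c' \<in> {c. length c = d}" and x: "x \<in> {x. length x = d}" and z: "z \<in> {x. length x = d}"
  proof -
    let ?x = "map real_of_int x" and ?z = "map real_of_int z"
    have "nrm p d (\<lambda>i. c' ! i - ?z ! i) \<le> nrm p d (\<lambda>i. c ! i - ?z ! i) + nrm p d (\<lambda>i. c ! i - c' ! i)"
      by (rule diff)
    also have "nrm p d (\<lambda>i. c ! i - c' ! i) = nrm p d (\<lambda>i. (c ! i - ?x ! i) + (?x ! i - c' ! i))" by simp
    also have "\<dots> \<le> nrm p d (\<lambda>i. c ! i - ?x ! i) + nrm p d (\<lambda>i. ?x ! i - c' ! i)" by (rule nrm_triangle)
    also have "nrm p d (\<lambda>i. ?x ! i - c' ! i) = nrm p d (\<lambda>i. c' ! i - ?x ! i)"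
      by (rule nrm_cong) (rule abs_minus_commute)
    finally show ?thesis using c c' x z by (simp add: \<delta>)
  qed
  show "1 \<le> lp_norm p (vec_diff c x) + lp_norm p (vec_diff c y)"
    if c: "c \<in> {c. length c = d}" and x: "x \<in> {x. length x = d}" and y: "y \<in> {x. length x = d}" and ne: "x \<noteq> y"
  proof -
    have "\<not> (\<forall>i<d. x ! i = y ! i)" using nth_equalityI[of x y] x y ne by auto
    then obtain i where i: "i < d" "x ! i \<noteq> y ! i" by blast
    have "real 0 + 1 \<le> nrm p d (\<lambda>i. real_of_int (x ! i) - real_of_int (y ! i))"
    proof (rule far_imp_nrm_ge)
      have "{i} \<subseteq> {i. i < d \<and> x ! i \<noteq> y ! i}" using i by simp
      then have "card {i} \<le> card {i. i < d \<and> x ! i \<noteq> y ! i}" by (intro card_mono) simp_all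
      then show "0 < card {i. i < d \<and> x ! i \<noteq> y ! i}" by simp
      show "\<exists>i<d. int 0 < \<bar>x ! i - y ! i\<bar>" using i by (intro exI[of _ i]) simp
    qed
    also have "nrm p d (\<lambda>i. real_of_int (x ! i) - real_of_int (y ! i)) =
        nrm p d (\<lambda>i. map real_of_int x ! i - map real_of_int y ! i)"
      using x y by (intro nrm_cong) simp
    also have "\<dots> \<le> nrm p d (\<lambda>i. c ! i - map real_of_int y ! i) + nrm p d (\<lambda>i. c ! i - map real_of_int x ! i)"
      by (rule diff)
    finally show ?thesis using c x y by (simp add: \<delta>)
  qed
qed

lemma cost_eq_mcost: "cost p d T = lp.mcost d p T"
  by (simp add: cost_def lp.mcost_def lp.wsum_def)

section \<open>The kernelization algorithm\<close>

type_synonym inst = "(point list \<times> nat) \<times> nat"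

abbreviation pts :: "inst \<Rightarrow> point list" where "pts J \<equiv> fst (fst J)"
abbreviation numk :: "inst \<Rightarrow> nat" where "numk J \<equiv> snd (fst J)"
abbreviation budget :: "inst \<Rightarrow> nat" where "budget J \<equiv> snd J"

definition dimn :: "inst \<Rightarrow> nat" where
  "dimn J = length (hdd [] (pts J))"

text \<open>The budget and \<open>k\<close> are binary; in unary they have to be capped.\<close>

definition bnd :: "inst \<Rightarrow> nat" where
  "bnd J = min (length (pts J) + dimn J) (budget J)"

definition knum :: "inst \<Rightarrow> nat" where
  "knum J = min (length (pts J)) (numk J)"

definition chunk_step :: "nat \<Rightarrow> 'a \<Rightarrow> 'a list \<times> 'a list list \<Rightarrow> 'a list \<times> 'a list list" where
  "chunk_step s y a =
     (if Suc (length (fst a)) = s then ([], (y # fst a) # snd a) else (y # fst a, snd a))"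

definition chunk :: "nat \<Rightarrow> 'a list \<Rightarrow> 'a list \<times> 'a list list" where
  "chunk s l = fold (chunk_step s) l ([], [])"

text \<open>The cluster size \<open>n / k\<close>, counted as the number of blocks of \<open>k\<close> points.\<close>

definition csize :: "inst \<Rightarrow> nat" where
  "csize J = length (snd (chunk (knum J) (pts J)))"

definition grp :: "inst \<Rightarrow> point \<Rightarrow> point list \<times> point list list" where
  "grp J x = chunk (csize J) (filter (\<lambda>y. y = x) (pts J))"

definition homog :: "inst \<Rightarrow> point list list" where
  "homog J = concat (map (\<lambda>x. snd (grp J x)) (remdups (pts J)))"

definition resid :: "inst \<Rightarrow> point list list" where
  "resid J = filter (\<lambda>g. g \<noteq> []) (map (\<lambda>x. fst (grp J x)) (remdups (pts J)))"

definition tnum :: "inst \<Rightarrow> nat" where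
  "tnum J = csize J - (2 * bnd J + 2)"

definition trimmed :: "inst \<Rightarrow> point list list" where
  "trimmed J = map (\<lambda>g. if bnd J < length g then drop (tnum J) g else g) (resid J)"

definition kres :: "inst \<Rightarrow> nat" where
  "kres J = length (snd (chunk (csize J) (concat (resid J))))"

definition good :: "inst \<Rightarrow> bool" where
  "good J \<longleftrightarrow> resid J \<noteq> [] \<and> length (resid J) \<le> 2 * bnd J \<and>
     length (concat (trimmed J)) = kres J * (csize J - tnum J)"

definition reps :: "inst \<Rightarrow> point list" where
  "reps J = map (hdd []) (resid J)"

definition nthz :: "point \<Rightarrow> nat \<Rightarrow> int" where
  "nthz x j = hdd 0 (drop j x)"

definition close :: "nat \<Rightarrow> inst \<Rightarrow> point \<Rightarrow> point \<Rightarrow> bool" where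
  "close p J x y \<longleftrightarrow>
     length (filter (\<lambda>j. nthz x j \<noteq> nthz y j) [0..<dimn J]) \<le> bnd J ^ max p 1 \<and>
     (p = 0 \<or> (\<forall>j\<in>set [0..<dimn J]. nat \<bar>nthz x j - nthz y j\<bar> \<le> budget J))"

definition merge :: "nat \<Rightarrow> inst \<Rightarrow> point \<Rightarrow> point list list \<Rightarrow> point list list" where
  "merge p J x Cs =
     (x # concat (filter (\<lambda>c. \<exists>y\<in>set c. close p J x y) Cs)) #
     filter (\<lambda>c. \<not> (\<exists>y\<in>set c. close p J x y)) Cs"

definition comps :: "nat \<Rightarrow> inst \<Rightarrow> point list list" where
  "comps p J = fold (merge p J) (reps J) []"

definition cof :: "nat \<Rightarrow> inst \<Rightarrow> point \<Rightarrow> point list" where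
  "cof p J x = hdd [] (filter (\<lambda>c. x \<in> set c) (comps p J))"

text \<open>
  For \<open>p = 0\<close> only equality of coordinates matters, so a coordinate may be replaced by minus
  the index of the first point of the component that agrees in it.
\<close>

definition coord :: "nat \<Rightarrow> inst \<Rightarrow> point \<Rightarrow> nat \<Rightarrow> int" where
  "coord p J x j =
     (if p = 0 then slot 1 (map (\<lambda>z. nthz z j = nthz x j) (cof p J x))
      else nthz x j - nthz (hdd [] (cof p J x)) j)"

definition varying :: "nat \<Rightarrow> inst \<Rightarrow> nat list" where
  "varying p J = filter (\<lambda>j. \<exists>x\<in>set (reps J). coord p J x j \<noteq> 0) [0..<dimn J]"

text \<open>
  Different components get values more than the budget apart. For \<open>p = 0\<close> a single such coordinate
  contributes only \<open>1\<close> to a distance, hence the repetition in \<open>compress\<close>.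
\<close>

definition separator :: "nat \<Rightarrow> inst \<Rightarrow> point \<Rightarrow> int" where
  "separator p J x = slot (int (budget J + 1)) (map (\<lambda>c. x \<in> set c) (comps p J))"

definition compress :: "nat \<Rightarrow> inst \<Rightarrow> point \<Rightarrow> point" where
  "compress p J x = map (coord p J x) (varying p J) @ replicate (Suc (bnd J)) (separator p J x)"

definition kernelize :: "nat \<Rightarrow> inst \<Rightarrow> inst" where
  "kernelize p J =
     (if good J then ((map (compress p J) (concat (trimmed J)), kres J), budget J) else (([[0]], 1), 0))"

definition expand :: "nat \<Rightarrow> inst \<Rightarrow> point \<Rightarrow> point" where
  "expand p J y = hdd [] (filter (\<lambda>x. compress p J x = y) (reps J))"

definition majority :: "inst \<Rightarrow> point list \<Rightarrow> point" where
  "majority J T = hdd [] (filter (\<lambda>x. bnd J < length (filter (\<lambda>y. y = x) T)) T)"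

definition grow :: "inst \<Rightarrow> point list \<Rightarrow> point list" where
  "grow J T = T @ replicate (tnum J) (majority J T)"

definition cand :: "nat \<Rightarrow> inst \<Rightarrow> point list list \<Rightarrow> point list list" where
  "cand p J C = homog J @ map (\<lambda>T. grow J (map (expand p J) T)) C"

definition valid :: "inst \<Rightarrow> point list list \<Rightarrow> bool" where
  "valid J C \<longleftrightarrow> length C = knum J \<and> (\<forall>T\<in>set C. length T = csize J) \<and>
     (\<forall>x\<in>set (pts J). length (filter (\<lambda>y. y = x) (concat C)) = length (filter (\<lambda>y. y = x) (pts J)))"

definition lift_sol :: "nat \<Rightarrow> inst \<times> inst \<times> point list list \<Rightarrow> point list list" where
  "lift_sol p z =
     (if valid (fst z) (cand p (fst z) (snd (snd z))) then cand p (fst z) (snd (snd z))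
      else snd (chunk (csize (fst z)) (pts (fst z))))"

subsection \<open>Running time\<close>

declare pt_add_nat [pt_intros del] pt_minus_nat [pt_intros del] pt_le_nat [pt_intros del]

abbreviation enc_pt :: "point \<Rightarrow> tree" where "enc_pt \<equiv> enc_list enc_int"
abbreviation enc_pts :: "point list \<Rightarrow> tree" where "enc_pts \<equiv> enc_list enc_pt"
abbreviation enc_clu :: "point list list \<Rightarrow> tree" where "enc_clu \<equiv> enc_list enc_pts"
abbreviation ei :: "inst \<Rightarrow> tree" where "ei \<equiv> enc_prod (enc_prod enc_pts enc_nat) enc_nat"

lemma pt_comp2:
  assumes "ptime (enc_prod e1 e2) e3 (\<lambda>z. h (fst z) (snd z))" "ptime e e1 f" "ptime e e2 g"
  shows "ptime e e3 (\<lambda>z. h (f z) (g z))"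
  using pt_comp[OF pt_Pair[OF assms(2,3)] assms(1)] by simp

lemma pt_comp3:
  assumes "ptime (enc_prod e1 (enc_prod e2 e3)) e4 (\<lambda>z. h (fst z) (fst (snd z)) (snd (snd z)))"
    "ptime e e1 f" "ptime e e2 g" "ptime e e3 k"
  shows "ptime e e4 (\<lambda>z. h (f z) (g z) (k z))"
  using pt_comp[OF pt_Pair[OF assms(2) pt_Pair[OF assms(3,4)]] assms(1)] by simp

lemma pt_dimn0: "ptime ei enc_un (\<lambda>J. dimn J)"
  unfolding dimn_def by (rule pt_intros)+
lemmas pt_dimn [pt_intros] = pt_comp[OF _ pt_dimn0]

lemma pt_bnd0: "ptime ei enc_un (\<lambda>J. bnd J)"
  unfolding bnd_def by (rule pt_min_nat pt_intros)+
lemmas pt_bnd [pt_intros] = pt_comp[OF _ pt_bnd0]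

lemma pt_knum0: "ptime ei enc_un (\<lambda>J. knum J)"
  unfolding knum_def by (rule pt_min_nat pt_intros)+
lemmas pt_knum [pt_intros] = pt_comp[OF _ pt_knum0]

lemma pt_chunk_step:
  assumes "ptime e enc_un s" "ptime e e1 y" "ptime e (enc_prod (enc_list e1) (enc_list (enc_list e1))) a"
  shows "ptime e (enc_prod (enc_list e1) (enc_list (enc_list e1))) (\<lambda>z. chunk_step (s z) (y z) (a z))"
  unfolding chunk_step_def by (rule assms pt_intros)+

lemma pt_chunk [pt_intros]:
  assumes "ptime e enc_un s" "ptime e (enc_list e1) l"
  shows "ptime e (enc_prod (enc_list e1) (enc_list (enc_list e1))) (\<lambda>z. chunk (s z) (l z))"
  unfolding chunk_def
proof (rule pt_fold[OF assms(2) pt_const, where q = "[:3, 1:]"])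
  show "ptime (enc_prod e (enc_prod e1 (enc_prod (enc_list e1) (enc_list (enc_list e1)))))
     (enc_prod (enc_list e1) (enc_list (enc_list e1))) (\<lambda>z. chunk_step (s (fst z)) (fst (snd z)) (snd (snd z)))"
    by (rule pt_chunk_step pt_comp[OF _ assms(1)] pt_intros)+
  show "size (enc_prod (enc_list e1) (enc_list (enc_list e1)) (chunk_step (s x) y a))
     \<le> size (enc_prod (enc_list e1) (enc_list (enc_list e1)) a) + poly [:3, 1:] (size (e x) + size (e1 y))" for x y a
    by (auto simp: chunk_step_def enc_prod_def)
qed

lemma pt_csize0: "ptime ei enc_un (\<lambda>J. csize J)"
  unfolding csize_def by (rule pt_intros)+
lemmas pt_csize [pt_intros] = pt_comp[OF _ pt_csize0]

lemma pt_grp0: "ptime (enc_prod ei enc_pt) (enc_prod enc_pts enc_clu) (\<lambda>z. grp (fst z) (snd z))"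
  unfolding grp_def by (rule pt_intros)+
lemmas pt_grp [pt_intros] = pt_comp2[OF pt_grp0]

lemma pt_homog0: "ptime ei enc_clu (\<lambda>J. homog J)"
  unfolding homog_def by (rule pt_intros)+
lemmas pt_homog [pt_intros] = pt_comp[OF _ pt_homog0]

lemma pt_resid0: "ptime ei enc_clu (\<lambda>J. resid J)"
  unfolding resid_def by (rule pt_intros)+
lemmas pt_resid [pt_intros] = pt_comp[OF _ pt_resid0]

lemma pt_tnum0: "ptime ei enc_un (\<lambda>J. tnum J)"
  unfolding tnum_def by (rule pt_intros)+
lemmas pt_tnum [pt_intros] = pt_comp[OF _ pt_tnum0]

lemma pt_trimmed0: "ptime ei enc_clu (\<lambda>J. trimmed J)"
  unfolding trimmed_def by (rule pt_intros)+
lemmas pt_trimmed [pt_intros] = pt_comp[OF _ pt_trimmed0]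

lemma pt_kres0: "ptime ei enc_un (\<lambda>J. kres J)"
  unfolding kres_def by (rule pt_intros)+
lemmas pt_kres [pt_intros] = pt_comp[OF _ pt_kres0]

lemma pt_good0: "ptime ei enc_bool (\<lambda>J. good J)"
  unfolding good_def by (rule pt_intros)+
lemmas pt_good [pt_intros] = pt_comp[OF _ pt_good0]

lemma pt_reps0: "ptime ei enc_pts (\<lambda>J. reps J)"
  unfolding reps_def by (rule pt_intros)+
lemmas pt_reps [pt_intros] = pt_comp[OF _ pt_reps0]

lemma pt_nthz0: "ptime (enc_prod enc_pt enc_un) enc_int (\<lambda>z. nthz (fst z) (snd z))"
  unfolding nthz_def by (rule pt_intros)+
lemmas pt_nthz [pt_intros] = pt_comp2[OF pt_nthz0]

lemma pt_close0: "ptime (enc_prod ei (enc_prod enc_pt enc_pt)) enc_bool (\<lambda>z. close p (fst z) (fst (snd z)) (snd (snd z)))"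
  unfolding close_def by (rule pt_le_nat[OF pt_abs] pt_intros)+
lemmas pt_close [pt_intros] = pt_comp3[OF pt_close0]

lemma pt_merge0: "ptime (enc_prod ei (enc_prod enc_pt enc_clu)) enc_clu (\<lambda>z. merge p (fst z) (fst (snd z)) (snd (snd z)))"
  unfolding merge_def by (rule pt_intros)+

lemma size_concat_filter:
  "size (enc_list e (concat (filter P l))) + size (enc_list (enc_list e) (filter (\<lambda>c. \<not> P c) l))
    \<le> size (enc_list (enc_list e) l)"
  by (induction l) auto

lemma pt_comps0: "ptime ei enc_clu (\<lambda>J. comps p J)"
  unfolding comps_def
proof (rule pt_fold[OF pt_reps0 pt_const pt_merge0, where q = "[:2, 1:]"])
  show "size (enc_clu (merge p x y a)) \<le> size (enc_clu a) + poly [:2, 1:] (size (ei x) + size (enc_pt y))" for x y a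
    using size_concat_filter[of enc_pt "\<lambda>c. \<exists>z\<in>set c. close p x y z" a] by (simp add: merge_def)
qed
lemmas pt_comps [pt_intros] = pt_comp[OF _ pt_comps0]

lemma pt_cof0: "ptime (enc_prod ei enc_pt) enc_pts (\<lambda>z. cof p (fst z) (snd z))"
  unfolding cof_def by (rule pt_intros)+
lemmas pt_cof [pt_intros] = pt_comp2[OF pt_cof0]

lemma pt_coord0: "ptime (enc_prod ei (enc_prod enc_pt enc_un)) enc_int (\<lambda>z. coord p (fst z) (fst (snd z)) (snd (snd z)))"
  unfolding coord_def by (rule pt_intros)+
lemmas pt_coord [pt_intros] = pt_comp3[OF pt_coord0]

lemma pt_varying0: "ptime ei (enc_list enc_un) (\<lambda>J. varying p J)"
  unfolding varying_def by (rule pt_intros)+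
lemmas pt_varying [pt_intros] = pt_comp[OF _ pt_varying0]

lemma pt_separator0: "ptime (enc_prod ei enc_pt) enc_int (\<lambda>z. separator p (fst z) (snd z))"
  unfolding separator_def by (rule pt_int[OF pt_add_nat] pt_intros)+
lemmas pt_separator [pt_intros] = pt_comp2[OF pt_separator0]

lemma pt_compress0: "ptime (enc_prod ei enc_pt) enc_pt (\<lambda>z. compress p (fst z) (snd z))"
  unfolding compress_def by (rule pt_intros)+
lemmas pt_compress [pt_intros] = pt_comp2[OF pt_compress0]

lemma pt_kernel: "ptime ei ei (\<lambda>J. kernelize p J)"
  unfolding kernelize_def by (rule pt_un_to_nat[OF pt_kres] pt_intros)+

lemma pt_expand0: "ptime (enc_prod ei enc_pt) enc_pt (\<lambda>z. expand p (fst z) (snd z))"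
  unfolding expand_def by (rule pt_intros)+
lemmas pt_expand [pt_intros] = pt_comp2[OF pt_expand0]

lemma pt_majority0: "ptime (enc_prod ei enc_pts) enc_pt (\<lambda>z. majority (fst z) (snd z))"
  unfolding majority_def by (rule pt_intros)+
lemmas pt_majority [pt_intros] = pt_comp2[OF pt_majority0]

lemma pt_grow0: "ptime (enc_prod ei enc_pts) enc_pts (\<lambda>z. grow (fst z) (snd z))"
  unfolding grow_def by (rule pt_intros)+
lemmas pt_grow [pt_intros] = pt_comp2[OF pt_grow0]

lemma pt_cand0: "ptime (enc_prod ei enc_clu) enc_clu (\<lambda>z. cand p (fst z) (snd z))"
  unfolding cand_def by (rule pt_intros)+
lemmas pt_cand [pt_intros] = pt_comp2[OF pt_cand0]

lemma pt_valid0: "ptime (enc_prod ei enc_clu) enc_bool (\<lambda>z. valid (fst z) (snd z))"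
  unfolding valid_def by (rule pt_intros)+
lemmas pt_valid [pt_intros] = pt_comp2[OF pt_valid0]

lemma pt_lift_sol: "ptime (enc_prod ei (enc_prod ei enc_clu)) enc_clu (\<lambda>z. lift_sol p z)"
  unfolding lift_sol_def by (rule pt_intros)+

section \<open>Correctness\<close>

lemma chunk_fold:
  assumes "s > 0" "length (fst a) < s" "\<forall>T\<in>set (snd a). length T = s"
  shows "length (fst (fold (chunk_step s) l a)) < s \<and>
    (\<forall>T\<in>set (snd (fold (chunk_step s) l a)). length T = s) \<and>
    mset (fst (fold (chunk_step s) l a)) + mset (concat (snd (fold (chunk_step s) l a))) =
      mset l + mset (fst a) + mset (concat (snd a))"
  using assms(2,3)
proof (induction l arbitrary: a)
  case (Cons y l)
  have "length (fst (chunk_step s y a)) < s" "\<forall>T\<in>set (snd (chunk_step s y a)). length T = s"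
    "mset (fst (chunk_step s y a)) + mset (concat (snd (chunk_step s y a))) =
      {#y#} + mset (fst a) + mset (concat (snd a))"
    using Cons.prems assms(1) by (auto simp: chunk_step_def)
  with Cons.IH[of "chunk_step s y a"] show ?case by (auto simp: ac_simps)
qed auto

lemma chunk:
  assumes "s > 0"
  shows "length (fst (chunk s l)) < s" "T \<in> set (snd (chunk s l)) \<Longrightarrow> length T = s"
    "mset (fst (chunk s l)) + mset (concat (snd (chunk s l))) = mset l"
  using chunk_fold[OF assms, of "([], [])" l] assms by (auto simp: chunk_def)

lemma chunk_lengths:
  assumes "s > 0"
  shows "length (snd (chunk s l)) = length l div s" "length (fst (chunk s l)) = length l mod s"
proof -
  let ?r = "chunk s l"
  have "length (concat (snd ?r)) = length (snd ?r) * s"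
    using clus_size[of s "mset (concat (snd ?r))" "snd ?r"] chunk(2)[OF assms, of _ l] by (auto simp: clus_def)
  moreover have "length l = length (fst ?r) + length (concat (snd ?r))"
    using arg_cong[OF chunk(3)[OF assms, of l], of size] by simp
  ultimately have "length l = length (fst ?r) + length (snd ?r) * s" by simp
  with chunk(1)[OF assms, of l] assms show "length (snd ?r) = length l div s" "length (fst ?r) = length l mod s"
    by simp_all
qed

lemma hdd_hd: "l \<noteq> [] \<Longrightarrow> hdd d l = hd l"
  by (cases l) auto

lemma hdd_in: "l \<noteq> [] \<Longrightarrow> hdd d l \<in> set l"
  by (cases l) auto

lemma count_sum_list: "count (mset (concat L)) x = (\<Sum>l\<leftarrow>L. count (mset l) x)"
  by (induction L) auto

lemma sum_list_single:
  assumes "distinct xs"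
  shows "(\<Sum>y\<leftarrow>xs. if y = x then f y else (0::nat)) = (if x \<in> set xs then f x else 0)"
  using assms by (induction xs) auto

lemma length_filter_eq: "length (filter (\<lambda>y. y = x) l) = count (mset l) x"
  by (induction l) auto

lemma filter_eq_replicate: "filter (\<lambda>y. y = x) l = replicate (count (mset l) x) x"
  by (induction l) auto

locale kernel_inst =
  fixes p :: nat and X :: "point list" and k B :: nat
  assumes inst: "((X, k), B) \<in> equal_clustering_insts"
begin

abbreviation J :: inst where "J \<equiv> ((X, k), B)"
abbreviation s :: nat where "s \<equiv> csize J"
abbreviation d :: nat where "d \<equiv> dimn J"
abbreviation b :: nat where "b \<equiv> bnd J"
abbreviation t :: nat where "t \<equiv> tnum J"
abbreviation M :: "point multiset" where "M \<equiv> mset X"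
abbreviation r :: "point \<Rightarrow> nat" where "r x \<equiv> count (mset X) x mod csize J"

lemma X_ne: "X \<noteq> []" and k_pos: "k \<ge> 1" and k_dvd: "k dvd length X"
  using inst by (auto simp: equal_clustering_insts_def)

lemma d_eq: "d = dimension X"
  using X_ne by (simp add: dimn_def dimension_def hdd_hd)

lemma d_pos: "d \<ge> 1"
  using inst d_eq by (auto simp: equal_clustering_insts_def)

lemma X_length: "x \<in> set X \<Longrightarrow> length x = d"
  using inst d_eq by (auto simp: equal_clustering_insts_def)

lemma knum_eq: "knum J = k"
  using dvd_imp_le[OF k_dvd] X_ne by (simp add: knum_def)

lemma s_eq: "s = length X div k"
  using k_pos by (simp add: csize_def knum_eq chunk_lengths)

lemma n_eq: "length X = k * s"
  using k_dvd by (simp add: s_eq)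

lemma s_pos: "s > 0"
  using n_eq X_ne by (metis length_greater_0_conv mult_0_right not_gr_zero)

lemma s_le: "s \<le> length X"
  by (simp add: s_eq)

lemma b_le: "b \<le> B"
  by (simp add: bnd_def)

lemma b_cases: "b = B \<or> b = length X + d"
  by (auto simp: bnd_def min_def)

lemma sols_iff: "C \<in> sols (equal_clustering p) J \<longleftrightarrow> length C = k \<and> clus s M C"
  by (auto simp: equal_clustering_def equal_clusterings_def clus_def sum_list_mset_eq s_eq)

lemma clus_length: "clus s M C \<Longrightarrow> length C = k"
  using clus_size[of s M C] n_eq s_pos by simp

lemma grp_parts:
  "fst (grp J x) = replicate (r x) x"
  "T \<in> set (snd (grp J x)) \<Longrightarrow> T = replicate s x"
  "length (snd (grp J x)) = count M x div s"
proof -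
  let ?l = "filter (\<lambda>y. y = x) X"
  have len: "length ?l = count M x" by (rule length_filter_eq)
  have sub: "set (fst (chunk s ?l)) \<union> set (concat (snd (chunk s ?l))) \<subseteq> {x}"
    using arg_cong[OF chunk(3)[OF s_pos, of ?l], of set_mset] by auto
  show "fst (grp J x) = replicate (r x) x"
    unfolding grp_def fst_conv using sub chunk_lengths(2)[OF s_pos, of ?l] len
    by (intro replicate_eqI) (auto simp: fst_conv)
  show "T = replicate s x" if "T \<in> set (snd (grp J x))" for T
    using that sub chunk(2)[OF s_pos, of T ?l] unfolding grp_def fst_conv
    by (intro replicate_eqI) auto
  show "length (snd (grp J x)) = count M x div s"
    unfolding grp_def fst_conv using chunk_lengths(1)[OF s_pos, of ?l] len by simp
qed

lemma resid_map: "resid J = map (\<lambda>x. replicate (r x) x) (filter (\<lambda>x. r x \<noteq> 0) (remdups X))"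
  by (simp add: resid_def grp_parts filter_map comp_def)

lemma reps_eq: "reps J = filter (\<lambda>x. r x \<noteq> 0) (remdups X)"
proof -
  have "map (hdd [] \<circ> (\<lambda>x. replicate (r x) x)) (filter (\<lambda>x. r x \<noteq> 0) l) = filter (\<lambda>x. r x \<noteq> 0) l" for l
    by (induction l) (auto simp: hdd_hd)
  then show ?thesis by (simp add: reps_def resid_map)
qed

lemma resid_eq: "resid J = map (\<lambda>x. replicate (r x) x) (reps J)"
  by (simp add: resid_map reps_eq)

lemma reps_distinct: "distinct (reps J)"
  by (simp add: reps_eq)

lemma reps_set: "x \<in> set (reps J) \<longleftrightarrow> r x \<noteq> 0"
proof -
  have "x \<in> set X" if "r x \<noteq> 0"
  proof (rule ccontr)
    assume "x \<notin> set X"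
    then have "count M x = 0" by simp
    with that show False by simp
  qed
  then show ?thesis by (auto simp: reps_eq simp del: mod_eq_0_iff_dvd)
qed

lemma reps_sub: "set (reps J) \<subseteq> set X"
  by (auto simp: reps_eq)

lemma reps_length: "x \<in> set (reps J) \<Longrightarrow> length x = d"
  using reps_sub X_length by blast

abbreviation M' :: "point multiset" where "M' \<equiv> mset (concat (resid J))"
abbreviation Y :: "point list" where "Y \<equiv> concat (trimmed J)"
abbreviation M'' :: "point multiset" where "M'' \<equiv> mset Y"

lemma count_replicates:
  "count (mset (concat (map (\<lambda>x. replicate (f x) x) (reps J)))) x = (if x \<in> set (reps J) then f x else 0)"
proof -
  have "count (mset (concat (map (\<lambda>x. replicate (f x) x) (reps J)))) x = (\<Sum>y\<leftarrow>reps J. if y = x then f y else 0)"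
    by (simp add: count_sum_list comp_def eq_commute[of x] cong: if_cong)
  then show ?thesis using sum_list_single[OF reps_distinct] by simp
qed

lemma count_M': "count M' x = r x"
  unfolding resid_eq count_replicates using reps_set by auto

lemma trimmed_eq: "trimmed J = map (\<lambda>x. replicate (r x - (if b < r x then t else 0)) x) (reps J)"
  by (simp add: trimmed_def resid_eq)

lemma count_M'': "count M'' x = count M' x - (if b < count M' x then t else 0)"
  unfolding count_M' trimmed_eq count_replicates using reps_set by auto

lemma M'_sub: "set_mset M' \<subseteq> set (reps J)"
  using reps_set count_M' by (metis (no_types, lifting) count_eq_zero_iff subsetI)

lemma M''_sub: "set_mset M'' \<subseteq> set (reps J)"
proof
  fix x assume "x \<in># M''"
  then have "count M'' x \<noteq> 0" by (simp only: count_eq_zero_iff not_not)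
  then have "r x \<noteq> 0" using count_M''[of x] count_M'[of x] by linarith
  then show "x \<in> set (reps J)" using reps_set by blast
qed

lemma M_dim: "set_mset M \<subseteq> {x. length x = d}" and M'_dim: "set_mset M' \<subseteq> {x. length x = d}"
  and M''_dim: "set_mset M'' \<subseteq> {x. length x = d}"
  using X_length M'_sub M''_sub reps_length by auto

lemma homog_len: "T \<in> set (homog J) \<Longrightarrow> length T = s"
  unfolding homog_def using grp_parts(2) by fastforce

lemma homog_mset: "mset (concat (homog J)) + M' = M"
proof (rule multiset_eqI)
  fix x
  have "count (mset (concat (snd (grp J y)))) x = (if y = x then count M y - r y else 0)" for y
  proof -
    have "mset (fst (grp J y)) + mset (concat (snd (grp J y))) = mset (filter (\<lambda>z. z = y) X)"
      using chunk(3)[OF s_pos, of "filter (\<lambda>z. z = y) X"] by (simp add: grp_def)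
    from arg_cong[OF this, of "\<lambda>A. count A x"] show ?thesis
      by (auto simp: grp_parts(1) filter_eq_replicate)
  qed
  moreover have "concat (homog J) = concat (map (\<lambda>y. concat (snd (grp J y))) (remdups X))"
  proof -
    have "concat (concat (map f l)) = concat (map (\<lambda>y. concat (f y)) l)" for f :: "point \<Rightarrow> point list list" and l
      by (induction l) auto
    then show ?thesis by (simp add: homog_def)
  qed
  ultimately have "count (mset (concat (homog J))) x = (\<Sum>y\<leftarrow>remdups X. if y = x then count M y - r y else 0)"
    by (simp add: count_sum_list comp_def)
  also have "\<dots> = (if x \<in> set X then count M x - r x else 0)" by (subst sum_list_single) auto
  finally have "count (mset (concat (homog J))) x = count M x - r x"
    by (auto simp: count_mset_0_iff[THEN iffD2])
  then show "count (mset (concat (homog J)) + M') x = count M x"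
    by (simp only: count_union count_M') simp
qed

lemma homog_cost: "lp.lcost d p (homog J) = 0"
proof -
  have "lp.mcost d p (mset T) = 0" if T: "T \<in> set (homog J)" for T
  proof -
    obtain x where x: "x \<in> set X" "T \<in> set (snd (grp J x))" using T by (auto simp: homog_def)
    then have "mset T = replicate_mset s x" using grp_parts(2)[OF x(2)] by simp
    then show ?thesis using lp.mcost_replicate[of x d p s] X_length[OF x(1)] by simp
  qed
  then show ?thesis by (simp add: lp.lcost_def cong: map_cong)
qed

lemma homog_split: "clus s M' C \<Longrightarrow> clus s M (homog J @ C)"
  using homog_mset homog_len by (auto simp: clus_def)

lemma kres_eq: "length (concat (resid J)) = kres J * s"
proof -
  have "size M = size (mset (concat (homog J))) + size M'" using homog_mset by (metis size_union)
  moreover have "size (mset (concat (homog J))) = length (homog J) * s"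
    by (rule clus_size) (simp add: clus_def homog_len)
  ultimately have "k * s = length (homog J) * s + length (concat (resid J))" using n_eq by simp
  then have "s dvd length (concat (resid J))" by (metis dvd_add_right_iff dvd_triv_right)
  moreover have "kres J = length (concat (resid J)) div s"
    unfolding kres_def by (rule chunk_lengths(1)[OF s_pos])
  ultimately show ?thesis by simp
qed

lemma clus_kres: "clus s M' C \<Longrightarrow> length C = kres J"
  using clus_size[of s M' C] kres_eq s_pos by simp

lemma t_eq: "s - t = min s (2 * b + 2)"
  by (simp add: tnum_def)

lemma t_pos: "t > 0 \<Longrightarrow> 2 * B + 2 < s \<and> b = B"
  using b_cases s_le by (auto simp: tnum_def)

lemma reps_card: "length (reps J) = card {x \<in> set_mset M. \<not> s dvd count M x}"
proof -
  have "length (reps J) = card (set (reps J))" using reps_distinct by (simp add: distinct_card)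
  also have "set (reps J) = {x \<in> set_mset M. \<not> s dvd count M x}"
    by (auto simp: reps_eq dvd_eq_mod_eq_0)
  finally show ?thesis .
qed

lemma default_sol: "snd (chunk s X) \<in> sols (equal_clustering p) J"
proof -
  have "length (fst (chunk s X)) = 0" using chunk_lengths(2)[OF s_pos, of X] n_eq by simp
  then have "clus s M (snd (chunk s X))"
    using chunk(2)[OF s_pos, of _ X] chunk(3)[OF s_pos, of X] by (auto simp: clus_def)
  then show ?thesis using clus_length sols_iff by blast
qed

lemma valid_iff: "valid J C \<longleftrightarrow> C \<in> sols (equal_clustering p) J"
proof
  assume v: "valid J C"
  have len: "length C = k" "\<forall>T\<in>set C. length T = s"
    and cnt: "\<forall>x\<in>set X. count (mset (concat C)) x = count M x"
    using v by (auto simp: valid_def knum_eq length_filter_eq)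
  have "M \<subseteq># mset (concat C)"
  proof (rule mset_subset_eqI)
    show "count M x \<le> count (mset (concat C)) x" for x
      using cnt by (cases "x \<in> set X") (auto simp: count_mset_0_iff[THEN iffD2])
  qed
  moreover have "size (mset (concat C)) = size M"
    using clus_size[of s "mset (concat C)" C] len n_eq by (simp add: clus_def)
  ultimately have "mset (concat C) = M" by (metis mset_subset_size less_irrefl subset_mset.le_neq_trans)
  then show "C \<in> sols (equal_clustering p) J" using len sols_iff by (simp add: clus_def)
next
  assume C: "C \<in> sols (equal_clustering p) J"
  then have "mset (concat C) = M" "length C = k" "\<forall>T\<in>set C. length T = s" using sols_iff by (auto simp: clus_def)
  then show "valid J C" by (simp add: valid_def knum_eq length_filter_eq)
qed

lemma lift_sol_sols: "lift_sol p (J, J', C) \<in> sols (equal_clustering p) J"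
  using default_sol valid_iff by (simp add: lift_sol_def)

end

lemma nthz_nth: "j < length x \<Longrightarrow> nthz x j = x ! j"
  by (simp add: nthz_def hdd_hd hd_drop_conv_nth)

lemma card_filter_upt: "length (filter P [0..<n]) = card {j. j < n \<and> P j}"
proof -
  have "length (filter P [0..<n]) = card (set (filter P [0..<n]))" by (rule distinct_card[symmetric]) simp
  also have "set (filter P [0..<n]) = {j. j < n \<and> P j}" by auto
  finally show ?thesis .
qed

lemma slot_index: "slot c bs = - (c * int (length (takeWhile Not bs)))"
  by (induction bs) (auto simp: algebra_simps)

lemma length_takeWhile_less: "x \<in> set l \<Longrightarrow> \<not> P x \<Longrightarrow> length (takeWhile P l) < length l"
  by (induction l) auto

lemma card_UN_list_le:
  assumes "\<And>c. c \<in> set T \<Longrightarrow> card (F c) \<le> G c"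
  shows "card (\<Union>c\<in>set T. F c) \<le> (\<Sum>c\<leftarrow>T. G c)"
  using assms
proof (induction T)
  case (Cons c T)
  have "card (\<Union>c\<in>set (c # T). F c) \<le> card (F c) + card (\<Union>c\<in>set T. F c)" by (simp add: card_Un_le)
  with Cons show ?case by (simp add: add_mono order_trans)
qed simp

lemma length_le_concat: "c \<in> set T \<Longrightarrow> length c \<le> length (concat T)"
  by (induction T) auto

lemma length_le_concat2:
  "c \<in> set T \<Longrightarrow> c' \<in> set T \<Longrightarrow> c \<noteq> c' \<Longrightarrow> length c + length c' \<le> length (concat T)"
proof (induction T)
  case (Cons a T)
  then show ?case using length_le_concat[of c T] length_le_concat[of c' T] by auto
qed simp

lemma mset_concat_partition:
  "mset (concat (filter P l)) + mset (concat (filter (\<lambda>x. \<not> P x) l)) = mset (concat l)"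
  by (induction l) auto

context kernel_inst
begin

abbreviation D :: nat where "D \<equiv> b ^ max p 1"

definition diffs :: "point \<Rightarrow> point \<Rightarrow> nat set" where
  "diffs x y = {j. j < d \<and> x ! j \<noteq> y ! j}"

definition spread :: "point list \<Rightarrow> nat set" where
  "spread c = {j. j < d \<and> (\<exists>x\<in>set c. \<exists>y\<in>set c. x ! j \<noteq> y ! j)}"

lemma close_iff:
  assumes "length x = d" "length y = d"
  shows "close p J x y \<longleftrightarrow> card (diffs x y) \<le> D \<and> (p = 0 \<or> (\<forall>j<d. \<bar>x ! j - y ! j\<bar> \<le> int B))"
proof -
  have "{j. j < d \<and> nthz x j \<noteq> nthz y j} = diffs x y"
    using assms nthz_nth by (auto simp: diffs_def)
  moreover have "(\<forall>j\<in>set [0..<d]. nat \<bar>nthz x j - nthz y j\<bar> \<le> B) \<longleftrightarrow> (\<forall>j<d. \<bar>x ! j - y ! j\<bar> \<le> int B)"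
    using assms by (simp add: nthz_nth nat_le_iff Ball_def)
  ultimately show ?thesis by (simp add: close_def card_filter_upt)
qed

lemma diffs_sym: "diffs x y = diffs y x"
  by (auto simp: diffs_def)

lemma close_sym:
  assumes "length x = d" "length y = d"
  shows "close p J x y \<longleftrightarrow> close p J y x"
  unfolding close_iff[OF assms] close_iff[OF assms(2,1)] by (simp add: diffs_sym abs_minus_commute)

definition tight :: "point list \<Rightarrow> bool" where
  "tight c \<longleftrightarrow> c \<noteq> [] \<and> card (spread c) + D \<le> length c * D \<and>
     (p > 0 \<longrightarrow> (\<forall>x\<in>set c. \<forall>y\<in>set c. \<forall>j<d. \<bar>x ! j - y ! j\<bar> + int B \<le> int (length c) * int B))"

definition partition_inv :: "point list \<Rightarrow> point list list \<Rightarrow> bool" where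
  "partition_inv ys Cs \<longleftrightarrow> mset (concat Cs) = mset ys \<and> (\<forall>c\<in>set Cs. tight c) \<and>
     (\<forall>x\<in>set ys. \<forall>y\<in>set ys. close p J x y \<longrightarrow> (\<exists>c\<in>set Cs. x \<in> set c \<and> y \<in> set c))"

lemma tight_merge:
  assumes x: "length x = d" and T: "\<And>c. c \<in> set T \<Longrightarrow> tight c"
    and near: "\<And>c. c \<in> set T \<Longrightarrow> \<exists>y\<in>set c. close p J x y"
    and len: "\<And>c y. c \<in> set T \<Longrightarrow> y \<in> set c \<Longrightarrow> length y = d"
  shows "tight (x # concat T)"
proof -
  obtain w where w: "\<And>c. c \<in> set T \<Longrightarrow> w c \<in> set c \<and> close p J x (w c)" using near by metis
  have cw: "card (diffs x (w c)) \<le> D" "p > 0 \<Longrightarrow> j < d \<Longrightarrow> \<bar>x ! j - w c ! j\<bar> \<le> int B" if "c \<in> set T" for c j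
    using w[OF that] close_iff[OF x len[OF that]] by auto
  have sub: "spread (x # concat T) \<subseteq> (\<Union>c\<in>set T. spread c \<union> diffs x (w c))"
  proof
    fix j assume j: "j \<in> spread (x # concat T)"
    show "j \<in> (\<Union>c\<in>set T. spread c \<union> diffs x (w c))"
    proof (rule ccontr)
      assume no: "j \<notin> (\<Union>c\<in>set T. spread c \<union> diffs x (w c))"
      have "j < d" using j by (simp add: spread_def)
      have "y ! j = x ! j" if y: "y \<in> set (x # concat T)" for y
      proof (cases "y = x")
        case False
        then obtain c where c: "c \<in> set T" "y \<in> set c" using y by auto
        have "j \<notin> spread c" "j \<notin> diffs x (w c)" using no c(1) by auto
        moreover have "w c \<in> set c" using w[OF c(1)] by simp
        ultimately have "y ! j = w c ! j" "x ! j = w c ! j"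
          using c(2) \<open>j < d\<close> unfolding spread_def diffs_def by blast+
        then show ?thesis by simp
      qed simp
      note same = this
      obtain u v where uv: "u \<in> set (x # concat T)" "v \<in> set (x # concat T)" "u ! j \<noteq> v ! j"
        using j unfolding spread_def by blast
      then show False using same[OF uv(1)] same[OF uv(2)] by simp
    qed
  qed
  have "card (spread (x # concat T)) \<le> card (\<Union>c\<in>set T. spread c \<union> diffs x (w c))"
    by (rule card_mono[OF _ sub]) (auto simp: spread_def diffs_def)
  also have "\<dots> \<le> (\<Sum>c\<leftarrow>T. length c * D)"
  proof (rule card_UN_list_le)
    fix c assume c: "c \<in> set T"
    have "card (spread c \<union> diffs x (w c)) \<le> card (spread c) + card (diffs x (w c))" by (rule card_Un_le)
    also have "\<dots> \<le> card (spread c) + D" using cw(1)[OF c] by simp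
    also have "\<dots> \<le> length c * D" using T[OF c] by (simp add: tight_def)
    finally show "card (spread c \<union> diffs x (w c)) \<le> length c * D" .
  qed
  also have "\<dots> = length (concat T) * D" by (simp add: length_concat sum_list_mult_const)
  finally have 1: "card (spread (x # concat T)) + D \<le> length (x # concat T) * D" by simp
  have 2: "\<bar>u ! j - v ! j\<bar> + int B \<le> int (length (x # concat T)) * int B"
    if uv: "u \<in> set (x # concat T)" "v \<in> set (x # concat T)" and j: "j < d" and p: "p > 0" for u v j
  proof -
    let ?n = "int (length (concat T))"
    have tx: "\<bar>u ! j - x ! j\<bar> \<le> int (length c) * int B" if c: "c \<in> set T" "u \<in> set c" for c u
    proof -
      have "\<bar>u ! j - w c ! j\<bar> + int B \<le> int (length c) * int B"
        using T[OF c(1)] c(2) w[OF c(1)] j p unfolding tight_def by blast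
      moreover have "\<bar>x ! j - w c ! j\<bar> \<le> int B" by (rule cw(2)[OF c(1) p j])
      ultimately show ?thesis by linarith
    qed
    have mono: "int m * int B \<le> ?n * int B" if "m \<le> length (concat T)" for m
      using that by (intro mult_right_mono) auto
    have tx': "\<bar>u ! j - x ! j\<bar> \<le> ?n * int B" if u: "u \<in> set (concat T)" for u
    proof -
      obtain c where c: "c \<in> set T" "u \<in> set c" using u by auto
      show ?thesis using tx[OF c] mono[OF length_le_concat[OF c(1)]] by linarith
    qed
    have "\<bar>u ! j - v ! j\<bar> \<le> ?n * int B"
    proof (cases "u = x \<or> v = x")
      case True
      then consider "u = v" | "u = x" "v \<in> set (concat T)" | "v = x" "u \<in> set (concat T)" using uv by auto
      then show ?thesis
      proof cases
        case 1 then show ?thesis by simp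
      next
        case 2 then show ?thesis using tx'[of v] by (simp add: abs_minus_commute)
      next
        case 3 then show ?thesis using tx'[of u] by simp
      qed
    next
      case False
      then obtain c c' where c: "c \<in> set T" "u \<in> set c" "c' \<in> set T" "v \<in> set c'" using uv by auto
      show ?thesis
      proof (cases "c = c'")
        case True
        then have "\<bar>u ! j - v ! j\<bar> + int B \<le> int (length c) * int B"
          using T[OF c(1)] c j p unfolding tight_def by blast
        then show ?thesis using mono[OF length_le_concat[OF c(1)]] by linarith
      next
        case False
        have "int (length c + length c') * int B \<le> ?n * int B"
          by (rule mono[OF length_le_concat2[OF c(1,3) False]])
        moreover have "\<bar>u ! j - x ! j\<bar> \<le> int (length c) * int B" "\<bar>v ! j - x ! j\<bar> \<le> int (length c') * int B"
          using tx c by auto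
        ultimately show ?thesis by (simp add: distrib_right)
      qed
    qed
    then show ?thesis by (simp add: distrib_right)
  qed
  show ?thesis using 1 2 unfolding tight_def by blast
qed

lemma partition_inv_merge:
  assumes inv: "partition_inv ys Cs" and x: "length x = d" and ys: "\<forall>y\<in>set ys. length y = d"
  shows "partition_inv (x # ys) (merge p J x Cs)"
proof -
  let ?P = "\<lambda>c. \<exists>y\<in>set c. close p J x y"
  let ?T = "filter ?P Cs"
  have set_eq: "set (concat Cs) = set ys" using inv unfolding partition_inv_def by (metis set_mset_mset)
  have len: "length y = d" if "c \<in> set Cs" "y \<in> set c" for c y using that ys set_eq by auto
  have "tight (x # concat ?T)"
    by (rule tight_merge[OF x]) (use inv len in \<open>auto simp: partition_inv_def\<close>)
  moreover have "mset (concat (merge p J x Cs)) = mset (x # ys)"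
    using inv mset_concat_partition[of ?P Cs] by (simp add: merge_def partition_inv_def)
  moreover have "\<exists>c\<in>set (merge p J x Cs). u \<in> set c \<and> v \<in> set c"
    if uv: "u \<in> set (x # ys)" "v \<in> set (x # ys)" "close p J u v" for u v
  proof -
    have x_in: "y \<in> set (x # concat ?T)" if y: "y \<in> set ys" "close p J x y" for y
      using y set_eq by auto
    have new: "x # concat ?T \<in> set (merge p J x Cs)" by (simp add: merge_def)
    consider "u = x" "v = x" | "u = x" "v \<in> set ys" | "v = x" "u \<in> set ys" | "u \<in> set ys" "v \<in> set ys"
      using uv by auto
    then show ?thesis
    proof cases
      case 1
      then show ?thesis using new by (intro bexI[OF _ new]) simp
    next
      case 2
      then show ?thesis using x_in[of v] uv(3) by (intro bexI[OF _ new]) simp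
    next
      case 3
      then have "close p J x u" using uv(3) close_sym x ys by blast
      then show ?thesis using x_in[of u] 3 by (intro bexI[OF _ new]) simp
    next
      case 4
      then obtain c where c: "c \<in> set Cs" "u \<in> set c" "v \<in> set c"
        using inv uv(3) unfolding partition_inv_def by blast
      show ?thesis
      proof (cases "?P c")
        case True
        then have "u \<in> set (x # concat ?T)" "v \<in> set (x # concat ?T)" using c by auto
        then show ?thesis by (intro bexI[OF _ new]) simp
      next
        case False
        then show ?thesis using c by (intro bexI[of _ c]) (auto simp: merge_def)
      qed
    qed
  qed
  ultimately show ?thesis using inv unfolding partition_inv_def by (auto simp: merge_def)
qed

lemma partition_inv_comps: "partition_inv (rev (reps J)) (comps p J)"
proof -
  have "partition_inv (rev l @ ys) (fold (merge p J) l Cs)"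
    if "partition_inv ys Cs" "\<forall>y\<in>set l \<union> set ys. length y = d" for l ys Cs
    using that
  proof (induction l arbitrary: ys Cs)
    case (Cons x l)
    have "partition_inv (x # ys) (merge p J x Cs)" using Cons.prems by (intro partition_inv_merge) auto
    with Cons.IH[of "x # ys" "merge p J x Cs"] Cons.prems(2) show ?case by simp
  qed simp
  from this[of "[]" "[]" "reps J"] show ?thesis
    using reps_length by (auto simp: comps_def partition_inv_def)
qed

abbreviation Cs :: "point list list" where "Cs \<equiv> comps p J"

lemma mset_comps: "mset (concat Cs) = mset (reps J)"
  using partition_inv_comps by (simp add: partition_inv_def)

lemma comps_tight: "c \<in> set Cs \<Longrightarrow> tight c"
  using partition_inv_comps by (simp add: partition_inv_def)

lemma comps_sub: "c \<in> set Cs \<Longrightarrow> x \<in> set c \<Longrightarrow> x \<in> set (reps J)"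
  using mset_comps by (metis UN_I set_concat set_mset_mset)

lemma comps_dim: "c \<in> set Cs \<Longrightarrow> x \<in> set c \<Longrightarrow> length x = d"
  using comps_sub reps_length by blast

lemma comps_unique:
  assumes "c \<in> set Cs" "c' \<in> set Cs" "x \<in> set c" "x \<in> set c'"
  shows "c = c'"
proof -
  have "distinct (concat Cs)" using mset_comps reps_distinct by (metis mset_eq_imp_distinct_iff)
  then show ?thesis using assms by (auto simp: distinct_concat_iff)
qed

lemma cof: "cof p J x \<in> set Cs" "x \<in> set (cof p J x)" if "x \<in> set (reps J)" for x
proof -
  have "x \<in> set (concat Cs)" using that mset_comps by (metis set_mset_mset)
  then have "filter (\<lambda>c. x \<in> set c) Cs \<noteq> []" by (auto simp: filter_empty_conv)
  then have "cof p J x \<in> set (filter (\<lambda>c. x \<in> set c) Cs)" unfolding cof_def by (rule hdd_in)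
  then show "cof p J x \<in> set Cs" "x \<in> set (cof p J x)" by auto
qed

lemma cof_eq: "c \<in> set Cs \<Longrightarrow> x \<in> set c \<Longrightarrow> cof p J x = c"
  using cof comps_sub comps_unique by blast

lemma close_cof:
  assumes "x \<in> set (reps J)" "y \<in> set (reps J)" "close p J x y"
  shows "cof p J x = cof p J y"
proof -
  have "\<exists>c\<in>set Cs. x \<in> set c \<and> y \<in> set c"
    using partition_inv_comps assms unfolding partition_inv_def by simp
  then show ?thesis using cof_eq by metis
qed

lemma length_comp_le: "c \<in> set Cs \<Longrightarrow> length c \<le> length (reps J)"
  using length_le_concat mset_comps by (metis size_mset)

lemma length_comps_le: "length Cs \<le> length (reps J)"
proof -
  have "length l \<le> length (concat l)" if "\<forall>c\<in>set l. c \<noteq> []" for l :: "point list list"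
    using that
  proof (induction l)
    case (Cons c l)
    then show ?case by (cases c) auto
  qed simp
  then show ?thesis using comps_tight mset_comps by (metis size_mset tight_def)
qed

lemma coord_pos:
  assumes "p > 0" "c \<in> set Cs" "x \<in> set c" "j < d"
  shows "coord p J x j = x ! j - hd c ! j"
proof -
  have "c \<noteq> []" using assms(3) by auto
  then have "hd c \<in> set c" "hdd [] c = hd c" by (auto simp: hdd_hd)
  then show ?thesis using assms comps_dim[OF assms(2)]
    by (simp add: coord_def cof_eq[OF assms(2,3)] nthz_nth)
qed

lemma coord_zero:
  assumes "p = 0" "c \<in> set Cs" "x \<in> set c" "j < d"
  shows "coord p J x j = - int (length (takeWhile (\<lambda>z. z ! j \<noteq> x ! j) c))"
proof -
  have "map (\<lambda>z. nthz z j = nthz x j) c = map (\<lambda>z. z ! j = x ! j) c"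
    using assms comps_dim[OF assms(2)] by (simp add: nthz_nth)
  moreover have "coord p J x j = slot 1 (map (\<lambda>z. nthz z j = nthz x j) c)"
    unfolding coord_def cof_eq[OF assms(2,3)] using assms(1) by simp
  ultimately have "coord p J x j = slot 1 (map (\<lambda>z. z ! j = x ! j) c)" by (simp only:)
  then show ?thesis by (simp add: slot_index takeWhile_map comp_def)
qed

lemma coord_eq_iff:
  assumes c: "c \<in> set Cs" "x \<in> set c" "y \<in> set c" "j < d"
  shows "coord p J x j = coord p J y j \<longleftrightarrow> x ! j = y ! j"
proof (cases "p = 0")
  case True
  have first: "c ! length (takeWhile (\<lambda>z. z ! j \<noteq> u ! j) c) ! j = u ! j" if u: "u \<in> set c" for u
  proof -
    have "length (takeWhile (\<lambda>z. z ! j \<noteq> u ! j) c) < length c"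
      using u by (rule length_takeWhile_less) simp
    then show ?thesis using nth_length_takeWhile by blast
  qed
  show ?thesis
  proof
    assume "coord p J x j = coord p J y j"
    then have eq: "length (takeWhile (\<lambda>z. z ! j \<noteq> x ! j) c) = length (takeWhile (\<lambda>z. z ! j \<noteq> y ! j) c)"
      unfolding coord_zero[OF True c(1,2,4)] coord_zero[OF True c(1,3,4)] by linarith
    have "c ! length (takeWhile (\<lambda>z. z ! j \<noteq> y ! j) c) ! j = x ! j"
      using first[OF c(2)] by (simp only: eq)
    then show "x ! j = y ! j" by (rule trans[OF sym first[OF c(3)]])
  next
    assume "x ! j = y ! j"
    then show "coord p J x j = coord p J y j"
      unfolding coord_zero[OF True c(1,2,4)] coord_zero[OF True c(1,3,4)] by (simp only:)
  qed
next
  case False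
  then show ?thesis using coord_pos[OF _ c(1) _ c(4)] c(2,3) by simp
qed

abbreviation js :: "nat list" where "js \<equiv> varying p J"

lemma js_distinct: "distinct js" and js_sub: "set js \<subseteq> {..<d}"
  by (auto simp: varying_def)

lemma not_varying:
  assumes "c \<in> set Cs" "x \<in> set c" "y \<in> set c" "j < d" "j \<notin> set js"
  shows "x ! j = y ! j"
proof -
  have "coord p J x j = 0" "coord p J y j = 0"
    using assms comps_sub[OF assms(1)] by (auto simp: varying_def)
  then show ?thesis using coord_eq_iff[OF assms(1-4)] by simp
qed

lemma varying_spread: "set js \<subseteq> (\<Union>c\<in>set Cs. spread c)"
proof
  fix j assume "j \<in> set js"
  then obtain x where x: "x \<in> set (reps J)" "coord p J x j \<noteq> 0" "j < d" by (auto simp: varying_def)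
  let ?c = "cof p J x"
  have c: "?c \<in> set Cs" "x \<in> set ?c" using cof x(1) by auto
  then have ne: "?c \<noteq> []" by auto
  then have hd: "hd ?c \<in> set ?c" by simp
  have "coord p J (hd ?c) j = 0"
  proof (cases "p = 0")
    case True
    have "takeWhile (\<lambda>z. z ! j \<noteq> hd ?c ! j) ?c = []" using ne by (simp add: takeWhile_eq_Nil_iff)
    then show ?thesis unfolding coord_zero[OF True c(1) hd x(3)] by simp
  next
    case False
    then show ?thesis using coord_pos[OF _ c(1) hd x(3)] by simp
  qed
  then have "x ! j \<noteq> hd ?c ! j" using x coord_eq_iff[OF c(1,2) hd x(3)] by simp
  then have "j \<in> spread ?c" using x(3) c(2) hd by (auto simp: spread_def)
  then show "j \<in> (\<Union>c\<in>set Cs. spread c)" using c(1) by blast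
qed

lemma length_varying: "length js \<le> length (reps J) * D"
proof -
  have "length js = card (set js)" using js_distinct by (simp add: distinct_card)
  also have "\<dots> \<le> card (\<Union>c\<in>set Cs. spread c)"
    by (rule card_mono[OF _ varying_spread]) (auto simp: spread_def)
  also have "\<dots> \<le> (\<Sum>c\<leftarrow>Cs. length c * D)"
  proof (rule card_UN_list_le)
    fix c assume "c \<in> set Cs"
    then have "card (spread c) + D \<le> length c * D" using comps_tight unfolding tight_def by blast
    then show "card (spread c) \<le> length c * D" by (rule add_leD1)
  qed
  also have "\<dots> = length (concat Cs) * D" by (simp add: length_concat sum_list_mult_const)
  also have "length (concat Cs) = length (reps J)" using mset_comps by (metis size_mset)
  finally show ?thesis .
qed

lemma abs_coord_le:
  assumes x: "x \<in> set (reps J)" and j: "j < d"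
  shows "\<bar>coord p J x j\<bar> \<le> int (length (reps J) * (B + 1))"
proof -
  let ?c = "cof p J x"
  have c: "?c \<in> set Cs" "x \<in> set ?c" using cof x by auto
  have len: "length ?c * (B + 1) \<le> length (reps J) * (B + 1)"
    using length_comp_le[OF c(1)] by (rule mult_le_mono1)
  show ?thesis
  proof (cases "p = 0")
    case True
    have "length (takeWhile (\<lambda>z. z ! j \<noteq> x ! j) ?c) \<le> length ?c * (B + 1)"
      using length_takeWhile_le[of _ ?c] by (rule order_trans) simp
    then show ?thesis using coord_zero[OF True c j] len by linarith
  next
    case False
    have hd: "hd ?c \<in> set ?c" using c(2) by (metis list.set_sel(1) empty_iff empty_set)
    have "\<bar>x ! j - hd ?c ! j\<bar> + int B \<le> int (length ?c) * int B"
      using comps_tight[OF c(1)] c(2) hd j False unfolding tight_def by blast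
    also have "\<dots> \<le> int (length ?c * (B + 1))" by simp
    finally show ?thesis using coord_pos[OF _ c j] False len by linarith
  qed
qed

lemma separator_eq:
  "separator p J x = - (int (B + 1) * int (length (takeWhile (\<lambda>c. x \<notin> set c) Cs)))"
  by (simp add: separator_def slot_index takeWhile_map comp_def)

lemma abs_separator_le: "\<bar>separator p J x\<bar> \<le> int (length (reps J) * (B + 1))"
proof -
  have "length (takeWhile (\<lambda>c. x \<notin> set c) Cs) * (B + 1) \<le> length (reps J) * (B + 1)"
    using length_takeWhile_le[of _ Cs] length_comps_le by (intro mult_le_mono1) (rule order_trans)
  then have "int (length (takeWhile (\<lambda>c. x \<notin> set c) Cs) * (B + 1)) \<le> int (length (reps J) * (B + 1))"
    by (simp only: of_nat_le_iff)
  moreover have "\<bar>separator p J x\<bar> = int (length (takeWhile (\<lambda>c. x \<notin> set c) Cs) * (B + 1))"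
    unfolding separator_eq by (simp only: abs_minus_cancel abs_mult abs_of_nat of_nat_mult mult.commute)
  ultimately show ?thesis by simp
qed

lemma separator_same:
  assumes "c \<in> set Cs" "x \<in> set c" "y \<in> set c"
  shows "separator p J x = separator p J y"
proof -
  have "takeWhile (\<lambda>c. x \<notin> set c) Cs = takeWhile (\<lambda>c. y \<notin> set c) Cs"
    using assms comps_unique by (intro takeWhile_cong) auto
  then show ?thesis by (simp add: separator_eq)
qed

lemma separator_diff:
  assumes x: "x \<in> set (reps J)" and y: "y \<in> set (reps J)" and ne: "cof p J x \<noteq> cof p J y"
  shows "int B < \<bar>separator p J x - separator p J y\<bar>"
proof -
  let ?i = "\<lambda>x. length (takeWhile (\<lambda>c. x \<notin> set c) Cs)"
  have idx: "?i u < length Cs" "u \<in> set (Cs ! ?i u)" if u: "u \<in> set (reps J)" for u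
  proof -
    show less: "?i u < length Cs" using cof[OF u] length_takeWhile_less[of "cof p J u" Cs "\<lambda>c. u \<notin> set c"] by simp
    show "u \<in> set (Cs ! ?i u)" using nth_length_takeWhile[OF less] by simp
  qed
  have "?i x \<noteq> ?i y"
  proof
    assume "?i x = ?i y"
    then show False using idx[OF x] idx[OF y] ne cof_eq[of "Cs ! ?i x"] nth_mem by metis
  qed
  then have "1 \<le> \<bar>int (?i x) - int (?i y)\<bar>" by linarith
  then have "int (B + 1) * 1 \<le> int (B + 1) * \<bar>int (?i x) - int (?i y)\<bar>" by (intro mult_left_mono) auto
  also have "\<dots> = \<bar>separator p J x - separator p J y\<bar>"
  proof -
    have "separator p J x - separator p J y = - (int (B + 1) * (int (?i x) - int (?i y)))"
      unfolding separator_eq right_diff_distrib by linarith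
    then show ?thesis by (simp only: abs_minus_cancel abs_mult abs_of_nat)
  qed
  finally show ?thesis by simp
qed

end

definition gauge :: "nat \<Rightarrow> real \<Rightarrow> real" where
  "gauge p a = (if p = 0 then of_bool (a \<noteq> 0) else \<bar>a\<bar> ^ p)"

lemma gauge_nonneg: "0 \<le> gauge p a"
  by (simp add: gauge_def)

lemma gauge_0 [simp]: "gauge p 0 = 0"
  by (simp add: gauge_def)

lemma lp_norm_mono:
  assumes "(\<Sum>a\<leftarrow>v. gauge p a) \<le> (\<Sum>a\<leftarrow>w. gauge p a)"
  shows "lp_norm p v \<le> lp_norm p w"
proof (cases "p = 0")
  case True
  have "real (length (filter (\<lambda>a. a \<noteq> 0) u)) = (\<Sum>a\<leftarrow>u. gauge p a)" for u
    using True by (induction u) (auto simp: gauge_def)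
  with True assms show ?thesis by (simp add: lp_norm_def)
next
  case False
  then have "gauge p = (\<lambda>a. \<bar>a\<bar> ^ p)" by (intro ext) (simp add: gauge_def)
  with False assms show ?thesis by (simp add: lp_norm_def)
qed

lemma sum_list_gauge_nonneg: "0 \<le> (\<Sum>a\<leftarrow>v. gauge p a)"
  by (rule sum_list_nonneg) (auto simp: gauge_nonneg)

lemma vec_diff_append:
  "length c = length x \<Longrightarrow> vec_diff (c @ c') (x @ x') = vec_diff c x @ vec_diff c' x'"
  by (simp add: vec_diff_def)

lemma vec_diff_map: "vec_diff (map f l) (map g l) = map (\<lambda>j. f j - real_of_int (g j)) l"
  by (induction l) (auto simp: vec_diff_def)

lemma vec_diff_replicate: "vec_diff (replicate n (real_of_int u)) (replicate n u) = replicate n 0"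
  by (induction n) (auto simp: vec_diff_def)

lemma vec_diff_upt:
  "length c = d \<Longrightarrow> length x = d \<Longrightarrow> vec_diff c x = map (\<lambda>j. c ! j - real_of_int (x ! j)) [0..<d]"
  by (rule nth_equalityI) (auto simp: vec_diff_def)

context kernel_inst
begin

abbreviation f :: "point \<Rightarrow> point" where "f \<equiv> compress p J"
abbreviation d' :: nat where "d' \<equiv> length js + Suc b"

lemma length_f [simp]: "length (f x) = d'"
  by (simp add: compress_def)

lemma coord_transfer:
  assumes c: "c \<in> set Cs" and j: "j < d"
  shows "\<exists>\<phi> \<psi>. \<forall>u. \<forall>x\<in>set c. gauge p (\<phi> u - real_of_int (coord p J x j)) \<le> gauge p (u - real_of_int (x ! j)) \<and>
    gauge p (\<psi> u - real_of_int (x ! j)) \<le> gauge p (u - real_of_int (coord p J x j))"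
proof (cases "p = 0")
  case True
  define \<phi> where "\<phi> u = (if \<exists>y\<in>set c. real_of_int (y ! j) = u
    then real_of_int (coord p J (SOME y. y \<in> set c \<and> real_of_int (y ! j) = u) j) else 0)" for u
  define \<psi> where "\<psi> u = (if \<exists>y\<in>set c. real_of_int (coord p J y j) = u
    then real_of_int ((SOME y. y \<in> set c \<and> real_of_int (coord p J y j) = u) ! j) else 0)" for u
  have le1: "gauge p a \<le> of_bool (a \<noteq> 0)" for a using True by (simp add: gauge_def)
  have "\<phi> u = real_of_int (coord p J x j)" if x: "x \<in> set c" "real_of_int (x ! j) = u" for u x
  proof -
    let ?y = "SOME y. y \<in> set c \<and> real_of_int (y ! j) = u"
    have y: "?y \<in> set c \<and> real_of_int (?y ! j) = u" by (rule someI[of _ x]) (use x in simp)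
    then have "?y ! j = x ! j" using x by simp
    then have "coord p J ?y j = coord p J x j" using coord_eq_iff[OF c _ x(1) j] y by blast
    moreover have "\<exists>y\<in>set c. real_of_int (y ! j) = u" using x by blast
    ultimately show ?thesis unfolding \<phi>_def by simp
  qed
  moreover have "\<psi> u = real_of_int (x ! j)" if x: "x \<in> set c" "real_of_int (coord p J x j) = u" for u x
  proof -
    let ?y = "SOME y. y \<in> set c \<and> real_of_int (coord p J y j) = u"
    have y: "?y \<in> set c \<and> real_of_int (coord p J ?y j) = u" by (rule someI[of _ x]) (use x in simp)
    then have "coord p J ?y j = coord p J x j" using x by simp
    then have "?y ! j = x ! j" using coord_eq_iff[OF c _ x(1) j] y by blast
    moreover have "\<exists>y\<in>set c. real_of_int (coord p J y j) = u" using x by blast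
    ultimately show ?thesis unfolding \<psi>_def by simp
  qed
  ultimately show ?thesis
    using True by (intro exI[of _ \<phi>] exI[of _ \<psi>]) (auto simp: gauge_def)
next
  case False
  then have "real_of_int (coord p J x j) = real_of_int (x ! j) - real_of_int (hd c ! j)" if "x \<in> set c" for x
    using coord_pos[OF _ c that j] by simp
  then show ?thesis
    by (intro exI[of _ "\<lambda>u. u - real_of_int (hd c ! j)"] exI[of _ "\<lambda>u. u + real_of_int (hd c ! j)"])
      (auto simp: diff_diff_eq2)
qed

lemma center_forward:
  assumes c: "c \<in> set Cs" and a: "length a = d"
  shows "\<exists>a'. length a' = d' \<and> (\<forall>x\<in>set c. lp_norm p (vec_diff a' (f x)) \<le> lp_norm p (vec_diff a x))"
proof -
  have "\<exists>\<phi>. \<forall>u. \<forall>x\<in>set c. gauge p (\<phi> u - real_of_int (coord p J x j)) \<le> gauge p (u - real_of_int (x ! j))"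
    if "j < d" for j using coord_transfer[OF c that] by blast
  then obtain \<phi> where \<phi>: "\<And>j u x. j < d \<Longrightarrow> x \<in> set c \<Longrightarrow>
      gauge p (\<phi> j u - real_of_int (coord p J x j)) \<le> gauge p (u - real_of_int (x ! j))"
    by metis
  define w where "w = separator p J (hd c)"
  let ?a = "map (\<lambda>j. \<phi> j (a ! j)) js @ replicate (Suc b) (real_of_int w)"
  have "lp_norm p (vec_diff ?a (f x)) \<le> lp_norm p (vec_diff a x)" if x: "x \<in> set c" for x
  proof (rule lp_norm_mono)
    have "hd c \<in> set c" using x by (metis list.set_sel(1) empty_iff empty_set)
    then have w: "separator p J x = w" unfolding w_def using separator_same[OF c x] by blast
    have "vec_diff ?a (f x) = map (\<lambda>j. \<phi> j (a ! j) - real_of_int (coord p J x j)) js @ replicate (Suc b) 0"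
      unfolding compress_def w by (simp only: vec_diff_append length_map vec_diff_map vec_diff_replicate)
    then have "(\<Sum>u\<leftarrow>vec_diff ?a (f x). gauge p u) = (\<Sum>j\<leftarrow>js. gauge p (\<phi> j (a ! j) - real_of_int (coord p J x j)))"
      by (simp add: comp_def sum_list_replicate)
    also have "\<dots> = (\<Sum>j\<in>set js. gauge p (\<phi> j (a ! j) - real_of_int (coord p J x j)))"
      by (rule sum_list_distinct_conv_sum_set[OF js_distinct])
    also have "\<dots> \<le> (\<Sum>j\<in>set js. gauge p (a ! j - real_of_int (x ! j)))"
      using js_sub \<phi> x by (intro sum_mono) auto
    also have "\<dots> \<le> (\<Sum>j<d. gauge p (a ! j - real_of_int (x ! j)))"
      using js_sub by (intro sum_mono2) (auto simp: gauge_nonneg)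
    also have "\<dots> = (\<Sum>u\<leftarrow>vec_diff a x. gauge p u)"
      by (simp add: vec_diff_upt[OF a comps_dim[OF c x]] comp_def interv_sum_list_conv_sum_set_nat atLeast0LessThan)
    finally show "(\<Sum>u\<leftarrow>vec_diff ?a (f x). gauge p u) \<le> (\<Sum>u\<leftarrow>vec_diff a x. gauge p u)" .
  qed
  then show ?thesis by (intro exI[of _ ?a]) simp
qed

lemma center_backward:
  assumes c: "c \<in> set Cs" and a: "length a = d'"
  shows "\<exists>a'. length a' = d \<and> (\<forall>x\<in>set c. lp_norm p (vec_diff a' x) \<le> lp_norm p (vec_diff a (f x)))"
proof -
  have "\<exists>\<psi>. \<forall>u. \<forall>x\<in>set c. gauge p (\<psi> u - real_of_int (x ! j)) \<le> gauge p (u - real_of_int (coord p J x j))"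
    if "j < d" for j using coord_transfer[OF c that] by blast
  then obtain \<psi> where \<psi>: "\<And>j u x. j < d \<Longrightarrow> x \<in> set c \<Longrightarrow>
      gauge p (\<psi> j u - real_of_int (x ! j)) \<le> gauge p (u - real_of_int (coord p J x j))"
    by metis
  let ?q = "length js"
  have "\<forall>j\<in>set js. \<exists>i<?q. js ! i = j" by (metis in_set_conv_nth)
  then obtain pos where pos: "\<And>j. j \<in> set js \<Longrightarrow> pos j < ?q \<and> js ! pos j = j" by metis
  have pos_nth: "pos (js ! i) = i" if "i < ?q" for i
    using nth_eq_iff_index_eq[OF js_distinct, of "pos (js ! i)" i] pos[of "js ! i"] that by simp
  define h where "h j = (if j \<in> set js then \<psi> j (a ! pos j) else real_of_int (hd c ! j))" for j
  let ?a = "map h [0..<d]"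
  have "lp_norm p (vec_diff ?a x) \<le> lp_norm p (vec_diff a (f x))" if x: "x \<in> set c" for x
  proof (rule lp_norm_mono)
    have hd: "hd c \<in> set c" using x by (metis list.set_sel(1) empty_iff empty_set)
    let ?g = "\<lambda>i. gauge p (a ! i - real_of_int (coord p J x (js ! i)))"
    have "(\<Sum>u\<leftarrow>vec_diff ?a x. gauge p u) = (\<Sum>j<d. gauge p (h j - real_of_int (x ! j)))"
      by (subst vec_diff_upt[OF _ comps_dim[OF c x]])
        (auto simp: comp_def interv_sum_list_conv_sum_set_nat atLeast0LessThan intro: sum.cong)
    also have "\<dots> = (\<Sum>j\<in>set js. gauge p (h j - real_of_int (x ! j)))"
    proof (rule sum.mono_neutral_right)
      show "\<forall>j\<in>{..<d} - set js. gauge p (h j - real_of_int (x ! j)) = 0"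
        using not_varying[OF c hd x] by (auto simp: h_def)
    qed (use js_sub in auto)
    also have "\<dots> \<le> (\<Sum>j\<in>set js. ?g (pos j))"
    proof (rule sum_mono)
      fix j assume j: "j \<in> set js"
      then have "j < d" using js_sub by auto
      from \<psi>[OF this x, of "a ! pos j"] show "gauge p (h j - real_of_int (x ! j)) \<le> ?g (pos j)"
        using pos[OF j] j by (simp add: h_def)
    qed
    also have "\<dots> = (\<Sum>j\<leftarrow>js. ?g (pos j))" by (rule sum_list_distinct_conv_sum_set[OF js_distinct, symmetric])
    also have "\<dots> = (\<Sum>i<?q. ?g i)"
      by (simp add: sum_list_sum_nth atLeast0LessThan pos_nth)
    also have "\<dots> = (\<Sum>u\<leftarrow>vec_diff (take ?q a) (map (coord p J x) js). gauge p u)"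
      using a by (simp add: sum_list_sum_nth atLeast0LessThan) (simp add: vec_diff_def)
    also have "\<dots> \<le> \<dots> + (\<Sum>u\<leftarrow>vec_diff (drop ?q a) (replicate (Suc b) (separator p J x)). gauge p u)"
      using sum_list_gauge_nonneg by simp
    also have "\<dots> = (\<Sum>u\<leftarrow>vec_diff a (f x). gauge p u)"
    proof -
      have "vec_diff (take ?q a @ drop ?q a) (f x) =
          vec_diff (take ?q a) (map (coord p J x) js) @ vec_diff (drop ?q a) (replicate (Suc b) (separator p J x))"
        unfolding compress_def by (rule vec_diff_append) (use a in simp)
      then show ?thesis by simp
    qed
    finally show "(\<Sum>u\<leftarrow>vec_diff ?a x. gauge p u) \<le> (\<Sum>u\<leftarrow>vec_diff a (f x). gauge p u)" .
  qed
  then show ?thesis by (intro exI[of _ ?a]) simp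
qed

lemma cost_compress:
  assumes c: "c \<in> set Cs" and T: "set_mset T \<subseteq> set c"
  shows "lp.mcost d' p (image_mset f T) = lp.mcost d p T"
proof (rule antisym)
  show "lp.mcost d' p (image_mset f T) \<le> lp.mcost d p T"
  proof (rule lp.mcost_ge)
    fix a :: "real list" assume "a \<in> {a. length a = d}"
    then obtain a' where a': "length a' = d'" "\<forall>x\<in>set c. lp_norm p (vec_diff a' (f x)) \<le> lp_norm p (vec_diff a x)"
      using center_forward[OF c, of a] by auto
    have "lp.mcost d' p (image_mset f T) \<le> lp.wsum p a' (image_mset f T)"
      using a'(1) by (intro lp.mcost_le) auto
    also have "\<dots> \<le> lp.wsum p a T"
      using T a'(2) unfolding lp.wsum_def image_mset.compositionality comp_def
      by (intro sum_mset_mono) auto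
    finally show "lp.mcost d' p (image_mset f T) \<le> lp.wsum p a T" .
  qed
  show "lp.mcost d p T \<le> lp.mcost d' p (image_mset f T)"
  proof (rule lp.mcost_ge)
    fix a :: "real list" assume "a \<in> {a. length a = d'}"
    then obtain a' where a': "length a' = d" "\<forall>x\<in>set c. lp_norm p (vec_diff a' x) \<le> lp_norm p (vec_diff a (f x))"
      using center_backward[OF c, of a] by auto
    have "lp.mcost d p T \<le> lp.wsum p a' T"
      using a'(1) T comps_dim[OF c] by (intro lp.mcost_le) auto
    also have "\<dots> \<le> lp.wsum p a (image_mset f T)"
      using T a'(2) unfolding lp.wsum_def image_mset.compositionality comp_def
      by (intro sum_mset_mono) auto
    finally show "lp.mcost d p T \<le> lp.wsum p a (image_mset f T)" .
  qed
qed

lemma dist_nrm: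
  assumes "length x = m" "length y = m"
  shows "lp_norm p (vec_diff (map real_of_int x) y) = nrm p m (\<lambda>i. real_of_int (x ! i) - real_of_int (y ! i))"
  using assms by (subst lp_norm_nrm[where d = m]) (auto intro: nrm_cong)

lemma near_same:
  assumes x: "x \<in> set (reps J)" and y: "y \<in> set (reps J)"
    and "lp_norm p (vec_diff (map real_of_int x) y) \<le> real B"
  shows "cof p J x = cof p J y"
proof -
  have len: "length x = d" "length y = d" using x y reps_length by auto
  have nrm: "nrm p d (\<lambda>i. real_of_int (x ! i) - real_of_int (y ! i)) \<le> real B"
    using assms(3) dist_nrm[OF len] by simp
  have "card (diffs x y) \<le> D"
  proof (cases "b = B")
    case True
    then show ?thesis using nrm_le_imp_close(1)[OF nrm] by (simp add: diffs_def)
  next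
    case False
    then have b: "b = length X + d" using b_cases by blast
    have "card (diffs x y) \<le> card {..<d}" by (rule card_mono) (auto simp: diffs_def)
    also have "\<dots> \<le> b" using b by simp
    also have "b \<le> D" using d_pos b by (intro self_le_power) auto
    finally show ?thesis .
  qed
  moreover have "p = 0 \<or> (\<forall>j<d. \<bar>x ! j - y ! j\<bar> \<le> int B)"
    using nrm_le_imp_close(2)[OF nrm] by blast
  ultimately show ?thesis using close_cof[OF x y] close_iff[OF len] by blast
qed

lemma f_sep: "length js \<le> i \<Longrightarrow> i < d' \<Longrightarrow> f x ! i = separator p J x"
  by (simp add: compress_def nth_append nth_replicate del: replicate_Suc)

lemma far_compress:
  assumes x: "x \<in> set (reps J)" and y: "y \<in> set (reps J)" and ne: "cof p J x \<noteq> cof p J y"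
  shows "real B + 1 \<le> lp_norm p (vec_diff (map real_of_int (f x)) (f y))"
proof -
  have sep: "int B < \<bar>separator p J x - separator p J y\<bar>" by (rule separator_diff[OF assms])
  have "real B + 1 \<le> nrm p d' (\<lambda>i. real_of_int (f x ! i) - real_of_int (f y ! i))"
  proof (rule far_imp_nrm_ge)
    assume p: "p = 0"
    have len: "length x = d" "length y = d" using x y reps_length by auto
    have "\<not> close p J x y" using close_cof[OF x y] ne by blast
    then have "\<not> card (diffs x y) \<le> b" using close_iff[OF len] p by simp
    moreover have "card (diffs x y) \<le> card {..<d}" by (rule card_mono) (auto simp: diffs_def)
    ultimately have "b = B" using b_cases by auto
    have "{length js..<d'} \<subseteq> {i. i < d' \<and> f x ! i \<noteq> f y ! i}"
      using sep f_sep[of _ x] f_sep[of _ y] by auto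
    then have "card {length js..<d'} \<le> card {i. i < d' \<and> f x ! i \<noteq> f y ! i}" by (intro card_mono) auto
    then show "B < card {i. i < d' \<and> f x ! i \<noteq> f y ! i}" using \<open>b = B\<close> by simp
  next
    show "\<exists>i<d'. int B < \<bar>f x ! i - f y ! i\<bar>"
      using sep f_sep[of "length js" x] f_sep[of "length js" y] by (intro exI[of _ "length js"]) simp
  qed
  then show ?thesis using dist_nrm[of "f x" d' "f y"] by simp
qed

lemma f_inj: "inj_on f (set (reps J))"
proof (rule inj_onI)
  fix x y assume x: "x \<in> set (reps J)" and y: "y \<in> set (reps J)" and eq: "f x = f y"
  have "separator p J x = separator p J y" using eq f_sep[of "length js"] by (metis add_Suc_right le_refl less_add_Suc1)
  then have cof_xy: "cof p J x = cof p J y" using separator_diff[OF x y] by fastforce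
  let ?c = "cof p J x"
  have c: "?c \<in> set Cs" "x \<in> set ?c" "y \<in> set ?c" using cof[OF x] cof[OF y] cof_xy by auto
  have coords: "coord p J x j = coord p J y j" if "j \<in> set js" for j
  proof -
    have "map (coord p J x) js = map (coord p J y) js"
      using eq unfolding compress_def by (simp add: append_eq_append_conv)
    then show ?thesis using that by simp
  qed
  show "x = y"
  proof (rule nth_equalityI)
    show "length x = length y" using x y reps_length by simp
    fix j assume "j < length x"
    then have j: "j < d" using x reps_length by simp
    show "x ! j = y ! j"
    proof (cases "j \<in> set js")
      case True
      then show ?thesis using coords coord_eq_iff[OF c j] by blast
    next
      case False
      then show ?thesis using not_varying[OF c j] by blast
    qed
  qed
qed

lemma expand_f: "x \<in> set (reps J) \<Longrightarrow> expand p J (f x) = x"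
proof -
  assume x: "x \<in> set (reps J)"
  have "filter (\<lambda>z. f z = f x) (reps J) \<noteq> []" using x by (auto simp: filter_empty_conv)
  then have "expand p J (f x) \<in> set (filter (\<lambda>z. f z = f x) (reps J))" unfolding expand_def by (rule hdd_in)
  then show ?thesis using f_inj x by (auto dest: inj_onD)
qed

lemma cluster_in_comp:
  assumes T: "set_mset T \<subseteq> set (reps J)" "T \<noteq> {#}"
    and near: "\<And>x y. x \<in># T \<Longrightarrow> y \<in># T \<Longrightarrow> x \<noteq> y \<Longrightarrow> cof p J x = cof p J y"
  shows "\<exists>c\<in>set Cs. set_mset T \<subseteq> set c"
proof -
  obtain x where x: "x \<in># T" using T(2) by blast
  have "y \<in> set (cof p J x)" if "y \<in># T" for y
    using near[OF that x] cof(2)[of y] T(1) that by (cases "y = x") auto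
  then show ?thesis using cof(1)[of x] x T(1) by blast
qed

lemma cheap_compress:
  assumes T: "set_mset T \<subseteq> set (reps J)"
    and cheap: "lp.mcost d p T \<le> real B \<or> lp.mcost d' p (image_mset f T) \<le> real B"
  shows "lp.mcost d' p (image_mset f T) = lp.mcost d p T"
proof (cases "T = {#}")
  case True
  then show ?thesis using lp.mcost_replicate[of "replicate d' 0" d' p 0] lp.mcost_replicate[of "replicate d 0" d p 0] by simp
next
  case False
  have "cof p J x = cof p J y" if xy: "x \<in># T" "y \<in># T" "x \<noteq> y" for x y
  proof (rule ccontr)
    assume ne: "cof p J x \<noteq> cof p J y"
    have P: "x \<in> set (reps J)" "y \<in> set (reps J)" using T xy by auto
    from cheap show False
    proof
      assume cheap: "lp.mcost d p T \<le> real B"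
      have "lp_norm p (vec_diff (map real_of_int x) y) \<le> lp.mcost d p T"
        using T reps_length xy by (intro lp.pair_dist) auto
      then show False using near_same[OF P] cheap ne by simp
    next
      assume cheap: "lp.mcost d' p (image_mset f T) \<le> real B"
      have "f x \<noteq> f y" using f_inj P xy(3) by (auto dest: inj_onD)
      then have "lp_norm p (vec_diff (map real_of_int (f x)) (f y)) \<le> lp.mcost d' p (image_mset f T)"
        using xy by (intro lp.pair_dist) auto
      then show False using far_compress[OF P ne] cheap by simp
    qed
  qed
  then obtain c where "c \<in> set Cs" "set_mset T \<subseteq> set c" using cluster_in_comp[OF T False] by blast
  then show ?thesis by (rule cost_compress)
qed

end

lemma finite_sols: "finite (sols (equal_clustering p) I)"
  by (cases I; cases "fst I") (auto simp: equal_clustering_def finite_equal_clusterings)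

lemma opt_le_val: "C \<in> sols (equal_clustering p) I \<Longrightarrow> opt (equal_clustering p) I \<le> sol_val (equal_clustering p) I C"
  unfolding opt_def by (intro Min_le) (auto simp: finite_sols)

context kernel_inst
begin

abbreviation val :: "point list list \<Rightarrow> real" where
  "val \<equiv> sol_val (equal_clustering p) J"

lemma val_eq: "val C = (if lp.lcost d p C \<le> real B then lp.lcost d p C else real B + 1)"
  by (simp add: equal_clustering_def clustering_cost_def cost_eq_mcost lp.lcost_def d_eq Let_def)

lemma val_le: "val C \<le> real B + 1"
  by (simp add: val_eq)

lemma lcost_nonneg: "clus s M C \<Longrightarrow> 0 \<le> lp.lcost d p C"
  unfolding lp.lcost_nth using lp.clus_mcost_nonneg[OF _ M_dim] by (intro sum_nonneg) auto

lemma val_nonneg: "C \<in> sols (equal_clustering p) J \<Longrightarrow> 0 \<le> val C"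
  using lcost_nonneg sols_iff by (simp add: val_eq)

lemma opt_attained: "\<exists>C\<in>sols (equal_clustering p) J. val C = opt (equal_clustering p) J"
proof -
  have "val ` sols (equal_clustering p) J \<noteq> {}" using default_sol by blast
  then have "opt (equal_clustering p) J \<in> val ` sols (equal_clustering p) J"
    unfolding opt_def using finite_sols by (intro Min_in) auto
  then show ?thesis by force
qed

lemma opt_nonneg: "0 \<le> opt (equal_clustering p) J"
  using opt_attained val_nonneg by force

lemma ratio_ge_1: "C \<in> sols (equal_clustering p) J \<Longrightarrow> 1 \<le> approx_ratio (equal_clustering p) J C"
  using opt_le_val[of C p J] opt_nonneg by (simp add: approx_ratio_def)

lemma M''_M': "t = 0 \<Longrightarrow> M'' = M'"
  by (rule multiset_eqI) (simp add: count_M'' del: mset_concat)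

lemma M'_less: "count M' x < s"
  using s_pos by (simp add: count_M' del: mset_concat)

lemma trim_exists:
  assumes C: "clus s M' C" "lp.lcost d p C \<le> real B"
  shows "\<exists>C'. clus (s - t) M'' C' \<and> length C' = kres J \<and> lp.lcost d p C' \<le> lp.lcost d p C"
    and "t > 0 \<Longrightarrow> B < count M' x \<Longrightarrow> t + B < count M' x"
proof -
  have t: "2 * B + 2 \<le> s" "t = s - (2 * B + 2)" "\<And>x. count M'' x = count M' x - (if B < count M' x then t else 0)"
    if "t > 0" using t_pos[OF that] count_M'' by (simp_all add: tnum_def)
  show "\<exists>C'. clus (s - t) M'' C' \<and> length C' = kres J \<and> lp.lcost d p C' \<le> lp.lcost d p C"
  proof (cases "t = 0")
    case True
    then show ?thesis using C clus_kres M''_M' by (intro exI[of _ C]) simp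
  next
    case False
    then show ?thesis
      using lp.trim_forward(1)[OF C(1) M'_dim C(2) t(1) M'_less t(2,3)] clus_kres[OF C(1)] by auto
  qed
  show "t + B < count M' x" if "t > 0" "B < count M' x"
    by (rule lp.trim_forward(2)[OF C(1) M'_dim C(2) t(1)[OF that(1)] M'_less t(2)[OF that(1)] t(3)[OF that(1)] that(2)])
qed

lemma residue_exists:
  assumes C: "clus s M C" "lp.lcost d p C \<le> real B"
  shows "\<exists>C'. clus s M' C' \<and> lp.lcost d p C' \<le> (if s \<le> B then 2 - 2 / real s else 1) * lp.lcost d p C"
  using count_M' by (intro lp.residue[OF C(1) M_dim s_pos C(2)]) blast

lemma good_if:
  assumes C: "clus s M C" "lp.lcost d p C \<le> real B" and pos: "\<And>C'. clus s M C' \<Longrightarrow> 0 < lp.lcost d p C'"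
  shows "good J"
  unfolding good_def
proof (intro conjI)
  show "resid J \<noteq> []"
  proof
    assume "resid J = []"
    then have "clus s M' []" by (simp add: clus_def)
    from homog_split[OF this] have "0 < lp.lcost d p (homog J)" using pos by simp
    then show False using homog_cost by simp
  qed
  have len: "length (resid J) = length (reps J)" by (simp add: resid_eq)
  have "length (reps J) \<le> 2 * B"
    unfolding reps_card by (rule lp.indivisible_bound[OF C(1) M_dim C(2)])
  moreover have "length (reps J) \<le> length X"
    unfolding reps_eq using length_filter_le length_remdups_leq le_trans by blast
  ultimately show "length (resid J) \<le> 2 * b" unfolding len using b_cases by auto
  show "length Y = kres J * (s - t)"
  proof (cases "t = 0")
    case True
    then show ?thesis using M''_M' kres_eq by (metis diff_zero size_mset)
  next
    case False
    then have "\<not> s \<le> B" using t_pos by simp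
    then obtain C1 where "clus s M' C1" "lp.lcost d p C1 \<le> lp.lcost d p C"
      using residue_exists[OF C] by auto
    then obtain C2 where C2: "clus (s - t) M'' C2" "length C2 = kres J"
      using trim_exists(1)[of C1] C(2) by auto
    from clus_size[OF C2(1)] show ?thesis by (simp only: size_mset C2(2))
  qed
qed

lemma s_t_pos: "s - t > 0"
  using s_pos t_eq by simp

lemma good_kres: "good J \<Longrightarrow> kres J \<ge> 1"
proof (rule ccontr)
  assume g: "good J" and "\<not> kres J \<ge> 1"
  then have "kres J = 0" by linarith
  then have "length (concat (resid J)) = 0" using kres_eq by simp
  then have "concat (resid J) = []" by (simp only: length_0_conv)
  then show False using g by (auto simp: good_def resid_def filter_empty_conv)
qed

abbreviation X' :: "point list" where "X' \<equiv> map f Y"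

lemma kernel_good: "good J \<Longrightarrow> kernelize p J = ((X', kres J), B)"
  by (simp add: kernelize_def)

lemma kernel_inst_good:
  assumes "good J"
  shows "kernel_inst X' (kres J) B"
proof
  have len: "length X' = kres J * (s - t)" using assms by (simp add: good_def)
  then have ne: "X' \<noteq> []" using good_kres[OF assms] s_t_pos by fastforce
  then have "hd X' \<in> set X'" by (rule hd_in_set)
  then have "dimension X' = d'" unfolding dimension_def by auto
  then show "((X', kres J), B) \<in> equal_clustering_insts"
    using ne len good_kres[OF assms] by (auto simp: equal_clustering_insts_def)
qed

lemma kernel_size_good:
  assumes "good J"
  shows "csize ((X', kres J), B) = s - t" "dimn ((X', kres J), B) = d'"
proof -
  interpret K: kernel_inst p X' "kres J" B by (rule kernel_inst_good[OF assms])
  have len: "length X' = kres J * (s - t)" using assms by (simp add: good_def)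
  then show "csize ((X', kres J), B) = s - t" using good_kres[OF assms] K.s_eq by simp
  have "hd X' \<in> set X'" using K.X_ne by (rule hd_in_set)
  then show "dimn ((X', kres J), B) = d'" using K.d_eq unfolding dimension_def by auto
qed

lemma lcost_compress:
  assumes C: "clus m M'' C" and cheap: "lp.lcost d p C \<le> real B \<or> lp.lcost d' p (map (map f) C) \<le> real B"
  shows "lp.lcost d' p (map (map f) C) = lp.lcost d p C"
proof -
  have C': "clus m (image_mset f M'') (map (map f) C)"
    using C by (auto simp: clus_def map_concat[symmetric] simp del: mset_concat)
  have dim: "set_mset (image_mset f M'') \<subseteq> {x. length x = d'}" by auto
  have "lp.mcost d' p (mset (map f (C ! j))) = lp.mcost d p (mset (C ! j))" if j: "j < length C" for j
  proof -
    have "lp.mcost d p (mset (C ! j)) \<le> real B \<or> lp.mcost d' p (image_mset f (mset (C ! j))) \<le> real B"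
      using cheap lp.mcost_le_lcost[OF C M''_dim j, of p] lp.mcost_le_lcost[OF C' dim, of j p] j by auto
    moreover have "set_mset (mset (C ! j)) \<subseteq> set (reps J)"
      using clus_sub[OF C nth_mem[OF j]] M''_sub by simp
    ultimately show ?thesis using cheap_compress[of "mset (C ! j)"] by simp
  qed
  then show ?thesis by (simp add: lp.lcost_nth)
qed

lemma kernel_opt_le:
  assumes C: "clus s M C" "lp.lcost d p C \<le> real B" and good: "good J"
  shows "opt (equal_clustering p) (kernelize p J) \<le> 2 * lp.lcost d p C"
proof -
  interpret K: kernel_inst p X' "kres J" B by (rule kernel_inst_good[OF good])
  let ?L = "lp.lcost d p C"
  have L: "0 \<le> ?L" by (rule lcost_nonneg[OF C(1)])
  obtain C1 where C1: "clus s M' C1" "lp.lcost d p C1 \<le> (if s \<le> B then 2 - 2 / real s else 1) * ?L"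
    using residue_exists[OF C] by blast
  show ?thesis
  proof (cases "lp.lcost d p C1 \<le> real B")
    case True
    then obtain C2 where C2: "clus (s - t) M'' C2" "length C2 = kres J" "lp.lcost d p C2 \<le> lp.lcost d p C1"
      using trim_exists(1)[OF C1(1)] by blast
    have le2: "lp.lcost d p C2 \<le> 2 * ?L"
    proof -
      have "(if s \<le> B then 2 - 2 / real s else 1) * ?L \<le> 2 * ?L" using L by (intro mult_right_mono) auto
      then show ?thesis using C2(3) C1(2) by linarith
    qed
    let ?C = "map (map f) C2"
    have cost: "lp.lcost d' p ?C = lp.lcost d p C2" using C2(3) True by (intro lcost_compress[OF C2(1)]) auto
    have "clus (s - t) (mset X') ?C"
      using C2(1) by (auto simp: clus_def map_concat[symmetric] simp del: mset_concat map_concat)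
    then have "?C \<in> sols (equal_clustering p) ((X', kres J), B)"
      using C2(2) K.sols_iff kernel_size_good(1)[OF good] by simp
    then have "opt (equal_clustering p) (kernelize p J) \<le> K.val ?C"
      unfolding kernel_good[OF good] by (rule opt_le_val)
    also have "\<dots> \<le> 2 * ?L"
      using K.val_eq[of ?C] cost le2 C2(3) True kernel_size_good(2)[OF good] by simp
    finally show ?thesis .
  next
    case False
    have s: "s \<le> B"
    proof (rule ccontr)
      assume "\<not> s \<le> B"
      then show False using C1(2) C(2) False by simp
    qed
    have "real B < (2 - 2 / real s) * ?L" using False C1(2) s by simp
    then have "real B * real s < (2 - 2 / real s) * ?L * real s" using s_pos by simp
    also have "\<dots> = 2 * ?L * (real s - 1)" using s_pos by (simp add: field_simps)
    finally have less: "real B * real s < 2 * ?L * (real s - 1)" .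
    have "real B + 1 \<le> 2 * ?L"
    proof (rule ccontr)
      assume "\<not> real B + 1 \<le> 2 * ?L"
      then have "2 * ?L * (real s - 1) \<le> (real B + 1) * (real s - 1)" using s_pos by (intro mult_right_mono) auto
      also have "\<dots> = real B * real s + (real s - real B) - 1" by (simp add: algebra_simps)
      also have "\<dots> \<le> real B * real s" using s by simp
      finally show False using less by simp
    qed
    moreover obtain C' where "C' \<in> sols (equal_clustering p) ((X', kres J), B)" using K.default_sol by blast
    then have "opt (equal_clustering p) (kernelize p J) \<le> real B + 1"
      unfolding kernel_good[OF good] using opt_le_val K.val_le order_trans by blast
    ultimately show ?thesis by linarith
  qed
qed

lemma lift_cost:
  assumes C: "clus s M C" "lp.lcost d p C \<le> real B" and good: "good J"
    and C': "C' \<in> sols (equal_clustering p) (kernelize p J)" "lp.lcost d' p C' \<le> real B"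
  shows "lp.lcost d p (lift_sol p (J, K', C')) \<le> lp.lcost d' p C'"
proof -
  interpret K: kernel_inst p X' "kres J" B by (rule kernel_inst_good[OF good])
  have clusC': "clus (s - t) (mset X') C'"
    using C'(1) K.sols_iff kernel_size_good(1)[OF good] unfolding kernel_good[OF good] by simp
  let ?C2 = "map (map (expand p J)) C'"
  have f_expand: "f (expand p J y) = y \<and> expand p J y \<in> set (reps J)" if y: "y \<in> set X'" for y
  proof -
    obtain x where "x \<in> set Y" "y = f x" using y unfolding set_map by blast
    moreover from this have "x \<in> set (reps J)" using M''_sub by auto
    ultimately show ?thesis using expand_f by simp
  qed
  have "mset (concat ?C2) = image_mset (expand p J) (mset (concat C'))" by (simp only: map_concat[symmetric] mset_map)
  also have "\<dots> = image_mset (expand p J) (image_mset f M'')" using clusC' by (simp only: clus_def mset_map)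
  also have "\<dots> = image_mset (\<lambda>x. x) M''"
    unfolding image_mset.compositionality comp_def using expand_f M''_sub by (intro image_mset_cong) blast
  finally have C2: "clus (s - t) M'' ?C2" using clusC' by (auto simp: clus_def)
  have "map f (map (expand p J) T) = T" if T: "T \<in> set C'" for T
  proof -
    have "set T \<subseteq> set X'" using clus_sub[OF clusC' T] by simp
    then have "map (\<lambda>y. f (expand p J y)) T = map (\<lambda>y. y) T"
      using f_expand by (intro map_cong refl) blast
    then show ?thesis by (simp add: comp_def)
  qed
  then have back_eq: "map (map f) ?C2 = C'" by (simp add: map_idI comp_def)
  have cost2: "lp.lcost d p ?C2 = lp.lcost d' p C'"
    using lcost_compress[OF C2] C'(2) unfolding back_eq by simp
  have "\<exists>C1. clus s M' C1 \<and> lp.lcost d p C1 \<le> real B"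
  proof (cases "t = 0")
    case True
    then show ?thesis using C2 cost2 C'(2) M''_M' by (intro exI[of _ ?C2]) simp
  next
    case False
    then have "\<not> s \<le> B" using t_pos by simp
    then show ?thesis using residue_exists[OF C] C(2) by auto
  qed
  then obtain C1 where C1: "clus s M' C1" "lp.lcost d p C1 \<le> real B" by blast
  have grow: "clus s M' (map (grow J) ?C2) \<and> lp.lcost d p (map (grow J) ?C2) \<le> lp.lcost d p ?C2"
  proof (cases "t = 0")
    case True
    then have "grow J = (\<lambda>T. T)" by (intro ext) (simp add: grow_def)
    then show ?thesis using C2 True M''_M' by simp
  next
    case False
    then have t: "2 * B + 2 < s" "b = B" using t_pos by auto
    then have st: "s - t = 2 * B + 2" using t_eq by simp
    have big: "t + B < count M' x" if "B < count M' x" for x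
      using trim_exists(2)[OF C1] that False by simp
    have cnt: "count M'' x = count M' x - (if B < count M' x then t else 0)" for x
      using count_M''[of x] t(2) by simp
    have "clus (s - t + t) M' (map (\<lambda>T. T @ replicate t (majority J T)) ?C2) \<and>
      lp.lcost d p (map (\<lambda>T. T @ replicate t (majority J T)) ?C2) \<le> lp.lcost d p ?C2"
    proof (rule lp.trim_backward[OF C2 M''_dim])
      show "lp.lcost d p ?C2 \<le> real B" using cost2 C'(2) by simp
      show "2 * B + 2 \<le> s - t" using st by simp
      show "count M'' x < s - t" for x using cnt[of x] M'_less[of x] big[of x] st by (auto split: if_splits)
      show "count M' x = count M'' x + (if B < count M'' x then t else 0)" for x
        using cnt[of x] big[of x] by (auto split: if_splits)
      fix T x
      assume T: "T \<in> set ?C2" "B < count (mset T) x" "\<And>y. y \<noteq> x \<Longrightarrow> count (mset T) y \<le> B"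
      have "x \<in> set T" using T(2) by (metis count_eq_zero_iff not_less_zero set_mset_mset)
      then have "filter (\<lambda>y. b < length (filter (\<lambda>z. z = y) T)) T \<noteq> []"
        using T(2) t(2) by (auto simp: filter_empty_conv length_filter_eq)
      then have "majority J T \<in> set (filter (\<lambda>y. b < length (filter (\<lambda>z. z = y) T)) T)"
        unfolding majority_def by (rule hdd_in)
      then have "B < count (mset T) (majority J T)" using t(2) by (simp add: length_filter_eq)
      then show "majority J T = x" using T(3) not_less by blast
    qed
    moreover have "s - t + t = s" by (simp add: tnum_def)
    ultimately show ?thesis unfolding grow_def[abs_def] by simp
  qed
  have cand: "cand p J C' = homog J @ map (grow J) ?C2" by (simp add: cand_def comp_def)
  have "clus s M (cand p J C')" unfolding cand using grow homog_split by blast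
  then have "valid J (cand p J C')" using valid_iff sols_iff clus_length by blast
  then have "lift_sol p (J, K', C') = homog J @ map (grow J) ?C2" by (simp add: lift_sol_def cand)
  then have "lp.lcost d p (lift_sol p (J, K', C')) = lp.lcost d p (homog J) + lp.lcost d p (map (grow J) ?C2)"
    by (simp add: lp.lcost_def)
  then show ?thesis using homog_cost grow cost2 by simp
qed

lemma approx_ratio_lift:
  assumes C': "C' \<in> sols (equal_clustering p) (kernelize p J)" and K: "kernelize p J \<in> equal_clustering_insts"
  shows "approx_ratio (equal_clustering p) J (lift_sol p (J, K', C')) \<le>
    2 * approx_ratio (equal_clustering p) (kernelize p J) C'"
proof -
  let ?opt = "opt (equal_clustering p) J" and ?lift = "lift_sol p (J, K', C')"
  let ?opt' = "opt (equal_clustering p) (kernelize p J)" and ?val' = "sol_val (equal_clustering p) (kernelize p J)"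
  obtain Xk kk Bk where Kk: "kernelize p J = ((Xk, kk), Bk)" by (metis prod.collapse)
  interpret K0: kernel_inst p Xk kk Bk using K by unfold_locales (simp add: Kk)
  have ge1: "1 \<le> approx_ratio (equal_clustering p) (kernelize p J) C'"
    using K0.ratio_ge_1 C' by (simp add: Kk)
  obtain C where C: "C \<in> sols (equal_clustering p) J" "val C = ?opt" using opt_attained by blast
  consider "?opt = 0" | "\<not> lp.lcost d p C \<le> real B" | "?opt > 0" "lp.lcost d p C \<le> real B"
    using opt_nonneg by fastforce
  then show ?thesis
  proof cases
    case 1
    then have "approx_ratio (equal_clustering p) J ?lift = 1" by (simp add: approx_ratio_def)
    then show ?thesis using ge1 by simp
  next
    case 2
    then have "?opt = real B + 1" using C(2) by (simp add: val_eq)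
    then have "approx_ratio (equal_clustering p) J ?lift \<le> 1"
      using val_le[of ?lift] by (simp add: approx_ratio_def)
    then show ?thesis using ge1 by simp
  next
    case 3
    have clusC: "clus s M C" using C(1) sols_iff by simp
    have L: "lp.lcost d p C = ?opt" using C(2) 3(2) by (simp add: val_eq)
    have pos: "0 < lp.lcost d p C''" if "clus s M C''" for C''
    proof (rule ccontr)
      assume "\<not> 0 < lp.lcost d p C''"
      then have "val C'' \<le> 0" by (simp add: val_eq)
      moreover have "C'' \<in> sols (equal_clustering p) J" using that sols_iff clus_length by blast
      ultimately show False using opt_le_val 3(1) by fastforce
    qed
    have good: "good J" by (rule good_if[OF clusC 3(2) pos])
    interpret K: kernel_inst p X' "kres J" B by (rule kernel_inst_good[OF good])
    have val': "?val' C'' = (if lp.lcost d' p C'' \<le> real B then lp.lcost d' p C'' else real B + 1)" for C''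
      using K.val_eq[of C''] kernel_size_good(2)[OF good] kernel_good[OF good] by simp
    have lift_le: "val (lift_sol p (J, K', C'')) \<le> ?val' C''" if "C'' \<in> sols (equal_clustering p) (kernelize p J)" for C''
    proof (cases "lp.lcost d' p C'' \<le> real B")
      case True
      then show ?thesis using lift_cost[OF clusC 3(2) good that True, of K'] val' by (simp add: val_eq)
    next
      case False
      then show ?thesis using val_le val' by simp
    qed
    have lift_ge: "?opt \<le> val (lift_sol p (J, K', C''))" for C''
      by (rule opt_le_val[OF lift_sol_sols])
    have opt'_le: "?opt' \<le> 2 * ?opt" using kernel_opt_le[OF clusC 3(2) good] L by simp
    obtain C'' where "C'' \<in> sols (equal_clustering p) (kernelize p J)" "?val' C'' = ?opt'"
      using K.opt_attained kernel_good[OF good] by auto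
    then have opt'_pos: "0 < ?opt'" using lift_le lift_ge[of C''] 3(1) by fastforce
    have v: "val ?lift \<le> ?val' C'" "0 < ?val' C'" using lift_le[OF C'] lift_ge[of C'] 3(1) by auto
    have "val ?lift / ?opt \<le> ?val' C' / ?opt" using v 3(1) by (simp add: divide_right_mono)
    also have "\<dots> \<le> 2 * (?val' C' / ?opt')"
    proof -
      have "?val' C' * ?opt' \<le> ?val' C' * (2 * ?opt)" using opt'_le v(2) by (intro mult_left_mono) auto
      then show ?thesis using opt'_pos 3(1) by (simp add: field_simps)
    qed
    finally show ?thesis using 3(1) opt'_pos by (simp add: approx_ratio_def)
  qed
qed

lemma kernel_bounds:
  assumes good: "good J"
  shows "length X' \<le> 2 * B * (2 * B + 2)" "d' \<le> 2 * B * B ^ max p 1 + B + 1"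
    "x \<in> set X' \<Longrightarrow> a \<in> set x \<Longrightarrow> \<bar>a\<bar> \<le> int (2 * B * (B + 1))"
proof -
  have reps: "length (reps J) \<le> 2 * B"
    using good b_le resid_eq by (simp add: good_def)
  have part: "r x - (if b < r x then t else 0) \<le> 2 * B + 2" for x
  proof (cases "b < r x")
    case True
    have "r x < s" using s_pos by simp
    then show ?thesis using True t_eq b_le by simp
  next
    case False
    then show ?thesis using b_le by simp
  qed
  have "length Y = (\<Sum>x\<leftarrow>reps J. r x - (if b < r x then t else 0))"
    by (simp add: trimmed_eq length_concat comp_def)
  also have "\<dots> \<le> (\<Sum>x\<leftarrow>reps J. 2 * B + 2)" using part by (intro sum_list_mono)
  also have "\<dots> = length (reps J) * (2 * B + 2)" by (simp add: sum_list_triv)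
  also have "\<dots> \<le> 2 * B * (2 * B + 2)" using reps by (rule mult_le_mono1)
  finally show "length X' \<le> 2 * B * (2 * B + 2)" by simp
  have "length js \<le> length (reps J) * D" by (rule length_varying)
  also have "\<dots> \<le> 2 * B * B ^ max p 1" using reps b_le by (intro mult_le_mono power_mono) auto
  finally show "d' \<le> 2 * B * B ^ max p 1 + B + 1" using b_le by simp
  show "\<bar>a\<bar> \<le> int (2 * B * (B + 1))" if xa: "x \<in> set X'" "a \<in> set x"
  proof -
    obtain y where y: "y \<in> set Y" "x = f y" using xa(1) unfolding set_map by blast
    then have yr: "y \<in> set (reps J)" using M''_sub by auto
    have "a \<in> coord p J y ` set js \<or> a = separator p J y"
      using xa(2) y(2) by (auto simp: compress_def)
    then have "\<bar>a\<bar> \<le> int (length (reps J) * (B + 1))"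
      using abs_coord_le[OF yr] abs_separator_le[of y] js_sub by auto
    also have "\<dots> \<le> int (2 * B * (B + 1))" using reps by (intro of_nat_mono mult_le_mono1)
    finally show ?thesis .
  qed
qed

end

subsection \<open>The kernel\<close>

lemma size_enc_list_le:
  assumes "\<And>x. x \<in> set l \<Longrightarrow> size (e x) \<le> m"
  shows "size (enc_list e l) \<le> length l * (m + 1)"
  using assms
proof (induction l)
  case (Cons x l)
  then have "size (e x) \<le> m" "size (enc_list e l) \<le> length l * (m + 1)" by auto
  then show ?case by simp
qed simp

lemma size_enc_nat_linear: "size (enc_nat n) \<le> 2 * n"
  using size_enc_nat_le[of n] length_bits_le_self[of n] by linarith

lemma size_enc_int_le: "\<bar>a\<bar> \<le> int m \<Longrightarrow> size (enc_int a) \<le> 2 + 2 * m"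
  using size_enc_nat_linear[of "nat \<bar>a\<bar>"] size_enc_bool_le[of "a < 0"] by (simp add: enc_int_def)

definition Nb :: "nat \<Rightarrow> nat" where "Nb B = 2 * B * (2 * B + 2) + 1"
definition Db :: "nat \<Rightarrow> nat \<Rightarrow> nat" where "Db p B = 2 * B * B ^ max p 1 + B + 1"
definition Mb :: "nat \<Rightarrow> nat" where "Mb B = 2 * B * (B + 1)"
definition gb :: "nat \<Rightarrow> nat \<Rightarrow> nat" where
  "gb p B = Nb B * (Db p B * (2 + 2 * Mb B + 1) + 1) + 2 * Nb B + 1 + B"

lemma kernel_spec:
  assumes "J \<in> equal_clustering_insts"
  shows "kernelize p J \<in> equal_clustering_insts" "snd (kernelize p J) \<le> snd J"
    "length (pts (kernelize p J)) \<le> Nb (snd J)" "dimension (pts (kernelize p J)) \<le> Db p (snd J)"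
    "x \<in> set (pts (kernelize p J)) \<Longrightarrow> a \<in> set x \<Longrightarrow> \<bar>a\<bar> \<le> int (Mb (snd J))"
proof -
  obtain X k B where J: "J = ((X, k), B)" by (metis prod.collapse)
  interpret kernel_inst p X k B using assms by unfold_locales (simp add: J)
  have "kernelize p J \<in> equal_clustering_insts \<and> snd (kernelize p J) \<le> B \<and>
    length (pts (kernelize p J)) \<le> Nb B \<and> dimension (pts (kernelize p J)) \<le> Db p B \<and>
    (\<forall>x\<in>set (pts (kernelize p J)). \<forall>a\<in>set x. \<bar>a\<bar> \<le> int (Mb B))"
  proof (cases "good J")
    case True
    then have good: "good ((X, k), B)" by (simp add: J)
    interpret K: kernel_inst p X' "kres ((X, k), B)" B by (rule kernel_inst_good[OF good])
    have "dimension X' = d'" using K.d_eq kernel_size_good(2)[OF good] by simp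
    then show ?thesis
      using kernel_good[OF good] K.inst kernel_bounds[OF good] unfolding J
      by (auto simp: Nb_def Db_def Mb_def)
  next
    case False
    then show ?thesis
      by (auto simp: kernelize_def equal_clustering_insts_def dimension_def Nb_def Db_def)
  qed
  then show "kernelize p J \<in> equal_clustering_insts" "snd (kernelize p J) \<le> snd J"
    "length (pts (kernelize p J)) \<le> Nb (snd J)" "dimension (pts (kernelize p J)) \<le> Db p (snd J)"
    "x \<in> set (pts (kernelize p J)) \<Longrightarrow> a \<in> set x \<Longrightarrow> \<bar>a\<bar> \<le> int (Mb (snd J))"
    by (auto simp: J)
qed

lemma kernel_enc_size:
  assumes "J \<in> equal_clustering_insts"
  shows "size (enc_main (equal_clustering p) (fst (kernelize p J))) + snd (kernelize p J) \<le> gb p (snd J)"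
proof -
  let ?B = "snd J"
  note spec = kernel_spec[OF assms]
  obtain X k B' where K: "kernelize p J = ((X, k), B')" by (metis prod.collapse)
  have pt: "size (enc_pt x) \<le> Db p ?B * (2 + 2 * Mb ?B + 1)" if x: "x \<in> set X" for x
  proof -
    have "size (enc_pt x) \<le> length x * (2 + 2 * Mb ?B + 1)"
    proof (rule size_enc_list_le)
      fix a assume "a \<in> set x"
      then have "\<bar>a\<bar> \<le> int (Mb ?B)" using spec(5)[of x p a] x K by simp
      then show "size (enc_int a) \<le> 2 + 2 * Mb ?B" by (rule size_enc_int_le)
    qed
    also have "\<dots> \<le> Db p ?B * (2 + 2 * Mb ?B + 1)"
      using spec(1,4)[of p] x K by (intro mult_le_mono1) (auto simp: equal_clustering_insts_def)
    finally show ?thesis .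
  qed
  have "size (enc_pts X) \<le> length X * (Db p ?B * (2 + 2 * Mb ?B + 1) + 1)"
    by (rule size_enc_list_le) (rule pt)
  also have "\<dots> \<le> Nb ?B * (Db p ?B * (2 + 2 * Mb ?B + 1) + 1)" using spec(3)[of p] K by (intro mult_le_mono1) simp
  finally have 1: "size (enc_pts X) \<le> Nb ?B * (Db p ?B * (2 + 2 * Mb ?B + 1) + 1)" .
  have "X \<noteq> []" "k dvd length X" using spec(1)[of p] K by (auto simp: equal_clustering_insts_def)
  then have "k \<le> length X" by (intro dvd_imp_le) auto
  then have "size (enc_nat k) \<le> 2 * Nb ?B" using size_enc_nat_linear[of k] spec(3)[of p] K by simp
  then show ?thesis using 1 spec(2)[of p] K by (simp add: equal_clustering_def gb_def)
qed

lemma enc_inst_eq: "enc_inst (equal_clustering p) = ei"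
  by (intro ext) (auto simp: enc_inst_def equal_clustering_def enc_prod_def split: prod.splits)

lemma enc_sol_eq: "enc_sol (equal_clustering p) = enc_clu"
  by (simp add: equal_clustering_def)

lemma approx_kernel: "approx_kernel (equal_clustering p) 2 (gb p) (kernelize p) (lift_sol p)"
proof -
  have insts: "insts (equal_clustering p) = equal_clustering_insts" by (simp add: equal_clustering_def)
  have "polytime_on (insts (equal_clustering p)) (enc_inst (equal_clustering p)) (enc_inst (equal_clustering p)) (kernelize p)"
    unfolding enc_inst_eq by (rule polytime_on_subset[OF pt_kernel]) simp
  moreover have "polytime_on A
       (\<lambda>(J, J', s'). Node (enc_inst (equal_clustering p) J) (Node (enc_inst (equal_clustering p) J') (enc_sol (equal_clustering p) s')))
       (enc_sol (equal_clustering p)) (lift_sol p)" for A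
    unfolding enc_inst_eq enc_sol_eq
    by (rule polytime_on_subset[OF polytime_on_cong[OF pt_lift_sol]]) (auto simp: enc_prod_def)
  moreover have "lift_sol p (J, J', C) \<in> sols (equal_clustering p) J"
    if "J \<in> equal_clustering_insts" for J J' C
  proof -
    obtain X k B where J: "J = ((X, k), B)" by (metis prod.collapse)
    interpret kernel_inst p X k B using that by unfold_locales (simp add: J)
    show ?thesis unfolding J by (rule lift_sol_sols)
  qed
  moreover have "approx_ratio (equal_clustering p) J (lift_sol p (J, kernelize p J, C)) \<le>
      2 * approx_ratio (equal_clustering p) (kernelize p J) C"
    if "J \<in> equal_clustering_insts" "C \<in> sols (equal_clustering p) (kernelize p J)" for J C
  proof -
    obtain X k B where J: "J = ((X, k), B)" by (metis prod.collapse)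
    interpret kernel_inst p X k B using that by unfold_locales (simp add: J)
    show ?thesis using approx_ratio_lift[of C "kernelize p J"] that kernel_spec(1)[OF that(1)] unfolding J by blast
  qed
  ultimately show ?thesis
    unfolding approx_kernel_def insts using kernel_spec(1) kernel_enc_size by blast
qed

lemma Nb_bigo: "(\<lambda>B. real (Nb B)) \<in> O(\<lambda>B. real B ^ 2)"
proof (rule bigoI[where c = 9])
  have "real (Nb B) \<le> 9 * real B ^ 2" if "B \<ge> 1" for B
  proof -
    have "B \<le> B * B" "1 \<le> B * B" using that by auto
    moreover have "Nb B = 4 * (B * B) + 4 * B + 1" by (simp add: Nb_def algebra_simps)
    ultimately have "Nb B \<le> 9 * (B * B)" by linarith
    then have "real (Nb B) \<le> real (9 * (B * B))" by (simp only: of_nat_le_iff)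
    then show ?thesis by (simp add: power2_eq_square)
  qed
  then show "\<forall>\<^sub>F B in sequentially. norm (real (Nb B)) \<le> 9 * norm (real B ^ 2)"
    unfolding eventually_sequentially by (intro exI[of _ 1]) auto
qed

lemma Db_bigo: "(\<lambda>B. real (Db p B)) \<in> O(\<lambda>B. real B ^ (p + 2))"
proof (rule bigoI[where c = 4])
  have "real (Db p B) \<le> 4 * real B ^ (p + 2)" if "B \<ge> 1" for B
  proof -
    have "B * B ^ max p 1 = B ^ Suc (max p 1)" by simp
    also have "\<dots> \<le> B ^ (p + 2)" using that by (intro power_increasing) auto
    finally have "B * B ^ max p 1 \<le> B ^ (p + 2)" .
    moreover have "B \<le> B ^ (p + 2)" using that by (intro self_le_power) auto
    moreover have "1 \<le> B ^ (p + 2)" using that by simp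
    ultimately have "Db p B \<le> 4 * B ^ (p + 2)" unfolding Db_def by linarith
    then have "real (Db p B) \<le> real (4 * B ^ (p + 2))" by (simp only: of_nat_le_iff)
    then show ?thesis by simp
  qed
  then show "\<forall>\<^sub>F B in sequentially. norm (real (Db p B)) \<le> 4 * norm (real B ^ (p + 2))"
    unfolding eventually_sequentially by (intro exI[of _ 1]) auto
qed

lemma Mb_bigo: "(\<lambda>B. real (Mb B)) \<in> O(\<lambda>B. real B ^ 3)"
proof (rule bigoI[where c = 4])
  have "real (Mb B) \<le> 4 * real B ^ 3" if "B \<ge> 1" for B
  proof -
    have "B \<le> B ^ 3" "B ^ 2 \<le> B ^ 3" using that by (auto intro!: self_le_power power_increasing)
    moreover have "Mb B = 2 * B ^ 2 + 2 * B" by (simp add: Mb_def power2_eq_square algebra_simps)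
    ultimately have "Mb B \<le> 4 * B ^ 3" by linarith
    then have "real (Mb B) \<le> real (4 * B ^ 3)" by (simp only: of_nat_le_iff)
    then show ?thesis by simp
  qed
  then show "\<forall>\<^sub>F B in sequentially. norm (real (Mb B)) \<le> 4 * norm (real B ^ 3)"
    unfolding eventually_sequentially by (intro exI[of _ 1]) auto
qed

theorem theorem1:
  fixes p :: nat
  shows "\<exists>(g :: nat \<Rightarrow> nat) R L (N :: nat \<Rightarrow> nat) (D :: nat \<Rightarrow> nat) (M :: nat \<Rightarrow> nat).
    approx_kernel (equal_clustering p) 2 g R L \<and>
    (\<lambda>B. real (N B)) \<in> O(\<lambda>B. real B ^ 2) \<and>
    (\<lambda>B. real (D B)) \<in> O(\<lambda>B. real B ^ (p + 2)) \<and>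
    (\<lambda>B. real (M B)) \<in> O(\<lambda>B. real B ^ 3) \<and>
    (\<forall>X k B X' k' B'.
       ((X, k), B) \<in> insts (equal_clustering p) \<longrightarrow> R ((X, k), B) = ((X', k'), B') \<longrightarrow>
       length X' \<le> N B \<and>
       dimension X' \<le> D B \<and>
       (\<forall>x\<in>set X'. \<forall>a\<in>set x. \<bar>a\<bar> \<le> int (M B)))"
proof -
  have "length X' \<le> Nb B \<and> dimension X' \<le> Db p B \<and> (\<forall>x\<in>set X'. \<forall>a\<in>set x. \<bar>a\<bar> \<le> int (Mb B))"
    if "((X, k), B) \<in> insts (equal_clustering p)" "kernelize p ((X, k), B) = ((X', k'), B')" for X k B X' k' B'
  proof -
    have "((X, k), B) \<in> equal_clustering_insts" using that(1) by (simp add: equal_clustering_def)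
    note spec = kernel_spec[OF this]
    show ?thesis using spec(3,4)[of p] spec(5)[of _ p] that(2) by simp
  qed
  then have bounds: "\<forall>X k B X' k' B'.
       ((X, k), B) \<in> insts (equal_clustering p) \<longrightarrow> kernelize p ((X, k), B) = ((X', k'), B') \<longrightarrow>
       length X' \<le> Nb B \<and> dimension X' \<le> Db p B \<and> (\<forall>x\<in>set X'. \<forall>a\<in>set x. \<bar>a\<bar> \<le> int (Mb B))"
    by blast
  show ?thesis
    by (rule exI[of _ "gb p"], rule exI[of _ "kernelize p"], rule exI[of _ "lift_sol p"],
        rule exI[of _ Nb], rule exI[of _ "Db p"], rule exI[of _ Mb])
      (intro conjI approx_kernel Nb_bigo Db_bigo Mb_bigo bounds)
qed

end
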